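(* Let $\xi\ge0$, $\gamma>(2d-1)/2$, and let $\Lambda^{(1)}$ be the multiplier operator associated with $\lambda^{(1)}_{m,n}=\lambda^{(1)}(\max\{m,n\})$, where $\lambda^{(1)}(t)=t^{-\gamma}(\ln t)^{-\xi}$ for $t>1$ and $\lambda^{(1)}(t)=0$ for $0\le t\le1$. Then for all $m\in\mathbb{N}$ $$d_m(\Lambda^{(1)}U_p,L^q)\gg m^{-\gamma/(2d-1)}(\ln m)^{-\xi}\kappa_m,$$ where $$\kappa_m=\begin{cases}1,&1\le p\le2,\ 1<q\le2,\\1,&2\le p<\infty,\ 2\le q\le\infty,\\1,&1\le p\le2\le q\le\infty,\\(\ln m)^{-1/2},&1\le p\le2,\ q=1,\\(\ln m)^{-1/2},&p=\infty,\ 2\le q\le\infty.\end{cases}$$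
   Context: $\mathbb{N}=\{0,1,2,\dots\}$; $d\ge2$ is a fixed integer. The notation $a_m\gg b_m$ means that there is a constant $C>0$, independent of $m$, with $a_m\ge Cb_m$; here it is understood for $m\ge2$. $\Omega_d$ is the unit sphere of $\mathbb{C}^d$ with surface measure $\sigma_d$ (the Lebesgue surface measure of $S^{2d-1}\subset\mathbb{R}^{2d}$ under $\mathbb{C}^d\cong\mathbb{R}^{2d}$). $L^p=L^p(\Omega_d)$ is the usual space of complex-valued functions, with closed unit ball $U_p$. $\mathcal{H}_{m,n}$ is the space of restrictions to $\Omega_d$ of polynomials in $z,\bar z$ homogeneous of degree $m$ in $z$ and degree $n$ in $\bar z$ and in the kernel of $4\sum_j\partial^2/\partial z_j\partial\bar z_j$. Let $Z_w^{(m,n)}$ be the reproducing kernel of $\mathcal{H}_{m,n}$ at $w\in\Omega_d$, and $(\varphi*\widetilde Z^{(m,n)})(w)=\int_{\Omega_d}\varphi\,\overline{Z_w^{(m,n)}}\,d\sigma_d$ (the orthogonal projection onto $\mathcal{H}_{m,n}$ on $L^2$). The multiplier operator $\Lambda$ associated with $\{\lambda_{m,n}\}$ sends $\varphi$ to the function $\Lambda\varphi$ with formal expansion $\Lambda\varphi\sim\sum_{m,n}\lambda_{m,n}\varphi*\widetilde Z^{(m,n)}$. Standing assumption: the operator is bounded from $L^p$ to $L^q$, i.e. $\Lambda\varphi\in L^q$ for all $\varphi\in L^p$ and $\sup_{\varphi\in U_p}\|\Lambda\varphi\|_q<\infty$. Kolmogorov width: $d_n(A,X)=\inf_{X_n}\sup_{x\in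 A}\inf_{y\in X_n}\|x-y\|_X$, $X_n$ ranging over the subspaces of $X$ of dimension $n$. *)

theory Defs
  imports "HOL-Analysis.Analysis" "HOL-Probability.Essential_Supremum"
begin

text \<open>
  The ambient space is \<^typ>\<open>complex ^ 'd\<close>; its \<^const>\<open>norm\<close> is the Hermitian (equivalently,
  Euclidean) norm and its real dimension is \<open>2 * CARD('d)\<close>.
\<close>

text \<open>
  Surface measure is defined by polar coordinates: \<open>\<sigma> E = 2d * vol {t *\<^sub>R x | 0 < t \<le> 1, x \<in> E}\<close>.
\<close>

definition surface_measure :: "(complex ^ 'd::finite) measure" where
  "surface_measure =
     scale_measure (2 * of_nat CARD('d))
       (distr (restrict_space lborel (cball 0 1 - {0})) (restrict_space borel (sphere 0 1))
          (\<lambda>x. x /\<^sub>R norm x))"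

text \<open>
  Elements of \<open>L\<^sup>p\<close>, \<open>1 \<le> p \<le> \<infinity>\<close>, are represented by functions; almost everywhere equal functions
  represent the same element.  The value of \<open>Lp_norm p f\<close> is meaningful only for \<open>f \<in> Lp p\<close>.
\<close>

definition Lp :: "ennreal \<Rightarrow> ((complex ^ 'd::finite) \<Rightarrow> complex) set" where
  "Lp p = {f \<in> borel_measurable surface_measure.
     if p = \<infinity> then \<exists>C. AE x in surface_measure. norm (f x) \<le> C
     else integrable surface_measure (\<lambda>x. norm (f x) powr enn2real p)}"

definition Lp_norm :: "ennreal \<Rightarrow> ((complex ^ 'd::finite) \<Rightarrow> complex) \<Rightarrow> real" where
  "Lp_norm p f =
     (if p = \<infinity> then real_of_ereal (esssup surface_measure (\<lambda>x. ereal (norm (f x))))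
      else (LINT x|surface_measure. norm (f x) powr enn2real p) powr (1 / enn2real p))"

definition Lp_unit_ball :: "ennreal \<Rightarrow> ((complex ^ 'd::finite) \<Rightarrow> complex) set" where
  "Lp_unit_ball p = {f \<in> Lp p. Lp_norm p f \<le> 1}"

text \<open>\<open>\<partial>/\<partial>z\<^sub>j = (\<partial>/\<partial>x\<^sub>j - i \<partial>/\<partial>y\<^sub>j)/2\<close> and \<open>\<partial>/\<partial>\<bar>z\<^sub>j = (\<partial>/\<partial>x\<^sub>j + i \<partial>/\<partial>y\<^sub>j)/2\<close>.\<close>

definition wirt_z :: "'d \<Rightarrow> ((complex ^ 'd::finite) \<Rightarrow> complex) \<Rightarrow> complex ^ 'd \<Rightarrow> complex" where
  "wirt_z j f z =
     (frechet_derivative f (at z) (axis j 1) - \<i> * frechet_derivative f (at z) (axis j \<i>)) / 2"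

definition wirt_zbar :: "'d \<Rightarrow> ((complex ^ 'd::finite) \<Rightarrow> complex) \<Rightarrow> complex ^ 'd \<Rightarrow> complex" where
  "wirt_zbar j f z =
     (frechet_derivative f (at z) (axis j 1) + \<i> * frechet_derivative f (at z) (axis j \<i>)) / 2"

definition complex_laplacian :: "((complex ^ 'd::finite) \<Rightarrow> complex) \<Rightarrow> complex ^ 'd \<Rightarrow> complex" where
  "complex_laplacian f z = 4 * (\<Sum>j\<in>UNIV. wirt_z j (wirt_zbar j f) z)"

definition bihomogeneous_poly :: "nat \<Rightarrow> nat \<Rightarrow> ((complex ^ 'd::finite) \<Rightarrow> complex) \<Rightarrow> bool" where
  "bihomogeneous_poly m n P \<longleftrightarrow>
     (\<exists>c :: ('d \<Rightarrow> nat) \<Rightarrow> ('d \<Rightarrow> nat) \<Rightarrow> complex.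
        P = (\<lambda>z. \<Sum>\<alpha> | sum \<alpha> UNIV = m. \<Sum>\<beta> | sum \<beta> UNIV = n.
               c \<alpha> \<beta> * (\<Prod>j\<in>UNIV. (z $ j) ^ \<alpha> j * cnj (z $ j) ^ \<beta> j)))"

definition Hspace :: "nat \<Rightarrow> nat \<Rightarrow> ((complex ^ 'd::finite) \<Rightarrow> complex) set" where
  "Hspace m n =
     {restrict P (sphere 0 1) | P. bihomogeneous_poly m n P \<and> (\<forall>z. complex_laplacian P z = 0)}"

definition repr_kernel :: "nat \<Rightarrow> nat \<Rightarrow> complex ^ 'd::finite \<Rightarrow> complex ^ 'd \<Rightarrow> complex" where
  "repr_kernel m n w =
     (THE Z. Z \<in> Hspace m n \<and>
        (\<forall>f \<in> Hspace m n. (LINT z|surface_measure. f z * cnj (Z z)) = f w))"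

definition zonal_conv ::
    "((complex ^ 'd::finite) \<Rightarrow> complex) \<Rightarrow> nat \<Rightarrow> nat \<Rightarrow> complex ^ 'd \<Rightarrow> complex" where
  "zonal_conv \<phi> m n w = (LINT z|surface_measure. \<phi> z * cnj (repr_kernel m n w z))"

text \<open>
  \<open>multiplier_rel \<lambda> \<phi> \<psi>\<close> says that \<open>\<psi>\<close> is (a representative of) \<open>\<Lambda>\<phi>\<close>, i.e. that \<open>\<psi>\<close> has formal
  expansion \<open>\<Sum>\<lambda>\<^sub>m\<^sub>n \<phi> * Z\<^sup>(\<^sup>m\<^sup>,\<^sup>n\<^sup>)\<close>: the \<open>(m,n)\<close> component of \<open>\<psi>\<close> is the \<open>(m,n)\<close> term of that series.
  It is used only for \<open>\<phi>\<close> and \<open>\<psi>\<close> integrable, and determines \<open>\<psi>\<close> up to null sets.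
\<close>

definition multiplier_rel ::
    "(nat \<Rightarrow> nat \<Rightarrow> complex) \<Rightarrow> ((complex ^ 'd::finite) \<Rightarrow> complex) \<Rightarrow>
     (complex ^ 'd \<Rightarrow> complex) \<Rightarrow> bool" where
  "multiplier_rel l \<phi> \<psi> \<longleftrightarrow>
     (\<forall>m n. \<forall>w\<in>sphere 0 1. zonal_conv \<psi> m n w = l m n * zonal_conv \<phi> m n w)"

text \<open>The set \<open>\<Lambda> U\<^sub>p\<close> in \<open>L\<^sup>q\<close>.\<close>

definition multiplier_image ::
    "(nat \<Rightarrow> nat \<Rightarrow> complex) \<Rightarrow> ennreal \<Rightarrow> ennreal \<Rightarrow> ((complex ^ 'd::finite) \<Rightarrow> complex) set" where
  "multiplier_image l p q = {\<psi> \<in> Lp q. \<exists>\<phi> \<in> Lp_unit_ball p. multiplier_rel l \<phi> \<psi>}"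

definition multiplier_bounded ::
    "'d::finite itself \<Rightarrow> (nat \<Rightarrow> nat \<Rightarrow> complex) \<Rightarrow> ennreal \<Rightarrow> ennreal \<Rightarrow> bool" where
  "multiplier_bounded _ l p q \<longleftrightarrow>
     (\<forall>\<phi> \<in> (Lp p :: ((complex ^ 'd) \<Rightarrow> complex) set). \<exists>\<psi> \<in> Lp q. multiplier_rel l \<phi> \<psi>) \<and>
     bdd_above (Lp_norm q ` (multiplier_image l p q :: ((complex ^ 'd) \<Rightarrow> complex) set))"

text \<open>
  The \<open>n\<close>-dimensional complex subspaces of \<open>L\<^sup>q\<close>, each given by (representatives of) a basis; linear
  independence is that of the almost everywhere classes.
\<close>

definition Lp_subspaces :: "ennreal \<Rightarrow> nat \<Rightarrow> ((complex ^ 'd::finite) \<Rightarrow> complex) set set" where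
  "Lp_subspaces q n =
     {{(\<lambda>x. \<Sum>i<n. c i * b i x) | c. True} | b.
        (\<forall>i<n. b i \<in> Lp q) \<and>
        (\<forall>c. (AE x in surface_measure. (\<Sum>i<n. c i * b i x) = 0) \<longrightarrow> (\<forall>i<n. c i = 0))}"

definition kolmogorov_width ::
    "nat \<Rightarrow> ((complex ^ 'd::finite) \<Rightarrow> complex) set \<Rightarrow> ennreal \<Rightarrow> ennreal" where
  "kolmogorov_width n A q =
     (INF X \<in> Lp_subspaces q n. SUP f \<in> A. INF g \<in> X. ennreal (Lp_norm q (\<lambda>x. f x - g x)))"

definition lambda1 :: "real \<Rightarrow> real \<Rightarrow> real \<Rightarrow> real" where
  "lambda1 \<gamma> \<xi> t = (if t > 1 then t powr (- \<gamma>) * ln t powr (- \<xi>) else 0)"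

definition multiplier1 :: "real \<Rightarrow> real \<Rightarrow> nat \<Rightarrow> nat \<Rightarrow> complex" where
  "multiplier1 \<gamma> \<xi> m n = of_real (lambda1 \<gamma> \<xi> (real (max m n)))"

definition admissible_exponents :: "ennreal \<Rightarrow> ennreal \<Rightarrow> bool" where
  "admissible_exponents p q \<longleftrightarrow>
     (1 \<le> p \<and> p \<le> 2 \<and> 1 < q \<and> q \<le> 2) \<or>
     (2 \<le> p \<and> p < \<infinity> \<and> 2 \<le> q \<and> q \<le> \<infinity>) \<or>
     (1 \<le> p \<and> p \<le> 2 \<and> 2 \<le> q \<and> q \<le> \<infinity>) \<or>
     (1 \<le> p \<and> p \<le> 2 \<and> q = 1) \<or>
     (p = \<infinity> \<and> 2 \<le> q \<and> q \<le> \<infinity>)"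

text \<open>Unspecified outside \<^const>\<open>admissible_exponents\<close>.\<close>

definition kappa :: "ennreal \<Rightarrow> ennreal \<Rightarrow> nat \<Rightarrow> real" where
  "kappa p q m =
     (if 1 \<le> p \<and> p \<le> 2 \<and> 1 < q \<and> q \<le> 2 then 1
      else if 2 \<le> p \<and> p < \<infinity> \<and> 2 \<le> q \<and> q \<le> \<infinity> then 1
      else if 1 \<le> p \<and> p \<le> 2 \<and> 2 \<le> q \<and> q \<le> \<infinity> then 1
      else if 1 \<le> p \<and> p \<le> 2 \<and> q = 1 then ln (real m) powr (- 1 / 2)
      else if p = \<infinity> \<and> 2 \<le> q \<and> q \<le> \<infinity> then ln (real m) powr (- 1 / 2)
      else undefined)"

end

theory Submission
  imports Defs "HOL-Probability.Hoeffding"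
begin

text \<open>
  Throughout, \<open>\<sigma>\<close> is the area of the sphere, and constants depend only on \<open>d, p, q, \<gamma>, \<xi>\<close>.

  The bound comes from testing one well chosen element of \<open>\<Lambda>U\<^sub>p\<close> against a given subspace.  Let \<open>T\<close>
  be the space of restrictions of polynomials that have degree exactly \<open>N\<close> in \<open>z\<close> and degree at most
  \<open>N - 2\<close> in \<open>\<bar>z\<close>.  On the sphere it is the orthogonal sum of the harmonic spaces
  \<open>H\<^sub>k\<^sub>l\<close> with \<open>k \<le> N\<close> and \<open>l \<le> k - 2\<close>, so \<open>max k l\<close> lies between \<open>2\<close> and \<open>N\<close> on \<open>T\<close>: the
  degrees at which the multiplier vanishes are avoided and all its eigenvalues on \<open>T\<close> are at least
  \<open>\<lambda>(N)\<close>.  Counting monomials gives \<open>dim T \<ge> 2m\<close> for some \<open>N\<close> of order \<open>m\<close> to the power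
  \<open>1/(2d - 1)\<close>, and then \<open>\<lambda>(N)\<close> is of the order of the claimed bound without \<open>\<kappa>\<close>.

  The space \<open>T\<close> is invariant under unitary maps, which act transitively on the sphere; hence an
  orthonormal basis satisfies \<open>\<Sum>|e\<^sub>i(x)|\<^sup>2 = dim T / \<sigma>\<close> at every point (\<open>kernel_diag\<close>).  If \<open>m\<close> linear
  conditions are imposed on \<open>T\<close>, there remains an orthonormal family \<open>u\<^sub>1, \<dots>, u\<^sub>r\<close> with
  \<open>r \<ge> dim T / 2\<close>, and Bessel's inequality preserves the pointwise bound.  A combination of the
  \<open>u\<^sub>s\<close> with random signs has \<open>L\<^sup>2\<close> norm \<open>\<surd>r\<close>, while Khintchine's inequality bounds its \<open>2k\<close>-th moment by
  \<open>(C k dim T)\<^sup>k\<close>.  So every subspace of codimension \<open>m\<close> in \<open>T\<close> contains some \<open>\<phi>\<close> with \<open>L\<^sup>2\<close> norm \<open>1\<close>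
  and \<open>L\<^sup>2\<^sup>k\<close> norm at most \<open>C\<surd>k\<close> (\<open>flat_polynomial\<close>).  Since \<open>\<phi>\<^sup>k\<close> lies in a space of the same kind
  whose dimension is polynomial in \<open>kN\<close>, taking \<open>k\<close> close to \<open>ln N\<close> also bounds the maximum of \<open>\<phi>\<close>
  by \<open>C\<surd>(ln N)\<close> (\<open>flat_polynomial_sup\<close>).

  Let \<open>X\<close> be an \<open>m\<close>-dimensional subspace of \<open>L\<^sup>q\<close>.  If \<open>p, q \<le> 2\<close>, choose \<open>\<phi>\<close> orthogonal to \<open>X\<close>;
  a fixed multiple of \<open>\<phi>\<close> is in \<open>U\<^sub>p\<close>, and pairing \<open>\<Lambda>\<phi> - x\<close> with \<open>\<phi>\<close> shows that the distance of \<open>\<Lambda>\<phi>\<close>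
  to \<open>X\<close> is at least \<open>\<lambda>(N)\<close> divided by the norm of \<open>\<phi>\<close> in the dual of \<open>L\<^sup>q\<close>
  (\<open>width_dual_case\<close>).  If \<open>q \<ge> 2\<close>, choose \<open>\<phi>\<close> with \<open>\<Lambda>\<phi>\<close> orthogonal to \<open>X\<close>; before
  division by a bound for the \<open>L\<^sup>p\<close> norm of \<open>\<phi>\<close> the distance is at least \<open>\<lambda>(N)\<close> in \<open>L\<^sup>2\<close>, hence in \<open>L\<^sup>q\<close>
  (\<open>width_hilbert_case\<close>).  The maximum norm of \<open>\<phi>\<close> enters only for \<open>q = 1\<close> and for \<open>p = \<infinity>\<close>; this is
  the source of the factor \<open>(ln m)\<^sup>-\<^sup>1\<^sup>/\<^sup>2\<close>.

  That \<open>\<Lambda>\<close> acts diagonally on \<open>T\<close> rests on two facts about bihomogeneous polynomials on the sphere: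
  harmonic spaces of different bidegree are orthogonal, and every bihomogeneous polynomial is a sum of
  harmonic ones.  Both follow from one integral identity (\<open>green_identity\<close>), which expresses the invariance of
  surface measure under the one-parameter groups of complex reflections.
\<close>

section \<open>Linear isometries and surface measure\<close>

lemma nn_integral_lborel_shift:
  fixes h :: "'a::euclidean_space \<Rightarrow> ennreal"
  assumes [measurable]: "h \<in> borel_measurable borel"
  shows "(\<integral>\<^sup>+x. h (x + a) \<partial>lborel) = (\<integral>\<^sup>+x. h x \<partial>lborel)"
proof -
  have "(\<integral>\<^sup>+x. h x \<partial>lborel) = (\<integral>\<^sup>+x. h x \<partial>(distr lborel borel ((+) a)))"
    by (simp add: lborel_distr_plus)
  also have "\<dots> = (\<integral>\<^sup>+x. h (x + a) \<partial>lborel)"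
    by (subst nn_integral_distr) (auto simp: add.commute)
  finally show ?thesis by simp
qed

text \<open>
  Uniqueness of Haar measure, specialised.  With \<open>g\<close> the inverse of \<open>f\<close> and \<open>B\<close> the unit ball, evaluate
  the double integral of \<open>1\<^sub>A(f x) 1\<^sub>B(y)\<close> by shifting \<open>y\<close> by \<open>-f x\<close>, then \<open>x\<close> by \<open>g y\<close>, then \<open>y\<close> by
  \<open>-f x\<close>: since \<open>B\<close> is symmetric and preserved by \<open>f\<close>, the measures of \<open>f\<^sup>-\<^sup>1A\<close> and \<open>A\<close> become equal after
  multiplication by the measure of \<open>B\<close>.
\<close>

lemma lborel_linear_isometry:
  fixes f :: "'a::euclidean_space \<Rightarrow> 'a"
  assumes lin: "linear f" and iso: "\<And>x. norm (f x) = norm x"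
  shows "distr lborel borel f = lborel"
proof (rule measure_eqI)
  have cf: "continuous_on UNIV f"
    using lin by (simp add: linear_continuous_on linear_linear)
  have mf [measurable]: "f \<in> borel_measurable borel"
    using cf by (rule borel_measurable_continuous_onI)
  have inj: "inj f"
    using lin iso by (metis linear_injective_0 norm_eq_zero)
  then have surj: "surj f"
    using lin linear_injective_imp_surjective by blast
  define g where "g = inv f"
  have fg: "f (g y) = y" for y
    by (simp add: g_def surj surj_f_inv_f)
  show "sets (distr lborel borel f) = sets lborel" by simp
  fix A assume "A \<in> sets (distr lborel borel f)"
  then have A [measurable]: "A \<in> sets borel" by simp
  define B where "B = (cball 0 1 :: 'a set)"
  have B [measurable]: "B \<in> sets borel" unfolding B_def by simp
  have Bpos: "emeasure lborel B \<noteq> 0"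
  proof
    assume "emeasure lborel B = 0"
    then have "emeasure lebesgue B = 0" by (simp add: B_def)
    then have "negligible B" using B by (simp add: negligible_iff_null_sets null_sets_def B_def)
    moreover have "\<not> negligible (ball (0::'a) 1)"
      using open_not_negligible[of "ball (0::'a) 1"] by simp
    ultimately show False
      unfolding B_def by (meson ball_subset_cball negligible_subset)
  qed
  have Bfin: "emeasure lborel B \<noteq> \<infinity>"
    unfolding B_def using emeasure_lborel_cball_finite[of "0::'a" 1] by (metis infinity_ennreal_def less_irrefl)
  let ?A = "indicator A :: 'a \<Rightarrow> ennreal" and ?B = "indicator B :: 'a \<Rightarrow> ennreal"
  have "emeasure lborel (f -` A) * emeasure lborel B
      = (\<integral>\<^sup>+x. \<integral>\<^sup>+y. ?A (f x) * ?B y \<partial>lborel \<partial>lborel)"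
  proof -
    have [measurable]: "f -` A \<in> sets borel" using measurable_sets[OF mf A] by simp
    have "(\<integral>\<^sup>+y. ?A (f x) * ?B y \<partial>lborel) = indicator (f -` A) x * emeasure lborel B" for x
      by (subst nn_integral_cmult) (auto simp: indicator_def)
    then show ?thesis by (simp add: nn_integral_multc)
  qed
  also have "\<dots> = (\<integral>\<^sup>+x. \<integral>\<^sup>+y. ?A (f x) * ?B (y + - f x) \<partial>lborel \<partial>lborel)"
    by (intro nn_integral_cong nn_integral_lborel_shift[symmetric]) measurable
  also have "\<dots> = (\<integral>\<^sup>+y. \<integral>\<^sup>+x. ?A (f x) * ?B (y + - f x) \<partial>lborel \<partial>lborel)"
    by (rule lborel_pair.Fubini') measurable
  also have "\<dots> = (\<integral>\<^sup>+y. \<integral>\<^sup>+x. ?A (f (x + g y)) * ?B (y + - f (x + g y)) \<partial>lborel \<partial>lborel)"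
    by (intro nn_integral_cong nn_integral_lborel_shift[symmetric]) measurable
  also have "\<dots> = (\<integral>\<^sup>+y. \<integral>\<^sup>+x. ?A (y + f x) * ?B x \<partial>lborel \<partial>lborel)"
    using iso by (intro nn_integral_cong) (simp add: linear_add[OF lin] fg B_def indicator_def add.commute)
  also have "\<dots> = (\<integral>\<^sup>+x. \<integral>\<^sup>+y. ?A (y + f x) * ?B x \<partial>lborel \<partial>lborel)"
    by (rule lborel_pair.Fubini') measurable
  also have "\<dots> = (\<integral>\<^sup>+x. emeasure lborel A * ?B x \<partial>lborel)"
  proof (intro nn_integral_cong)
    fix x :: 'a
    have "(\<integral>\<^sup>+y. ?A (y + f x) * ?B x \<partial>lborel) = (\<integral>\<^sup>+y. ?A y * ?B x \<partial>lborel)"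
      by (rule nn_integral_lborel_shift) measurable
    also have "\<dots> = emeasure lborel A * ?B x" by (simp add: nn_integral_multc)
    finally show "(\<integral>\<^sup>+y. ?A (y + f x) * ?B x \<partial>lborel) = emeasure lborel A * ?B x" .
  qed
  also have "\<dots> = emeasure lborel A * emeasure lborel B"
    by (simp add: nn_integral_cmult)
  finally have "emeasure lborel (f -` A) = emeasure lborel A"
    using Bpos Bfin ennreal_mult_cancel_left[of "emeasure lborel B" "emeasure lborel (f -` A)" "emeasure lborel A"]
    by (auto simp: mult.commute)
  then show "emeasure (distr lborel borel f) A = emeasure lborel A"
    by (subst emeasure_distr) (auto simp: A)
qed

abbreviation usph :: "(complex ^ 'd::finite) set" where "usph \<equiv> sphere 0 1"

lemma space_surface [simp]: "space (surface_measure :: (complex ^ 'd::finite) measure) = usph"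
  by (simp add: surface_measure_def space_scale_measure space_restrict_space)

lemma sets_surface [measurable_cong, simp]:
  "sets (surface_measure :: (complex ^ 'd::finite) measure) = sets (restrict_space borel usph)"
  by (simp add: surface_measure_def)

lemma radial_measurable [measurable]:
  "(\<lambda>x. x /\<^sub>R norm x) \<in> measurable (restrict_space lborel (cball 0 1 - {0})) 
      (restrict_space borel (usph :: (complex ^ 'd::finite) set))"
  by (rule measurable_restrict_space3) auto

lemma emeasure_surface:
  assumes "E \<in> sets (restrict_space borel (usph :: (complex ^ 'd::finite) set))"
  shows "emeasure surface_measure E = 2 * of_nat CARD('d) * 
     emeasure lborel {x \<in> cball 0 1 - {0}. x /\<^sub>R norm x \<in> E}"
proof -
  have *: "(\<lambda>x. x /\<^sub>R norm x) -` E \<inter> space (restrict_space lborel (cball 0 1 - {0}))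
     = {x \<in> cball 0 1 - {0}. x /\<^sub>R norm x \<in> E}"
    by (auto simp: space_restrict_space)
  have "emeasure surface_measure E = 2 * of_nat CARD('d) * 
     emeasure (restrict_space lborel (cball 0 1 - {0})) {x \<in> cball 0 1 - {0}. x /\<^sub>R norm x \<in> E}"
    unfolding surface_measure_def emeasure_scale_measure
    by (subst emeasure_distr[OF radial_measurable assms]) (simp only: *)
  also have "emeasure (restrict_space lborel (cball 0 1 - {0})) {x \<in> cball 0 1 - {0}. x /\<^sub>R norm x \<in> E}
     = emeasure lborel {x \<in> cball 0 1 - {0}. x /\<^sub>R norm x \<in> E}"
    by (rule emeasure_restrict_space) auto
  finally show ?thesis .
qed

lemma surface_finite: "finite_measure (surface_measure :: (complex ^ 'd::finite) measure)"
proof (rule finite_measureI)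
  have "emeasure lborel {x \<in> cball 0 1 - {0}. x /\<^sub>R norm x \<in> (usph :: (complex ^ 'd) set)} 
     \<le> emeasure lborel (cball 0 1 :: (complex ^ 'd) set)"
    by (rule emeasure_mono) auto
  also have "\<dots> < \<infinity>" by (rule emeasure_lborel_cball_finite)
  finally have "emeasure lborel {x \<in> cball 0 1 - {0}. x /\<^sub>R norm x \<in> (usph :: (complex ^ 'd) set)} \<noteq> \<infinity>"
    by simp
  moreover have "emeasure surface_measure (usph :: (complex ^ 'd) set) = 2 * of_nat CARD('d) * 
     emeasure lborel {x \<in> cball 0 1 - {0}. x /\<^sub>R norm x \<in> (usph :: (complex ^ 'd) set)}"
    by (rule emeasure_surface) (auto simp: sets_restrict_space)
  ultimately show "emeasure (surface_measure :: (complex ^ 'd) measure) (space surface_measure) \<noteq> \<infinity>"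
    by (simp add: ennreal_mult_eq_top_iff)
qed

lemma surface_isometry:
  fixes f :: "complex ^ 'd::finite \<Rightarrow> complex ^ 'd"
  assumes lin: "linear f" and iso: "\<And>x. norm (f x) = norm x"
  shows "distr surface_measure surface_measure f = surface_measure"
proof (rule measure_eqI)
  have cf: "continuous_on UNIV f"
    using lin by (simp add: linear_continuous_on linear_linear)
  then have mf [measurable]: "f \<in> borel_measurable borel"
    by (rule borel_measurable_continuous_onI)
  have mr: "f \<in> measurable (restrict_space borel usph) (restrict_space borel usph)"
    by (rule measurable_restrict_space3) (auto simp: iso)
  then have ms [measurable]: "f \<in> measurable surface_measure surface_measure"
    by (simp cong: measurable_cong_sets)
  show "sets (distr surface_measure surface_measure f) = sets surface_measure" by simp
  fix E assume "E \<in> sets (distr surface_measure surface_measure f)"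
  then have E: "E \<in> sets (restrict_space borel (usph :: (complex ^ 'd) set))" by simp
  let ?C = "\<lambda>E. {x \<in> cball 0 1 - {0}. x /\<^sub>R norm x \<in> E} :: (complex ^ 'd) set"
  have E': "f -` E \<inter> usph \<in> sets (restrict_space borel (usph :: (complex ^ 'd) set))"
    using measurable_sets[OF mr E] by (simp add: space_restrict_space)
  have Cm: "?C E \<in> sets borel"
  proof -
    have "(\<lambda>x. x /\<^sub>R norm x) -` E \<inter> space (restrict_space lborel (cball 0 1 - {0}))
       \<in> sets (restrict_space lborel (cball 0 1 - {0}))"
      by (rule measurable_sets[OF radial_measurable E])
    also have "(\<lambda>x. x /\<^sub>R norm x) -` E \<inter> space (restrict_space lborel (cball 0 1 - {0})) = ?C E"
      by (auto simp: space_restrict_space)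
    finally show ?thesis
      by (auto simp: sets_restrict_space_iff)
  qed
  have fsc: "f (x /\<^sub>R norm x) = f x /\<^sub>R norm (f x)" for x
    using lin iso by (simp add: linear_cmul)
  have z: "f x = 0 \<longleftrightarrow> x = 0" for x using iso by (metis norm_eq_zero)
  have pre: "?C (f -` E \<inter> usph) = f -` ?C E"
    using E by (auto simp: fsc iso z sets_restrict_space)
  have "emeasure (distr surface_measure surface_measure f) E = emeasure surface_measure (f -` E \<inter> usph)"
    using E by (subst emeasure_distr) auto
  also have "\<dots> = 2 * of_nat CARD('d) * emeasure lborel (f -` ?C E)"
    by (simp only: emeasure_surface[OF E'] pre)
  also have "emeasure lborel (f -` ?C E) = emeasure (distr lborel borel f) (?C E)"
    using Cm by (subst emeasure_distr) auto
  also have "\<dots> = emeasure lborel (?C E)"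
    by (simp only: lborel_linear_isometry[OF lin iso])
  finally show "emeasure (distr surface_measure surface_measure f) E = emeasure surface_measure E"
    by (simp only: emeasure_surface[OF E])
qed

text \<open>
  A relatively open part of the sphere spans a cone with interior.  This makes the \<open>L\<^sup>2\<close> inner product
  definite on continuous functions.
\<close>

lemma surface_open_pos:
  assumes "open U" "U \<inter> (usph :: (complex ^ 'd::finite) set) \<noteq> {}"
  shows "emeasure surface_measure (U \<inter> usph) \<noteq> 0"
proof
  assume 0: "emeasure surface_measure (U \<inter> usph) = 0"
  have E: "U \<inter> usph \<in> sets (restrict_space borel (usph :: (complex ^ 'd) set))"
    using assms by (auto simp: sets_restrict_space)
  let ?C = "{x \<in> cball 0 1 - {0}. x /\<^sub>R norm x \<in> U \<inter> usph} :: (complex ^ 'd) set"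
  let ?O = "(ball 0 1 - {0}) \<inter> (\<lambda>x. x /\<^sub>R norm x) -` U :: (complex ^ 'd) set"
  have "open ?O"
    by (rule continuous_open_preimage) (auto intro!: continuous_intros simp: assms)
  moreover obtain u where u: "u \<in> U" "norm u = 1" using assms by auto
  have "(1/2) *\<^sub>R u \<in> ?O" using u by auto
  then have "?O \<noteq> {}" by blast
  ultimately have nn: "\<not> negligible ?O" by (rule open_not_negligible)
  have sub: "?O \<subseteq> ?C" by auto
  have "emeasure lborel ?C = 0" using 0 emeasure_surface[OF E] by simp
  have Ob: "?O \<in> sets borel" using \<open>open ?O\<close> by (rule borel_open)
  have Cm: "?C \<in> sets borel"
  proof -
    have "(\<lambda>x. x /\<^sub>R norm x) -` (U \<inter> usph) \<inter> space (restrict_space lborel (cball 0 1 - {0}))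
       \<in> sets (restrict_space lborel (cball 0 1 - {0}))"
      by (rule measurable_sets[OF radial_measurable E])
    also have "(\<lambda>x. x /\<^sub>R norm x) -` (U \<inter> usph) \<inter> space (restrict_space lborel (cball 0 1 - {0})) = ?C"
      by (auto simp: space_restrict_space)
    finally show ?thesis
      by (auto simp: sets_restrict_space_iff)
  qed
  have "emeasure lborel ?O \<le> emeasure lborel ?C"
    by (rule emeasure_mono[OF sub]) (use Cm in simp)
  then have "emeasure lborel ?O = 0" using \<open>emeasure lborel ?C = 0\<close> by simp
  then have "emeasure lebesgue ?O = 0" using Ob by simp
  then have "negligible ?O" using Ob by (simp add: negligible_iff_null_sets null_sets_def)
  then show False using nn by simp
qed

section \<open>Bihomogeneous polynomials\<close>

text \<open>
  An inductive description of \<^const>\<open>bihomogeneous_poly\<close>: every structural property of these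
  polynomials (derivatives, Euler's relation, composition with linear maps) is then proved by building
  a polynomial up one coordinate at a time, without coefficients.  The two notions agree by \<open>bihom_iff\<close>.
\<close>

inductive bihom :: "nat \<Rightarrow> nat \<Rightarrow> ((complex ^ 'd::finite) \<Rightarrow> complex) \<Rightarrow> bool" where
  bihom_const: "bihom 0 0 (\<lambda>z. c)"
| bihom_zmul: "bihom k l f \<Longrightarrow> bihom (Suc k) l (\<lambda>z. z $ j * f z)"
| bihom_cmul: "bihom k l f \<Longrightarrow> bihom k (Suc l) (\<lambda>z. cnj (z $ j) * f z)"
| bihom_add: "bihom k l f \<Longrightarrow> bihom k l g \<Longrightarrow> bihom k l (\<lambda>z. f z + g z)"

lemma bihom_scale: "bihom k l f \<Longrightarrow> bihom k l (\<lambda>z. c * f z)"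
proof (induction rule: bihom.induct)
  case (bihom_const c') show ?case by (rule bihom.bihom_const)
next
  case (bihom_zmul k l f j)
  from bihom.bihom_zmul[OF bihom_zmul.IH, of j] show ?case by (simp add: mult.left_commute)
next
  case (bihom_cmul k l f j)
  from bihom.bihom_cmul[OF bihom_cmul.IH, of j] show ?case by (simp add: mult.left_commute)
next
  case (bihom_add k l f g)
  from bihom.bihom_add[OF bihom_add.IH] show ?case by (simp add: distrib_left)
qed

lemma bihom_zero: "bihom k l (\<lambda>z. 0)"
proof (induction k)
  case 0 show ?case
  proof (induction l)
    case 0 show ?case by (rule bihom_const)
  next
    case (Suc l) from bihom_cmul[OF Suc] show ?case by simp
  qed
next
  case (Suc k) from bihom_zmul[OF Suc] show ?case by simp
qed

lemma bihom_sum: "(\<And>i. i \<in> A \<Longrightarrow> bihom k l (f i)) \<Longrightarrow> bihom k l (\<lambda>z. \<Sum>i\<in>A. f i z)"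
  by (induction A rule: infinite_finite_induct) (auto intro: bihom_zero bihom_add)

lemma bihom_diff: "bihom k l f \<Longrightarrow> bihom k l g \<Longrightarrow> bihom k l (\<lambda>z. f z - g z)"
  using bihom_add[of k l f "\<lambda>z. (-1) * g z"] bihom_scale[of k l g "-1"] by simp

lemma bihom_coord: "bihom (Suc 0) 0 (\<lambda>z. z $ j)" "bihom 0 (Suc 0) (\<lambda>z. cnj (z $ j))"
  using bihom_zmul[OF bihom_const[of 1], of j] bihom_cmul[OF bihom_const[of 1], of j] by simp_all

lemma bihom_mult: "bihom k l f \<Longrightarrow> bihom k' l' g \<Longrightarrow> bihom (k + k') (l + l') (\<lambda>z. f z * g z)"
proof (induction rule: bihom.induct)
  case (bihom_const c) then show ?case by (simp add: bihom_scale)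
next
  case (bihom_zmul k l f j)
  from bihom.bihom_zmul[OF bihom_zmul.IH[OF bihom_zmul.prems], of j] show ?case by (simp add: mult.assoc)
next
  case (bihom_cmul k l f j)
  from bihom.bihom_cmul[OF bihom_cmul.IH[OF bihom_cmul.prems], of j] show ?case by (simp add: mult.assoc)
next
  case (bihom_add k l f g')
  from bihom.bihom_add[OF bihom_add.IH(1)[OF bihom_add.prems] bihom_add.IH(2)[OF bihom_add.prems]]
  show ?case by (simp add: distrib_right)
qed

lemma bihom_power: "bihom k l f \<Longrightarrow> bihom (n * k) (n * l) (\<lambda>z. f z ^ n)"
proof (induction n)
  case 0 show ?case by (simp add: bihom_const)
next
  case (Suc n) from bihom_mult[OF Suc.prems Suc.IH[OF Suc.prems]] show ?case by simp
qed

lemma bihom_prod: "finite A \<Longrightarrow> (\<And>i. i \<in> A \<Longrightarrow> bihom (k i) (l i) (f i)) \<Longrightarrow>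
   bihom (sum k A) (sum l A) (\<lambda>z. \<Prod>i\<in>A. f i z)"
proof (induction A rule: finite_induct)
  case empty show ?case by (simp add: bihom_const)
next
  case (insert x F)
  then have "bihom (k x + sum k F) (l x + sum l F) (\<lambda>z. f x z * (\<Prod>i\<in>F. f i z))"
    by (intro bihom_mult) auto
  with insert show ?case by simp
qed

lemma bihom_cnj: "bihom k l f \<Longrightarrow> bihom l k (\<lambda>z. cnj (f z))"
proof (induction rule: bihom.induct)
  case (bihom_const c) show ?case by (rule bihom.bihom_const)
next
  case (bihom_zmul k l f j)
  from bihom.bihom_cmul[OF bihom_zmul.IH, of j] show ?case by simp
next
  case (bihom_cmul k l f j)
  from bihom.bihom_zmul[OF bihom_cmul.IH, of j] show ?case by simp
next
  case (bihom_add k l f g)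
  from bihom.bihom_add[OF bihom_add.IH] show ?case by simp
qed

lemma bihom_compose:
  assumes "bihom k l f" "\<And>j. bihom (Suc 0) 0 (\<lambda>z. R z $ j)"
  shows "bihom k l (\<lambda>z. f (R z))"
  using assms(1)
proof (induction rule: bihom.induct)
  case (bihom_const c) show ?case by (rule bihom.bihom_const)
next
  case (bihom_zmul k l f j)
  from bihom_mult[OF assms(2)[of j] bihom_zmul.IH] show ?case by simp
next
  case (bihom_cmul k l f j)
  from bihom_mult[OF bihom_cnj[OF assms(2)[of j]] bihom_cmul.IH] show ?case by simp
next
  case (bihom_add k l f g)
  from bihom.bihom_add[OF bihom_add.IH] show ?case by simp
qed

definition normsq :: "complex ^ 'd::finite \<Rightarrow> complex" where
  "normsq z = (\<Sum>j\<in>UNIV. z $ j * cnj (z $ j))"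

lemma normsq_eq: "normsq z = of_real ((norm z)\<^sup>2)"
  by (simp add: normsq_def norm_vec_def L2_set_def real_sqrt_pow2 sum_nonneg
      complex_norm_square[symmetric])

lemma normsq_sphere: "z \<in> usph \<Longrightarrow> normsq z = 1"
  by (simp add: normsq_eq)

lemma bihom_normsq: "bihom (Suc 0) (Suc 0) normsq"
proof -
  have "bihom (Suc 0) (Suc 0) (\<lambda>z::complex^'d. \<Sum>j\<in>UNIV. z $ j * cnj (z $ j))"
    by (intro bihom_sum bihom_zmul bihom_coord)
  then show ?thesis by (simp add: normsq_def[abs_def])
qed

lemma bihom_homogeneous: "bihom k l f \<Longrightarrow> f (t *\<^sub>R z) = of_real t ^ (k + l) * f z"
proof (induction rule: bihom.induct)
  case (bihom_zmul k l f j)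
  have "(t *\<^sub>R z) $ j = of_real t * z $ j" by (simp add: scaleR_conv_of_real[of t "z $ j"])
  then show ?case using bihom_zmul.IH by simp
next
  case (bihom_cmul k l f j)
  have "(t *\<^sub>R z) $ j = of_real t * z $ j" by (simp add: scaleR_conv_of_real[of t "z $ j"])
  then show ?case using bihom_cmul.IH by simp
next
  case (bihom_add k l f g)
  then show ?case by (simp add: distrib_left)
qed simp

definition zmon :: "('d::finite \<Rightarrow> nat) \<Rightarrow> ('d \<Rightarrow> nat) \<Rightarrow> complex ^ 'd \<Rightarrow> complex" where
  "zmon \<alpha> \<beta> z = (\<Prod>j\<in>UNIV. (z $ j) ^ \<alpha> j * cnj (z $ j) ^ \<beta> j)"

lemma finite_exponents: "finite {\<alpha> :: 'd::finite \<Rightarrow> nat. sum \<alpha> UNIV = m}"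
proof (rule finite_subset)
  show "{\<alpha> :: 'd \<Rightarrow> nat. sum \<alpha> UNIV = m} \<subseteq> (UNIV :: 'd set) \<rightarrow>\<^sub>E {..m}"
    by (auto simp: member_le_sum)
  show "finite ((UNIV :: 'd set) \<rightarrow>\<^sub>E {..m})" by (intro finite_PiE) auto
qed

lemma bihom_zmon: "bihom (sum \<alpha> UNIV) (sum \<beta> UNIV) (zmon \<alpha> \<beta>)"
proof -
  have "bihom (\<alpha> j) (\<beta> j) (\<lambda>z. (z $ j) ^ \<alpha> j * cnj (z $ j) ^ \<beta> j)" for j :: 'a
    using bihom_mult[OF bihom_power[OF bihom_coord(1)[of j], of "\<alpha> j"] bihom_power[OF bihom_coord(2)[of j], of "\<beta> j"]]
    by simp
  with bihom_prod[of UNIV \<alpha> \<beta> "\<lambda>j z. (z $ j) ^ \<alpha> j * cnj (z $ j) ^ \<beta> j"] show ?thesis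
    by (simp add: zmon_def[abs_def])
qed

lemma bihomogeneous_poly_zmon:
  assumes "sum \<alpha> UNIV = k" "sum \<beta> UNIV = l"
  shows "bihomogeneous_poly k l (zmon \<alpha> \<beta> :: complex ^ 'd::finite \<Rightarrow> complex)"
  unfolding bihomogeneous_poly_def
proof (intro exI ext)
  fix z :: "complex ^ 'd"
  have "(\<Sum>a | sum a UNIV = k. \<Sum>b | sum b UNIV = l.
      (if a = \<alpha> then if b = \<beta> then 1 else 0 else 0) * zmon a b z)
      = (\<Sum>a | sum a UNIV = k. if a = \<alpha> then zmon \<alpha> \<beta> z else 0)"
  proof (intro sum.cong refl)
    fix a
    have "(\<Sum>b | sum b UNIV = l. (if b = \<beta> then 1 else 0) * zmon \<alpha> b z)
       = (\<Sum>b | sum b UNIV = l. if b = \<beta> then zmon \<alpha> \<beta> z else 0)"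
      by (intro sum.cong) auto
    also have "\<dots> = zmon \<alpha> \<beta> z" using assms(2) by (simp add: finite_exponents)
    finally show "(\<Sum>b | sum b UNIV = l. (if a = \<alpha> then if b = \<beta> then 1 else 0 else 0) * zmon a b z)
      = (if a = \<alpha> then zmon \<alpha> \<beta> z else 0)" by simp
  qed
  also have "\<dots> = zmon \<alpha> \<beta> z" using assms(1) by (simp add: finite_exponents)
  finally show "zmon \<alpha> \<beta> z = (\<Sum>a | sum a UNIV = k. \<Sum>b | sum b UNIV = l.
      (if a = \<alpha> then if b = \<beta> then 1 else 0 else 0) * (\<Prod>j\<in>UNIV. (z $ j) ^ a j * cnj (z $ j) ^ b j))"
    by (simp add: zmon_def)
qed

lemma bihomogeneous_polyE:
  assumes "bihomogeneous_poly k l f"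
  obtains c where "f = (\<lambda>z. \<Sum>\<alpha> | sum \<alpha> UNIV = k. \<Sum>\<beta> | sum \<beta> UNIV = l. c \<alpha> \<beta> * zmon \<alpha> \<beta> z)"
  using assms unfolding bihomogeneous_poly_def zmon_def by (elim exE)

lemma bihomogeneous_poly_add:
  assumes "bihomogeneous_poly k l f" "bihomogeneous_poly k l g"
  shows "bihomogeneous_poly k l (\<lambda>z. f z + g z)"
proof -
  obtain c where "f = (\<lambda>z. \<Sum>\<alpha> | sum \<alpha> UNIV = k. \<Sum>\<beta> | sum \<beta> UNIV = l. c \<alpha> \<beta> * zmon \<alpha> \<beta> z)"
    using assms(1) by (rule bihomogeneous_polyE)
  moreover obtain c' where "g = (\<lambda>z. \<Sum>\<alpha> | sum \<alpha> UNIV = k. \<Sum>\<beta> | sum \<beta> UNIV = l. c' \<alpha> \<beta> * zmon \<alpha> \<beta> z)"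
    using assms(2) by (rule bihomogeneous_polyE)
  ultimately have "(\<lambda>z. f z + g z) = (\<lambda>z. \<Sum>\<alpha> | sum \<alpha> UNIV = k. \<Sum>\<beta> | sum \<beta> UNIV = l.
      (c \<alpha> \<beta> + c' \<alpha> \<beta>) * zmon \<alpha> \<beta> z)"
    by (simp add: sum.distrib distrib_right)
  then show ?thesis unfolding bihomogeneous_poly_def zmon_def by (intro exI)
qed

lemma bihomogeneous_poly_scale:
  assumes "bihomogeneous_poly k l f"
  shows "bihomogeneous_poly k l (\<lambda>z. x * f z)"
proof -
  obtain c where "f = (\<lambda>z. \<Sum>\<alpha> | sum \<alpha> UNIV = k. \<Sum>\<beta> | sum \<beta> UNIV = l. c \<alpha> \<beta> * zmon \<alpha> \<beta> z)"
    using assms by (rule bihomogeneous_polyE)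
  then have "(\<lambda>z. x * f z) = (\<lambda>z. \<Sum>\<alpha> | sum \<alpha> UNIV = k. \<Sum>\<beta> | sum \<beta> UNIV = l.
      (x * c \<alpha> \<beta>) * zmon \<alpha> \<beta> z)"
    by (simp add: sum_distrib_left mult.assoc)
  then show ?thesis unfolding bihomogeneous_poly_def zmon_def by (intro exI)
qed

lemma bihomogeneous_poly_sum:
  "(\<And>i. i \<in> A \<Longrightarrow> bihomogeneous_poly k l (f i)) \<Longrightarrow> bihomogeneous_poly k l (\<lambda>z. \<Sum>i\<in>A. f i z)"
proof (induction A rule: infinite_finite_induct)
  case empty
  show ?case unfolding bihomogeneous_poly_def by (rule exI[of _ "\<lambda>_ _. 0"]) simp
next
  case (infinite A)
  then show ?case unfolding bihomogeneous_poly_def by (intro exI[of _ "\<lambda>_ _. 0"]) simp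
next
  case (insert x F)
  then show ?case by (simp add: bihomogeneous_poly_add)
qed

lemma zmon_zmul: "z $ j * zmon \<alpha> \<beta> z = zmon (\<alpha>(j := Suc (\<alpha> j))) \<beta> z"
  and zmon_cmul: "cnj (z $ j) * zmon \<alpha> \<beta> z = zmon \<alpha> (\<beta>(j := Suc (\<beta> j))) z"
proof -
  have *: "(\<Prod>i\<in>UNIV-{j}. (z $ i) ^ (\<alpha>(j := Suc (\<alpha> j))) i * cnj (z $ i) ^ \<beta> i)
     = (\<Prod>i\<in>UNIV-{j}. (z $ i) ^ \<alpha> i * cnj (z $ i) ^ \<beta> i)"
    "(\<Prod>i\<in>UNIV-{j}. (z $ i) ^ \<alpha> i * cnj (z $ i) ^ (\<beta>(j := Suc (\<beta> j))) i)
     = (\<Prod>i\<in>UNIV-{j}. (z $ i) ^ \<alpha> i * cnj (z $ i) ^ \<beta> i)"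
    by (intro prod.cong; simp)+
  show "z $ j * zmon \<alpha> \<beta> z = zmon (\<alpha>(j := Suc (\<alpha> j))) \<beta> z"
    "cnj (z $ j) * zmon \<alpha> \<beta> z = zmon \<alpha> (\<beta>(j := Suc (\<beta> j))) z"
    unfolding zmon_def by (subst (1 2) prod.remove[of UNIV j]; simp add: *)+
qed

lemma sum_upd_Suc: "sum (\<alpha>(j := Suc (\<alpha> j))) UNIV = Suc (sum \<alpha> (UNIV :: 'd::finite set))"
proof -
  have *: "sum (\<alpha>(j := Suc (\<alpha> j))) (UNIV - {j}) = sum \<alpha> (UNIV - {j})"
    by (intro sum.cong) auto
  show ?thesis by (subst (1 2) sum.remove[of UNIV j]) (simp_all only: *, simp_all)
qed

lemma bihom_iff: "bihom k l f \<longleftrightarrow> bihomogeneous_poly k l f"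
proof
  assume "bihom k l f"
  then show "bihomogeneous_poly k l f"
  proof (induction rule: bihom.induct)
    case (bihom_const c)
    have "bihomogeneous_poly 0 0 (zmon (\<lambda>_. 0) (\<lambda>_. 0) :: complex ^ 'a \<Rightarrow> complex)"
      by (rule bihomogeneous_poly_zmon) auto
    from bihomogeneous_poly_scale[OF this, of c] show ?case by (simp add: zmon_def)
  next
    case (bihom_zmul k l f j)
    from this(2) obtain c where f: "f = (\<lambda>z. \<Sum>\<alpha> | sum \<alpha> UNIV = k. \<Sum>\<beta> | sum \<beta> UNIV = l. c \<alpha> \<beta> * zmon \<alpha> \<beta> z)"
      by (rule bihomogeneous_polyE)
    have "(\<lambda>z. z $ j * f z) = (\<lambda>z. \<Sum>\<alpha> | sum \<alpha> UNIV = k. \<Sum>\<beta> | sum \<beta> UNIV = l. c \<alpha> \<beta> * zmon (\<alpha>(j := Suc (\<alpha> j))) \<beta> z)"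
      unfolding f zmon_zmul[symmetric] by (simp add: sum_distrib_left mult.left_commute)
    moreover have "bihomogeneous_poly (Suc k) l \<dots>"
      by (intro bihomogeneous_poly_sum bihomogeneous_poly_scale bihomogeneous_poly_zmon) (auto simp: sum_upd_Suc simp del: fun_upd_apply)
    ultimately show ?case by simp
  next
    case (bihom_cmul k l f j)
    from this(2) obtain c where f: "f = (\<lambda>z. \<Sum>\<alpha> | sum \<alpha> UNIV = k. \<Sum>\<beta> | sum \<beta> UNIV = l. c \<alpha> \<beta> * zmon \<alpha> \<beta> z)"
      by (rule bihomogeneous_polyE)
    have "(\<lambda>z. cnj (z $ j) * f z) = (\<lambda>z. \<Sum>\<alpha> | sum \<alpha> UNIV = k. \<Sum>\<beta> | sum \<beta> UNIV = l. c \<alpha> \<beta> * zmon \<alpha> (\<beta>(j := Suc (\<beta> j))) z)"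
      unfolding f zmon_cmul[symmetric] by (simp add: sum_distrib_left mult.left_commute)
    moreover have "bihomogeneous_poly k (Suc l) \<dots>"
      by (intro bihomogeneous_poly_sum bihomogeneous_poly_scale bihomogeneous_poly_zmon) (auto simp: sum_upd_Suc simp del: fun_upd_apply)
    ultimately show ?case by simp
  next
    case (bihom_add k l f g)
    then show ?case by (intro bihomogeneous_poly_add)
  qed
next
  assume "bihomogeneous_poly k l f"
  then obtain c where f: "f = (\<lambda>z. \<Sum>\<alpha> | sum \<alpha> UNIV = k. \<Sum>\<beta> | sum \<beta> UNIV = l. c \<alpha> \<beta> * zmon \<alpha> \<beta> z)"
    by (rule bihomogeneous_polyE)
  show "bihom k l f" unfolding f
    using bihom_zmon by (intro bihom_sum bihom_scale) auto
qed

section \<open>Wirtinger derivatives of polynomials\<close>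

lemma bihom_differentiable: "bihom k l f \<Longrightarrow> f differentiable (at z)"
proof (induction rule: bihom.induct)
  case (bihom_zmul k l f j)
  have "(\<lambda>z::complex^'a. z $ j) differentiable (at z)"
    by (simp add: bounded_linear_imp_differentiable bounded_linear_vec_nth)
  then show ?case using bihom_zmul by simp
next
  case (bihom_cmul k l f j)
  have "bounded_linear (\<lambda>z::complex^'a. cnj (z $ j))"
    by (rule bounded_linear_compose[OF bounded_linear_cnj bounded_linear_vec_nth])
  then have "(\<lambda>z::complex^'a. cnj (z $ j)) differentiable (at z)"
    by (rule bounded_linear_imp_differentiable)
  then show ?case using bihom_cmul by simp
qed simp_all

lemma bihom_continuous: "bihom k l f \<Longrightarrow> continuous_on A f"
  by (intro continuous_at_imp_continuous_on ballI differentiable_imp_continuous_within bihom_differentiable)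

lemma frechet_derivative_mult':
  fixes f g :: "complex ^ 'd::finite \<Rightarrow> complex"
  assumes "f differentiable (at z)" "g differentiable (at z)"
  shows "frechet_derivative (\<lambda>z. f z * g z) (at z) v
     = frechet_derivative f (at z) v * g z + f z * frechet_derivative g (at z) v"
proof -
  have "((\<lambda>z. f z * g z) has_derivative
     (\<lambda>v. f z * frechet_derivative g (at z) v + frechet_derivative f (at z) v * g z)) (at z)"
    using assms by (intro has_derivative_mult) (auto simp: frechet_derivative_works)
  then show ?thesis by (simp add: frechet_derivative_at[symmetric] add.commute)
qed

lemma frechet_derivative_add':
  fixes f g :: "complex ^ 'd::finite \<Rightarrow> complex"
  assumes "f differentiable (at z)" "g differentiable (at z)"
  shows "frechet_derivative (\<lambda>z. f z + g z) (at z) v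
     = frechet_derivative f (at z) v + frechet_derivative g (at z) v"
proof -
  have "((\<lambda>z. f z + g z) has_derivative
     (\<lambda>v. frechet_derivative f (at z) v + frechet_derivative g (at z) v)) (at z)"
    using assms by (intro has_derivative_add) (auto simp: frechet_derivative_works)
  then show ?thesis by (simp add: frechet_derivative_at[symmetric])
qed

lemma frechet_derivative_coord:
  "frechet_derivative (\<lambda>z::complex^'d::finite. z $ i) (at z) v = v $ i"
  "frechet_derivative (\<lambda>z::complex^'d::finite. cnj (z $ i)) (at z) v = cnj (v $ i)"
proof -
  have 1: "((\<lambda>z::complex^'d. z $ i) has_derivative (\<lambda>z. z $ i)) (at z)"
    by (rule bounded_linear_imp_has_derivative[OF bounded_linear_vec_nth])
  have 2: "((\<lambda>z::complex^'d. cnj (z $ i)) has_derivative (\<lambda>z. cnj (z $ i))) (at z)"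
    by (rule bounded_linear_imp_has_derivative[OF bounded_linear_compose[OF bounded_linear_cnj bounded_linear_vec_nth]])
  show "frechet_derivative (\<lambda>z::complex^'d. z $ i) (at z) v = v $ i"
    by (simp add: frechet_derivative_at[OF 1, symmetric])
  show "frechet_derivative (\<lambda>z::complex^'d. cnj (z $ i)) (at z) v = cnj (v $ i)"
    by (simp add: frechet_derivative_at[OF 2, symmetric])
qed

lemma wirt_coord:
  "wirt_z j (\<lambda>z::complex^'d::finite. z $ i) z = (if i = j then 1 else 0)"
  "wirt_zbar j (\<lambda>z::complex^'d::finite. z $ i) z = 0"
  "wirt_z j (\<lambda>z::complex^'d::finite. cnj (z $ i)) z = 0"
  "wirt_zbar j (\<lambda>z::complex^'d::finite. cnj (z $ i)) z = (if i = j then 1 else 0)"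
  by (auto simp: wirt_z_def wirt_zbar_def frechet_derivative_coord axis_def)

lemma wirt_mult:
  assumes "f differentiable (at z)" "g differentiable (at z)"
  shows "wirt_z j (\<lambda>z. f z * g z) z = wirt_z j f z * g z + f z * wirt_z j g z"
    "wirt_zbar j (\<lambda>z. f z * g z) z = wirt_zbar j f z * g z + f z * wirt_zbar j g z"
  by (simp_all add: wirt_z_def wirt_zbar_def frechet_derivative_mult'[OF assms] field_simps)

lemma wirt_add:
  assumes "f differentiable (at z)" "g differentiable (at z)"
  shows "wirt_z j (\<lambda>z. f z + g z) z = wirt_z j f z + wirt_z j g z"
    "wirt_zbar j (\<lambda>z. f z + g z) z = wirt_zbar j f z + wirt_zbar j g z"
  by (simp_all add: wirt_z_def wirt_zbar_def frechet_derivative_add'[OF assms] field_simps)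

lemma wirt_const: "wirt_z j (\<lambda>z. c) z = 0" "wirt_zbar j (\<lambda>z. c) z = 0"
  by (simp_all add: wirt_z_def wirt_zbar_def)

lemmas bihom_coord_differentiable = bihom_differentiable[OF bihom_coord(1)] bihom_differentiable[OF bihom_coord(2)]

lemma wirt_zmul:
  assumes "f differentiable (at z)"
  shows "wirt_z j (\<lambda>z. z $ i * f z) z = (if i = j then f z else 0) + z $ i * wirt_z j f z"
    "wirt_zbar j (\<lambda>z. z $ i * f z) z = z $ i * wirt_zbar j f z"
    "wirt_z j (\<lambda>z. cnj (z $ i) * f z) z = cnj (z $ i) * wirt_z j f z"
    "wirt_zbar j (\<lambda>z. cnj (z $ i) * f z) z = (if i = j then f z else 0) + cnj (z $ i) * wirt_zbar j f z"
  by (simp_all add: wirt_mult[OF bihom_coord_differentiable(1) assms]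
      wirt_mult[OF bihom_coord_differentiable(2) assms] wirt_coord)

text \<open>
  In degree \<open>0\<close> the derivative vanishes instead of having degree \<open>-1\<close>; the case distinction keeps the
  induction in one statement.
\<close>

lemma bihom_wirt_z_aux:
  "bihom k l f \<Longrightarrow> (case k of 0 \<Rightarrow> wirt_z j f = (\<lambda>_. 0) | Suc k' \<Rightarrow> bihom k' l (wirt_z j f))"
proof (induction rule: bihom.induct)
  case (bihom_const c) show ?case by (simp add: fun_eq_iff wirt_const)
next
  case (bihom_zmul k l f i)
  have e: "wirt_z j (\<lambda>z. z $ i * f z) = (\<lambda>z. (if i = j then f z else 0) + z $ i * wirt_z j f z)"
    by (intro ext wirt_zmul bihom_differentiable[OF bihom_zmul.hyps])
  have 1: "bihom k l (\<lambda>z. if i = j then f z else 0)"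
    using bihom_zmul.hyps bihom_zero by (cases "i = j") auto
  have 2: "bihom k l (\<lambda>z. z $ i * wirt_z j f z)"
    using bihom_zmul.IH by (cases k) (auto intro: bihom_zero bihom.bihom_zmul)
  show ?case unfolding e using bihom_add[OF 1 2] by simp
next
  case (bihom_cmul k l f i)
  have e: "wirt_z j (\<lambda>z. cnj (z $ i) * f z) = (\<lambda>z. cnj (z $ i) * wirt_z j f z)"
    by (intro ext wirt_zmul bihom_differentiable[OF bihom_cmul.hyps])
  show ?case unfolding e using bihom_cmul.IH by (cases k) (auto intro: bihom.bihom_cmul)
next
  case (bihom_add k l f g)
  have e: "wirt_z j (\<lambda>z. f z + g z) = (\<lambda>z. wirt_z j f z + wirt_z j g z)"
    by (intro ext wirt_add bihom_differentiable[OF bihom_add.hyps(1)] bihom_differentiable[OF bihom_add.hyps(2)])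
  show ?case unfolding e using bihom_add.IH by (cases k) (auto intro: bihom.bihom_add)
qed

lemma bihom_wirt_zbar_aux:
  "bihom k l f \<Longrightarrow> (case l of 0 \<Rightarrow> wirt_zbar j f = (\<lambda>_. 0) | Suc l' \<Rightarrow> bihom k l' (wirt_zbar j f))"
proof (induction rule: bihom.induct)
  case (bihom_const c) show ?case by (simp add: fun_eq_iff wirt_const)
next
  case (bihom_cmul k l f i)
  have e: "wirt_zbar j (\<lambda>z. cnj (z $ i) * f z) = (\<lambda>z. (if i = j then f z else 0) + cnj (z $ i) * wirt_zbar j f z)"
    by (intro ext wirt_zmul bihom_differentiable[OF bihom_cmul.hyps])
  have 1: "bihom k l (\<lambda>z. if i = j then f z else 0)"
    using bihom_cmul.hyps bihom_zero by (cases "i = j") auto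
  have 2: "bihom k l (\<lambda>z. cnj (z $ i) * wirt_zbar j f z)"
    using bihom_cmul.IH by (cases l) (auto intro: bihom_zero bihom.bihom_cmul)
  show ?case unfolding e using bihom_add[OF 1 2] by simp
next
  case (bihom_zmul k l f i)
  have e: "wirt_zbar j (\<lambda>z. z $ i * f z) = (\<lambda>z. z $ i * wirt_zbar j f z)"
    by (intro ext wirt_zmul bihom_differentiable[OF bihom_zmul.hyps])
  show ?case unfolding e using bihom_zmul.IH by (cases l) (auto intro: bihom.bihom_zmul)
next
  case (bihom_add k l f g)
  have e: "wirt_zbar j (\<lambda>z. f z + g z) = (\<lambda>z. wirt_zbar j f z + wirt_zbar j g z)"
    by (intro ext wirt_add bihom_differentiable[OF bihom_add.hyps(1)] bihom_differentiable[OF bihom_add.hyps(2)])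
  show ?case unfolding e using bihom_add.IH by (cases l) (auto intro: bihom.bihom_add)
qed

lemma bihom_wirt:
  "bihom (Suc k) l f \<Longrightarrow> bihom k l (wirt_z j f)"
  "bihom k (Suc l) f \<Longrightarrow> bihom k l (wirt_zbar j f)"
  "bihom 0 l f \<Longrightarrow> wirt_z j f z = 0"
  "bihom k 0 f \<Longrightarrow> wirt_zbar j f z = 0"
  using bihom_wirt_z_aux[of "Suc k" l f j] bihom_wirt_zbar_aux[of k "Suc l" f j]
    bihom_wirt_z_aux[of 0 l f j] bihom_wirt_zbar_aux[of k 0 f j] by auto

lemma bihom_wirt_ex: "bihom k l f \<Longrightarrow> \<exists>k' l'. bihom k' l' (wirt_z j f)"
  "bihom k l f \<Longrightarrow> \<exists>k' l'. bihom k' l' (wirt_zbar j f)"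
  using bihom_wirt_z_aux[of k l f j] bihom_wirt_zbar_aux[of k l f j] bihom_zero 
  by (auto split: nat.splits)

lemma euler_z: "bihom k l f \<Longrightarrow> (\<Sum>j\<in>UNIV. z $ j * wirt_z j f z) = of_nat k * f z"
proof (induction rule: bihom.induct)
  case (bihom_zmul k l f i)
  have "(\<Sum>j\<in>UNIV. z $ j * wirt_z j (\<lambda>z. z $ i * f z) z)
     = (\<Sum>j\<in>UNIV. (if i = j then z $ i * f z else 0) + z $ i * (z $ j * wirt_z j f z))"
    unfolding wirt_zmul[OF bihom_differentiable[OF bihom_zmul.hyps]]
    by (intro sum.cong refl) (auto simp: algebra_simps)
  also have "\<dots> = z $ i * f z + z $ i * (\<Sum>j\<in>UNIV. z $ j * wirt_z j f z)"
    by (simp add: sum.distrib sum_distrib_left)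
  finally show ?case using bihom_zmul.IH by (simp add: algebra_simps)
next
  case (bihom_cmul k l f i)
  have "(\<Sum>j\<in>UNIV. z $ j * wirt_z j (\<lambda>z. cnj (z $ i) * f z) z)
     = cnj (z $ i) * (\<Sum>j\<in>UNIV. z $ j * wirt_z j f z)"
    by (simp add: wirt_zmul[OF bihom_differentiable[OF bihom_cmul.hyps]] sum_distrib_left mult.left_commute)
  then show ?case using bihom_cmul.IH by (simp add: algebra_simps)
next
  case (bihom_add k l f g)
  then show ?case
    by (simp add: wirt_add bihom_differentiable distrib_left sum.distrib)
qed (simp add: wirt_const)

lemma euler_zbar: "bihom k l f \<Longrightarrow> (\<Sum>j\<in>UNIV. cnj (z $ j) * wirt_zbar j f z) = of_nat l * f z"
proof (induction rule: bihom.induct)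
  case (bihom_cmul k l f i)
  have "(\<Sum>j\<in>UNIV. cnj (z $ j) * wirt_zbar j (\<lambda>z. cnj (z $ i) * f z) z)
     = (\<Sum>j\<in>UNIV. (if i = j then cnj (z $ i) * f z else 0) + cnj (z $ i) * (cnj (z $ j) * wirt_zbar j f z))"
    unfolding wirt_zmul[OF bihom_differentiable[OF bihom_cmul.hyps]]
    by (intro sum.cong refl) (auto simp: algebra_simps)
  also have "\<dots> = cnj (z $ i) * f z + cnj (z $ i) * (\<Sum>j\<in>UNIV. cnj (z $ j) * wirt_zbar j f z)"
    by (simp add: sum.distrib sum_distrib_left)
  finally show ?case using bihom_cmul.IH by (simp add: algebra_simps)
next
  case (bihom_zmul k l f i)
  have "(\<Sum>j\<in>UNIV. cnj (z $ j) * wirt_zbar j (\<lambda>z. z $ i * f z) z)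
     = z $ i * (\<Sum>j\<in>UNIV. cnj (z $ j) * wirt_zbar j f z)"
    by (simp add: wirt_zmul[OF bihom_differentiable[OF bihom_zmul.hyps]] sum_distrib_left mult.left_commute)
  then show ?case using bihom_zmul.IH by (simp add: algebra_simps)
next
  case (bihom_add k l f g)
  then show ?case
    by (simp add: wirt_add bihom_differentiable distrib_left sum.distrib)
qed (simp add: wirt_const)

text \<open>
  The two Wirtinger derivatives carry the whole real derivative; this turns the derivative along a
  curve of complex reflections into an expression in them.
\<close>

lemma frechet_derivative_wirt:
  fixes f :: "complex ^ 'd::finite \<Rightarrow> complex"
  assumes "f differentiable (at z)"
  shows "frechet_derivative f (at z) v = (\<Sum>j\<in>UNIV. v $ j * wirt_z j f z + cnj (v $ j) * wirt_zbar j f z)"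
proof -
  let ?D = "frechet_derivative f (at z)"
  have lin: "linear ?D" using assms by (rule linear_frechet_derivative)
  have ax: "(\<Sum>j\<in>UNIV. axis j (v $ j)) = v"
    by (simp add: vec_eq_iff axis_def)
  have "?D (axis j (v $ j)) = v $ j * wirt_z j f z + cnj (v $ j) * wirt_zbar j f z" for j
  proof -
    have "axis j (v $ j) = Re (v $ j) *\<^sub>R axis j 1 + Im (v $ j) *\<^sub>R axis j \<i>"
      by (simp add: vec_eq_iff axis_def complex_eq_iff)
    then have "?D (axis j (v $ j)) = Re (v $ j) * ?D (axis j 1) + Im (v $ j) * ?D (axis j \<i>)"
      by (simp only: linear_add[OF lin] linear_cmul[OF lin]) (simp only: scaleR_conv_of_real)
    also have "\<dots> = (Re (v $ j) + \<i> * Im (v $ j)) * wirt_z j f z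
         + (Re (v $ j) - \<i> * Im (v $ j)) * wirt_zbar j f z"
      by (simp add: wirt_z_def wirt_zbar_def field_simps)
    also have "Re (v $ j) + \<i> * Im (v $ j) = v $ j" by (simp add: complex_eq_iff)
    also have "Re (v $ j) - \<i> * Im (v $ j) = cnj (v $ j)" by (simp add: complex_eq_iff)
    finally show ?thesis .
  qed
  then have "(\<Sum>j\<in>UNIV. v $ j * wirt_z j f z + cnj (v $ j) * wirt_zbar j f z)
     = (\<Sum>j\<in>UNIV. ?D (axis j (v $ j)))" by simp
  also have "\<dots> = ?D (\<Sum>j\<in>UNIV. axis j (v $ j))" by (simp add: linear_sum[OF lin])
  finally show ?thesis by (simp add: ax)
qed

section \<open>Complex reflections\<close>

abbreviation sphere_int :: "((complex ^ 'd::finite) \<Rightarrow> complex) \<Rightarrow> complex" where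
  "sphere_int f \<equiv> integral\<^sup>L surface_measure f"

lemma continuous_surface_measurable:
  assumes "continuous_on usph (f :: complex ^ 'd::finite \<Rightarrow> 'b::topological_space)"
  shows "f \<in> measurable surface_measure borel"
proof -
  have "f \<in> measurable (restrict_space borel usph) borel"
    by (rule borel_measurable_continuous_on_restrict[OF assms])
  then show ?thesis by (simp cong: measurable_cong_sets)
qed

lemma continuous_surface_integrable:
  fixes f :: "complex ^ 'd::finite \<Rightarrow> 'b::{banach, second_countable_topology}"
  assumes "continuous_on usph f"
  shows "integrable surface_measure f"
proof -
  have "bounded (f ` usph)"
    using assms compact_continuous_image compact_imp_bounded compact_sphere by blast
  then obtain B where "\<forall>x\<in>usph. norm (f x) \<le> B"
    unfolding bounded_iff by auto
  then show ?thesis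
    using continuous_surface_measurable[OF assms]
    by (intro finite_measure.integrable_const_bound[OF surface_finite, of _ B] AE_I2) auto
qed

lemma sphere_int_cong: "(\<And>z. z \<in> usph \<Longrightarrow> f z = g z) \<Longrightarrow> sphere_int f = sphere_int g"
  by (intro Bochner_Integration.integral_cong) auto

lemma bihom_integrable: "bihom k l f \<Longrightarrow> integrable surface_measure f"
  by (intro continuous_surface_integrable bihom_continuous)

definition cip :: "complex ^ 'd::finite \<Rightarrow> complex ^ 'd \<Rightarrow> complex" where
  "cip z u = (\<Sum>i\<in>UNIV. z $ i * cnj (u $ i))"

text \<open>
  For \<open>|\<zeta>| = 1\<close> this is the unitary map that multiplies the component along \<open>u\<close> by \<open>\<zeta>\<close> and fixes the
  orthogonal complement.  This family suffices for transitivity on the sphere, and its one-parameter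
  subgroups generate all infinitesimal rotations.
\<close>

definition creflect :: "complex \<Rightarrow> complex ^ 'd::finite \<Rightarrow> complex ^ 'd \<Rightarrow> complex ^ 'd" where
  "creflect \<zeta> u z = (\<chi> j. z $ j + ((\<zeta> - 1) * cip z u / normsq u) * u $ j)"

lemma cnj_cip: "cnj (cip z u) = cip u z"
  by (simp add: cip_def mult.commute)

lemma cip_self: "cip z z = normsq z"
  by (simp add: cip_def normsq_def)

lemma normsq_eq_0: "normsq z = 0 \<longleftrightarrow> z = 0"
  by (simp add: normsq_eq)

lemma cnj_normsq: "cnj (normsq z) = normsq z"
  by (simp add: normsq_eq)

lemma linear_creflect: "linear (creflect \<zeta> u)"
  unfolding creflect_def cip_def
  by (rule linearI)
     (simp_all add: vec_eq_iff algebra_simps sum.distrib add_divide_distrib diff_divide_distrib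
        scaleR_sum_right[symmetric] scaleR_conv_of_real[of _ "_ :: complex"] sum_distrib_left)

lemma norm_creflect:
  assumes "norm \<zeta> = 1" "u \<noteq> 0"
  shows "norm (creflect \<zeta> u z) = norm z"
proof -
  define s where "s = (\<zeta> - 1) * cip z u / normsq u"
  have n: "normsq u \<noteq> 0" using assms by (simp add: normsq_eq_0)
  have zz: "\<zeta> * cnj \<zeta> = 1" using assms(1) complex_norm_square[of \<zeta>] by simp
  have cs: "cnj s = (cnj \<zeta> - 1) * cnj (cip z u) / normsq u"
    by (simp add: s_def cnj_normsq)
  have "normsq (creflect \<zeta> u z) = (\<Sum>j\<in>UNIV. z $ j * cnj (z $ j) + cnj s * (z $ j * cnj (u $ j))
     + s * (u $ j * cnj (z $ j)) + s * cnj s * (u $ j * cnj (u $ j)))"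
    unfolding normsq_def creflect_def[folded s_def]
    unfolding s_def[symmetric, unfolded normsq_def]
    by (intro sum.cong refl) (simp add: algebra_simps)
  also have "\<dots> = normsq z + cnj s * cip z u + s * cnj (cip z u) + s * cnj s * normsq u"
    by (simp add: sum.distrib sum_distrib_left[symmetric] normsq_def cip_def mult.commute)
  also have "cnj s * cip z u + s * cnj (cip z u) + s * cnj s * normsq u
     = (\<zeta> * cnj \<zeta> - 1) * (cip z u * cnj (cip z u)) / normsq u"
    unfolding cs using n by (simp add: s_def field_simps)
  then have "normsq z + cnj s * cip z u + s * cnj (cip z u) + s * cnj s * normsq u = normsq z"
    by (simp add: zz add.assoc)
  finally have "(norm (creflect \<zeta> u z))\<^sup>2 = (norm z)\<^sup>2"
    by (simp only: normsq_eq of_real_eq_iff)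
  then show ?thesis by simp
qed

lemma bihom_creflect_coord: "bihom (Suc 0) 0 (\<lambda>z. creflect \<zeta> u z $ j)"
proof -
  have "bihom (Suc 0) 0 (\<lambda>z. z $ j + (\<Sum>i\<in>UNIV. ((\<zeta> - 1) * cnj (u $ i) * u $ j / normsq u) * z $ i))"
    by (intro bihom_add bihom_sum bihom_scale bihom_coord)
  then show ?thesis
    by (simp add: creflect_def cip_def sum_distrib_left sum_distrib_right sum_divide_distrib mult_ac)
qed

lemma bihom_creflect: "bihom k l f \<Longrightarrow> bihom k l (\<lambda>z. f (creflect \<zeta> u z))"
  by (rule bihom_compose[OF _ bihom_creflect_coord])

text \<open>
  Reflect along \<open>u = x - y\<close>.  With \<open>w = 1 - \<langle>x, y\<rangle>\<close> one has \<open>\<langle>x, u\<rangle> = w\<close> and \<open>|u|\<^sup>2 = w + \<bar>w\<close>, so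
  \<open>\<zeta> = -\<bar>w / w\<close> moves \<open>x\<close> by exactly \<open>-u\<close>, and it has modulus \<open>1\<close>.
\<close>

lemma creflect_transitive:
  assumes "x \<in> usph" "y \<in> usph" "x \<noteq> y"
  shows "\<exists>\<zeta> u. norm \<zeta> = 1 \<and> u \<noteq> 0 \<and> creflect \<zeta> u x = y"
proof -
  define u where "u = x - y"
  define w where "w = 1 - cip x y"
  have u0: "u \<noteq> 0" using assms by (simp add: u_def)
  have xx: "cip x x = 1" "cip y y = 1" using assms by (simp_all add: cip_self normsq_sphere)
  have xu: "cip x u = w"
    using xx by (simp add: u_def w_def cip_def algebra_simps sum_subtractf)
  have yu: "cip y u = - cnj w"
    using xx by (simp add: u_def w_def cnj_cip) (simp add: cip_def algebra_simps sum_subtractf)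
  have nu: "normsq u = w + cnj w"
  proof -
    have "normsq u = cip x u - cip y u"
      by (simp add: normsq_def cip_def u_def algebra_simps sum_subtractf sum.distrib)
    then show ?thesis using xu yu by simp
  qed
  have w0: "w \<noteq> 0" using nu u0 normsq_eq_0[of u] by auto
  define \<zeta> where "\<zeta> = - cnj w / w"
  have "norm \<zeta> = 1" using w0 by (simp add: \<zeta>_def norm_divide)
  moreover have "(\<zeta> - 1) * w / normsq u = -1"
  proof -
    have "(\<zeta> - 1) * w = - (w + cnj w)" using w0 by (simp add: \<zeta>_def field_simps)
    moreover have "w + cnj w \<noteq> 0" using nu u0 normsq_eq_0[of u] by simp
    ultimately show ?thesis unfolding nu by (simp only: minus_divide_left[symmetric] divide_self not_False_eq_True)
  qed
  then have "creflect \<zeta> u x = y"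
    unfolding creflect_def xu by (simp add: vec_eq_iff u_def)
  ultimately show ?thesis using u0 by blast
qed

lemma sphere_int_creflect:
  assumes "norm \<zeta> = 1" "u \<noteq> 0" "continuous_on usph f"
  shows "sphere_int (\<lambda>z. f (creflect \<zeta> u z)) = sphere_int f"
proof -
  have lin: "linear (creflect \<zeta> u)" by (rule linear_creflect)
  have "continuous_on UNIV (creflect \<zeta> u)"
    using lin by (simp add: linear_continuous_on linear_linear)
  then have mf: "creflect \<zeta> u \<in> borel_measurable borel"
    by (rule borel_measurable_continuous_onI)
  have "creflect \<zeta> u \<in> measurable (restrict_space borel usph) (restrict_space borel usph)"
    using mf by (rule measurable_restrict_space3) (auto simp: norm_creflect assms)
  then have ms: "creflect \<zeta> u \<in> measurable surface_measure surface_measure"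
    by (simp cong: measurable_cong_sets)
  have "sphere_int f = integral\<^sup>L (distr surface_measure surface_measure (creflect \<zeta> u)) f"
    by (simp add: surface_isometry[OF lin norm_creflect] assms)
  also have "\<dots> = sphere_int (\<lambda>z. f (creflect \<zeta> u z))"
    by (rule integral_distr[OF ms continuous_surface_measurable[OF assms(3)]])
  finally show ?thesis ..
qed

section \<open>Infinitesimal invariance and the Green identity on the sphere\<close>

text \<open>
  Finite sums of products \<open>p(t) G(z)\<close>.  For such families differentiation under the integral sign is
  plain linearity.  A polynomial composed with a one-parameter group of reflections is of this form.
\<close>

inductive separable_family :: "(real \<Rightarrow> complex ^ 'd::finite \<Rightarrow> complex) \<Rightarrow> bool" where
  sep_base: "(p has_vector_derivative p') (at 0) \<Longrightarrow> continuous_on usph G \<Longrightarrow> separable_family (\<lambda>t z. p t * G z)"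
| sep_add: "separable_family h1 \<Longrightarrow> separable_family h2 \<Longrightarrow> separable_family (\<lambda>t z. h1 t z + h2 t z)"

lemma sep_mult_base:
  assumes "separable_family h" "(p has_vector_derivative p') (at 0)" "continuous_on usph G"
  shows "separable_family (\<lambda>t z. (p t * G z) * h t z)"
  using assms(1)
proof (induction rule: separable_family.induct)
  case (sep_base q q' H)
  have "separable_family (\<lambda>t z. (p t * q t) * (G z * H z))"
    by (rule separable_family.sep_base[OF has_vector_derivative_mult[OF assms(2) sep_base(1)]])
       (intro continuous_on_mult assms sep_base)
  then show ?case by (simp add: mult_ac)
next
  case (sep_add h1 h2)
  from separable_family.sep_add[OF sep_add.IH] show ?case by (simp add: distrib_left)
qed

lemma sep_mult:
  assumes "separable_family g" "separable_family h"
  shows "separable_family (\<lambda>t z. g t z * h t z)"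
  using assms(1)
proof (induction rule: separable_family.induct)
  case (sep_base q q' H)
  from sep_mult_base[OF assms(2) sep_base] show ?case .
next
  case (sep_add h1 h2)
  from separable_family.sep_add[OF sep_add.IH] show ?case by (simp add: distrib_right)
qed

lemma sep_cnj: "separable_family h \<Longrightarrow> separable_family (\<lambda>t z. cnj (h t z))"
proof (induction rule: separable_family.induct)
  case (sep_base q q' H)
  have "((\<lambda>t. cnj (q t)) has_vector_derivative cnj q') (at 0)"
    by (rule has_vector_derivative_cnj[OF sep_base(1)])
  from separable_family.sep_base[OF this continuous_on_cnj[OF sep_base(2)]] show ?case by simp
next
  case (sep_add h1 h2)
  from separable_family.sep_add[OF sep_add.IH] show ?case by simp
qed

lemma sep_derivative:
  assumes "separable_family h"
  shows "\<exists>h'. (\<forall>z. ((\<lambda>t. h t z) has_vector_derivative h' z) (at 0)) \<and>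
     ((\<lambda>t. sphere_int (h t)) has_vector_derivative sphere_int h') (at 0) \<and>
     continuous_on usph h' \<and> (\<forall>t. continuous_on usph (h t))"
  using assms
proof (induction rule: separable_family.induct)
  case (sep_base p p' G)
  have "((\<lambda>t. sphere_int (\<lambda>z. p t * G z)) has_vector_derivative sphere_int (\<lambda>z. p' * G z)) (at 0)"
    using sep_base(1) by (simp add: has_vector_derivative_mult_left)
  then show ?case using sep_base
    by (intro exI[of _ "\<lambda>z. p' * G z"])
       (auto intro!: has_vector_derivative_mult_left continuous_intros)
next
  case (sep_add h1 h2)
  then obtain h1' h2' where
    1: "\<And>z. ((\<lambda>t. h1 t z) has_vector_derivative h1' z) (at 0)" "((\<lambda>t. sphere_int (h1 t)) has_vector_derivative sphere_int h1') (at 0)"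
     "continuous_on usph h1'" "\<And>t. continuous_on usph (h1 t)" and
    2: "\<And>z. ((\<lambda>t. h2 t z) has_vector_derivative h2' z) (at 0)" "((\<lambda>t. sphere_int (h2 t)) has_vector_derivative sphere_int h2') (at 0)"
     "continuous_on usph h2'" "\<And>t. continuous_on usph (h2 t)" by auto
  have e: "sphere_int (\<lambda>z. h1 t z + h2 t z) = sphere_int (h1 t) + sphere_int (h2 t)" for t
    by (intro Bochner_Integration.integral_add continuous_surface_integrable 1 2)
  have e': "sphere_int (\<lambda>z. h1' z + h2' z) = sphere_int h1' + sphere_int h2'"
    by (intro Bochner_Integration.integral_add continuous_surface_integrable 1 2)
  show ?case
    by (intro exI[of _ "\<lambda>z. h1' z + h2' z"])
       (auto simp: e e' intro!: has_vector_derivative_add continuous_intros 1 2)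
qed

lemma cis_has_vector_derivative: "((\<lambda>t. cis t) has_vector_derivative \<i>) (at 0)"
proof -
  have "((\<lambda>t. complex_of_real (cos t) + \<i> * complex_of_real (sin t)) has_vector_derivative
     complex_of_real (- sin 0) + \<i> * complex_of_real (cos 0)) (at 0)"
    by (intro has_vector_derivative_add has_vector_derivative_mult_right has_vector_derivative_of_real)
       (auto simp: has_real_derivative_iff_has_vector_derivative[symmetric] intro!: derivative_eq_intros)
  moreover have "(\<lambda>t. complex_of_real (cos t) + \<i> * complex_of_real (sin t)) = cis"
    by (auto simp: complex_eq_iff)
  ultimately show ?thesis by simp
qed

lemma sep_bihom_creflect:
  assumes "bihom k l f"
  shows "separable_family (\<lambda>t z. f (creflect (cis t) u z))"
proof -
  have coord: "separable_family (\<lambda>t z. creflect (cis t) u z $ j)" for j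
  proof -
    have c: "continuous_on usph (\<lambda>z. cip z u / normsq u * u $ j)"
      unfolding cip_def divide_inverse by (intro continuous_intros)
    have d: "((\<lambda>t. cis t - 1) has_vector_derivative \<i> - 0) (at 0)"
      by (intro has_vector_derivative_diff cis_has_vector_derivative has_vector_derivative_const)
    have "separable_family (\<lambda>t z. 1 * z $ j + (cis t - 1) * (cip z u / normsq u * u $ j))"
      by (intro sep_add sep_base[OF d c] sep_base[OF has_vector_derivative_const] continuous_intros)
    then show ?thesis by (simp add: creflect_def mult.assoc)
  qed
  show ?thesis using assms
  proof (induction rule: bihom.induct)
    case (bihom_const c)
    from sep_base[OF has_vector_derivative_const[of c] continuous_on_const[of _ 1]] show ?case by simp
  next
    case (bihom_zmul k l f j)
    from sep_mult[OF coord[of j] bihom_zmul.IH] show ?case .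
  next
    case (bihom_cmul k l f j)
    from sep_mult[OF sep_cnj[OF coord[of j]] bihom_cmul.IH] show ?case .
  next
    case (bihom_add k l f g)
    from sep_add[OF bihom_add.IH] show ?case .
  qed
qed

lemma creflect_cis_derivative:
  "((\<lambda>t. creflect (cis t) u z) has_vector_derivative (\<chi> j. \<i> * cip z u / normsq u * u $ j)) (at 0)"
proof -
  define v where "v = (\<chi> j. cip z u / normsq u * u $ j)"
  have bl: "bounded_linear (\<lambda>c::complex. (\<chi> j. c * v $ j) :: complex ^ 'a)"
  proof -
    have "linear (\<lambda>c::complex. (\<chi> j. c * v $ j) :: complex ^ 'a)"
      by (rule linearI) (simp_all add: vec_eq_iff algebra_simps)
    then show ?thesis by (simp add: linear_linear)
  qed
  have d: "((\<lambda>t. cis t - 1) has_vector_derivative \<i> - 0) (at 0)"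
    by (intro has_vector_derivative_diff cis_has_vector_derivative has_vector_derivative_const)
  have "((\<lambda>t. z + (\<chi> j. (cis t - 1) * v $ j)) has_vector_derivative 0 + (\<chi> j. (\<i> - 0) * v $ j)) (at 0)"
    by (intro has_vector_derivative_add has_vector_derivative_const
        bounded_linear.has_vector_derivative[OF bl d])
  then show ?thesis
    by (simp add: creflect_def v_def plus_vec_def mult.assoc)
qed

text \<open>
  A complexified generator of the unitary group acting on functions.
\<close>

definition rotation_gen :: "'d \<Rightarrow> 'd \<Rightarrow> (complex ^ 'd::finite \<Rightarrow> complex) \<Rightarrow> complex ^ 'd \<Rightarrow> complex" where
  "rotation_gen i j f z = z $ i * wirt_z j f z - cnj (z $ j) * wirt_zbar i f z"

lemma wirt_continuous:
  assumes "bihom k l f"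
  shows "continuous_on A (wirt_z j f)" "continuous_on A (wirt_zbar j f)"
  using bihom_wirt_ex[OF assms, of j] bihom_continuous by blast+

lemma rotation_gen_continuous: "bihom k l f \<Longrightarrow> continuous_on A (rotation_gen i j f)"
  unfolding rotation_gen_def[abs_def] by (intro continuous_intros wirt_continuous)

lemma rotation_gen_integrable: "bihom k l f \<Longrightarrow> integrable surface_measure (rotation_gen i j f)"
  by (intro continuous_surface_integrable rotation_gen_continuous)

text \<open>
  The integral of \<open>f\<close> composed with the reflections \<open>e\<^sup>i\<^sup>t\<close> along \<open>u\<close> does not depend on \<open>t\<close>; its
  derivative at \<open>0\<close> is, up to a factor, the Hermitian form on the left.
\<close>

lemma rotation_gen_quadratic_form:
  fixes u :: "complex ^ 'd::finite"
  assumes f: "bihom k l f" and u: "u \<noteq> 0"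
  shows "(\<Sum>i\<in>UNIV. \<Sum>j\<in>UNIV. cnj (u $ i) * u $ j * sphere_int (rotation_gen i j f)) = 0"
proof -
  obtain h' where h': "\<And>z. ((\<lambda>t. f (creflect (cis t) u z)) has_vector_derivative h' z) (at 0)"
    "((\<lambda>t. sphere_int (\<lambda>z. f (creflect (cis t) u z))) has_vector_derivative sphere_int h') (at 0)"
    using sep_derivative[OF sep_bihom_creflect[OF f, of u]] by auto
  have "(\<lambda>t. sphere_int (\<lambda>z. f (creflect (cis t) u z))) = (\<lambda>t. sphere_int f)"
    by (intro ext sphere_int_creflect) (auto simp: u bihom_continuous[OF f])
  with h'(2) have "((\<lambda>t. sphere_int f) has_vector_derivative sphere_int h') (at 0)" by simp
  then have 0: "sphere_int h' = 0"
    using vector_derivative_unique_at has_vector_derivative_const by blast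
  have n: "normsq u \<noteq> 0" using u by (simp add: normsq_eq_0)
  have h'_eq: "h' z = (\<i> / normsq u) * (\<Sum>i\<in>UNIV. \<Sum>j\<in>UNIV. cnj (u $ i) * u $ j * rotation_gen i j f z)" for z
  proof -
    define v where "v = (\<chi> j. \<i> * cip z u / normsq u * u $ j)"
    have z0: "creflect 1 u z = z" by (simp add: creflect_def vec_eq_iff)
    have "(f has_derivative frechet_derivative f (at z)) (at (creflect (cis 0) u z))"
      using bihom_differentiable[OF f, of z] by (simp add: z0 frechet_derivative_works)
    from vector_derivative_diff_chain_within[OF creflect_cis_derivative[of u z, folded v_def], of f]
    have "((\<lambda>t. f (creflect (cis t) u z)) has_vector_derivative frechet_derivative f (at z) v) (at 0)"
      using \<open>(f has_derivative frechet_derivative f (at z)) (at (creflect (cis 0) u z))\<close>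
      by (simp add: o_def has_derivative_at_withinI)
    then have "h' z = frechet_derivative f (at z) v"
      using h'(1) vector_derivative_unique_at by blast
    also have "\<dots> = (\<Sum>j\<in>UNIV. v $ j * wirt_z j f z) + (\<Sum>j\<in>UNIV. cnj (v $ j) * wirt_zbar j f z)"
      by (simp add: frechet_derivative_wirt bihom_differentiable[OF f] sum.distrib)
    also have "(\<Sum>j\<in>UNIV. v $ j * wirt_z j f z)
       = (\<Sum>j\<in>UNIV. \<Sum>i\<in>UNIV. (\<i> / normsq u) * (cnj (u $ i) * u $ j * (z $ i * wirt_z j f z)))"
      by (simp add: v_def cip_def sum_distrib_left sum_distrib_right sum_divide_distrib mult_ac)
    also have "\<dots> = (\<Sum>i\<in>UNIV. \<Sum>j\<in>UNIV. (\<i> / normsq u) * (cnj (u $ i) * u $ j * (z $ i * wirt_z j f z)))"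
      by (rule sum.swap)
    also have "(\<Sum>j\<in>UNIV. cnj (v $ j) * wirt_zbar j f z)
       = (\<Sum>i\<in>UNIV. \<Sum>j\<in>UNIV. - ((\<i> / normsq u) * (cnj (u $ i) * u $ j * (cnj (z $ j) * wirt_zbar i f z))))"
      by (simp add: v_def cip_def cnj_normsq sum_distrib_left sum_distrib_right sum_divide_distrib sum_negf mult_ac)
    finally show ?thesis
      by (simp add: rotation_gen_def sum_distrib_left right_diff_distrib sum.distrib[symmetric] sum_subtractf)
  qed
  have "sphere_int h' = (\<i> / normsq u) * (\<Sum>i\<in>UNIV. \<Sum>j\<in>UNIV. cnj (u $ i) * u $ j * sphere_int (rotation_gen i j f))"
    unfolding h'_eq[abs_def]
    by (simp add: Bochner_Integration.integral_sum rotation_gen_integrable[OF f])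
  with 0 n show ?thesis by simp
qed

text \<open>
  Polarisation of \<open>rotation_gen_quadratic_form\<close>, with \<open>u\<close> a coordinate vector and then a sum of two.
\<close>

lemma sphere_int_rotation_gen:
  fixes f :: "complex ^ 'd::finite \<Rightarrow> complex"
  assumes f: "bihom k l f"
  shows "sphere_int (rotation_gen i j f) = 0"
proof -
  define e where "e = (\<lambda>i j. sphere_int (rotation_gen i j f))"
  define H where "H = (\<lambda>u w :: complex ^ 'd. \<Sum>i\<in>UNIV. \<Sum>j\<in>UNIV. cnj (u $ i) * w $ j * e i j)"
  have H0: "H u u = 0" for u
    using rotation_gen_quadratic_form[OF f, of u] by (cases "u = 0") (auto simp: H_def e_def)
  have Hadd: "H (u + u') w = H u w + H u' w" "H u (w + w') = H u w + H u w'" for u u' w w'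
    by (simp_all add: H_def algebra_simps sum.distrib)
  have Hax: "H (axis i a) (axis j b) = cnj a * b * e i j" for i j a b
  proof -
    have "H (axis i a) (axis j b) = (\<Sum>k\<in>UNIV. \<Sum>l\<in>UNIV. if l = j then (if k = i then cnj a * b * e k l else 0) else 0)"
      unfolding H_def by (intro sum.cong refl) (auto simp: axis_def)
    then show ?thesis by simp
  qed
  have ii: "e i i = 0" for i
    using H0[of "axis i 1"] by (simp add: Hax)
  have *: "x * e i j + cnj x * e j i = 0" for x
    using H0[of "axis i 1 + axis j x"] by (simp add: Hadd Hax ii add.commute)
  have "e i j = 0"
    using *[of 1] *[of \<i>] by (simp add: algebra_simps)
  then show ?thesis by (simp add: e_def)
qed

text \<open>
  The diagonal generators sum to multiplication by the charge \<open>k - l\<close>, by Euler's relations.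
\<close>

lemma sphere_int_charge:
  assumes f: "bihom k l f" and "k \<noteq> l"
  shows "sphere_int f = 0"
proof -
  have "(of_nat k - of_nat l) * sphere_int f = sphere_int (\<lambda>z. (of_nat k - of_nat l) * f z)" by simp
  also have "\<dots> = sphere_int (\<lambda>z. \<Sum>i\<in>UNIV. rotation_gen i i f z)"
    by (simp add: rotation_gen_def sum_subtractf euler_z[OF f] euler_zbar[OF f] left_diff_distrib)
  also have "\<dots> = 0"
    by (simp add: Bochner_Integration.integral_sum rotation_gen_integrable[OF f] sphere_int_rotation_gen[OF f])
  finally show ?thesis using assms(2) by simp
qed

text \<open>
  Integration by parts on the sphere.  Apply the generators with indices \<open>i, j\<close> to \<open>z\<^sub>j G\<close> and sum
  over \<open>j\<close>: Euler's relation and \<open>\<Sum>|z\<^sub>j|\<^sup>2 = 1\<close> leave exactly the two sides.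
\<close>

lemma sphere_int_wirt_zbar:
  fixes G :: "complex ^ 'd::finite \<Rightarrow> complex"
  assumes G: "bihom k l G"
  shows "sphere_int (wirt_zbar i G) = of_nat (CARD('d) + k) * sphere_int (\<lambda>z. z $ i * G z)"
proof -
  have dG: "G differentiable (at z)" for z by (rule bihom_differentiable[OF G])
  have "0 = sphere_int (\<lambda>z. \<Sum>j\<in>UNIV. rotation_gen i j (\<lambda>z. z $ j * G z) z)"
    by (simp add: Bochner_Integration.integral_sum rotation_gen_integrable[OF bihom_zmul[OF G]] sphere_int_rotation_gen[OF bihom_zmul[OF G]])
  also have "\<dots> = sphere_int (\<lambda>z. of_nat (CARD('d) + k) * (z $ i * G z) - wirt_zbar i G z)"
  proof (rule sphere_int_cong)
    fix z :: "complex ^ 'd" assume z: "z \<in> usph"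
    have "(\<Sum>j\<in>UNIV. rotation_gen i j (\<lambda>z. z $ j * G z) z)
       = z $ i * (of_nat CARD('d) * G z + (\<Sum>j\<in>UNIV. z $ j * wirt_z j G z)) - normsq z * wirt_zbar i G z"
      unfolding rotation_gen_def wirt_zmul[OF dG]
      by (simp add: normsq_def sum_subtractf distrib_left sum.distrib
         sum_distrib_left sum_distrib_right mult_ac)
    then show "(\<Sum>j\<in>UNIV. rotation_gen i j (\<lambda>z. z $ j * G z) z) = of_nat (CARD('d) + k) * (z $ i * G z) - wirt_zbar i G z"
      by (simp add: euler_z[OF G] normsq_sphere[OF z] algebra_simps)
  qed
  also have "\<dots> = of_nat (CARD('d) + k) * sphere_int (\<lambda>z. z $ i * G z) - sphere_int (wirt_zbar i G)"
    by (simp add: bihom_integrable[OF bihom_zmul[OF G]] continuous_surface_integrable wirt_continuous[OF G])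
  finally show ?thesis by simp
qed

lemma sphere_int_wirt_z:
  fixes G :: "complex ^ 'd::finite \<Rightarrow> complex"
  assumes G: "bihom k l G"
  shows "sphere_int (wirt_z i G) = of_nat (CARD('d) + l) * sphere_int (\<lambda>z. cnj (z $ i) * G z)"
proof -
  have dG: "G differentiable (at z)" for z by (rule bihom_differentiable[OF G])
  have "0 = sphere_int (\<lambda>z. \<Sum>j\<in>UNIV. rotation_gen j i (\<lambda>z. cnj (z $ j) * G z) z)"
    by (simp add: Bochner_Integration.integral_sum rotation_gen_integrable[OF bihom_cmul[OF G]] sphere_int_rotation_gen[OF bihom_cmul[OF G]])
  also have "\<dots> = sphere_int (\<lambda>z. wirt_z i G z - of_nat (CARD('d) + l) * (cnj (z $ i) * G z))"
  proof (rule sphere_int_cong)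
    fix z :: "complex ^ 'd" assume z: "z \<in> usph"
    have "(\<Sum>j\<in>UNIV. rotation_gen j i (\<lambda>z. cnj (z $ j) * G z) z)
       = normsq z * wirt_z i G z - cnj (z $ i) * (of_nat CARD('d) * G z + (\<Sum>j\<in>UNIV. cnj (z $ j) * wirt_zbar j G z))"
      unfolding rotation_gen_def wirt_zmul[OF dG]
      by (simp add: normsq_def sum_subtractf distrib_left sum.distrib
         sum_distrib_left sum_distrib_right mult_ac)
    then show "(\<Sum>j\<in>UNIV. rotation_gen j i (\<lambda>z. cnj (z $ j) * G z) z) = wirt_z i G z - of_nat (CARD('d) + l) * (cnj (z $ i) * G z)"
      by (simp add: euler_zbar[OF G] normsq_sphere[OF z] algebra_simps)
  qed
  also have "\<dots> = sphere_int (wirt_z i G) - of_nat (CARD('d) + l) * sphere_int (\<lambda>z. cnj (z $ i) * G z)"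
    by (simp add: bihom_integrable[OF bihom_cmul[OF G]] continuous_surface_integrable wirt_continuous[OF G])
  finally show ?thesis by simp
qed

text \<open>
  The Laplacian up to the factor \<open>4\<close>, with the order of differentiation of \<^const>\<open>complex_laplacian\<close>;
  \<open>lapl'\<close> has the opposite order.  Integration by parts turns one into the other.
\<close>

definition lapl :: "(complex ^ 'd::finite \<Rightarrow> complex) \<Rightarrow> complex ^ 'd \<Rightarrow> complex" where
  "lapl f z = (\<Sum>i\<in>UNIV. wirt_z i (wirt_zbar i f) z)"

definition lapl' :: "(complex ^ 'd::finite \<Rightarrow> complex) \<Rightarrow> complex ^ 'd \<Rightarrow> complex" where
  "lapl' f z = (\<Sum>i\<in>UNIV. wirt_zbar i (wirt_z i f) z)"

lemma bihom_lapl: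
  "bihom (Suc k) (Suc l) f \<Longrightarrow> bihom k l (lapl f)"
  "bihom (Suc k) (Suc l) f \<Longrightarrow> bihom k l (lapl' f)"
  unfolding lapl_def[abs_def] lapl'_def[abs_def] by (intro bihom_sum bihom_wirt; assumption)+

lemma bihom_lapl_0:
  assumes "bihom k l f" "k = 0 \<or> l = 0"
  shows "lapl f z = 0" "lapl' f z = 0"
proof -
  have "wirt_z i (wirt_zbar i f) z = 0 \<and> wirt_zbar i (wirt_z i f) z = 0" for i
  proof (cases "k = 0")
    case True
    then have "wirt_z i f = (\<lambda>_. 0)" using assms bihom_wirt(3) by blast
    moreover have "wirt_z i (wirt_zbar i f) z = 0"
    proof (cases l)
      case 0
      then have "wirt_zbar i f = (\<lambda>_. 0)" using assms bihom_wirt(4) by blast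
      then show ?thesis by (simp add: wirt_const)
    next
      case (Suc l')
      then show ?thesis using assms True bihom_wirt(2,3) by metis
    qed
    ultimately show ?thesis by (simp add: wirt_const)
  next
    case False
    then have l: "l = 0" using assms by simp
    then have "wirt_zbar i f = (\<lambda>_. 0)" using assms bihom_wirt(4) by blast
    moreover obtain k' where "k = Suc k'" using False not0_implies_Suc by auto
    then have "wirt_zbar i (wirt_z i f) z = 0" using assms l bihom_wirt(1,4) by metis
    ultimately show ?thesis by (simp add: wirt_const)
  qed
  then show "lapl f z = 0" "lapl' f z = 0" by (simp_all add: lapl_def lapl'_def)
qed

lemma green_step_z:
  fixes Q S :: "complex ^ 'd::finite \<Rightarrow> complex"
  assumes Q: "bihom k l Q" and S: "bihom b a S"
  shows "(\<Sum>i\<in>UNIV. sphere_int (\<lambda>z. wirt_zbar i Q z * wirt_z i S z))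
     = (of_nat (CARD('d) + l + a) - 1) * of_nat l * sphere_int (\<lambda>z. Q z * S z) - sphere_int (\<lambda>z. lapl Q z * S z)"
proof (cases l)
  case 0
  then have "wirt_zbar i Q z = 0" for i z using Q bihom_wirt(4) by blast
  with 0 show ?thesis using bihom_lapl_0(1)[OF Q] by simp
next
  case (Suc l')
  have Qi: "bihom k l' (wirt_zbar i Q)" for i using Q Suc bihom_wirt(2) by blast
  have G: "bihom (k + b) (l' + a) (\<lambda>z. wirt_zbar i Q z * S z)" for i
    by (rule bihom_mult[OF Qi S])
  have int: "integrable surface_measure (\<lambda>z. wirt_z i (wirt_zbar i Q) z * S z)"
     "integrable surface_measure (\<lambda>z. wirt_zbar i Q z * wirt_z i S z)" 
     "integrable surface_measure (\<lambda>z. cnj (z $ i) * (wirt_zbar i Q z * S z))" for i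
    by (intro continuous_surface_integrable continuous_intros wirt_continuous[OF Qi] wirt_continuous[OF Q]
       wirt_continuous[OF S] bihom_continuous[OF S])+
  have "sphere_int (\<lambda>z. lapl Q z * S z) + (\<Sum>i\<in>UNIV. sphere_int (\<lambda>z. wirt_zbar i Q z * wirt_z i S z))
     = (\<Sum>i\<in>UNIV. sphere_int (\<lambda>z. wirt_z i (wirt_zbar i Q) z * S z) + sphere_int (\<lambda>z. wirt_zbar i Q z * wirt_z i S z))"
    by (simp add: lapl_def sum_distrib_right Bochner_Integration.integral_sum int sum.distrib)
  also have "\<dots> = (\<Sum>i\<in>UNIV. sphere_int (wirt_z i (\<lambda>z. wirt_zbar i Q z * S z)))"
  proof (intro sum.cong refl)
    fix i :: 'd
    have "wirt_z i (\<lambda>z. wirt_zbar i Q z * S z) = (\<lambda>z. wirt_z i (wirt_zbar i Q) z * S z + wirt_zbar i Q z * wirt_z i S z)"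
      by (intro ext wirt_mult bihom_differentiable[OF Qi] bihom_differentiable[OF S])
    then show "sphere_int (\<lambda>z. wirt_z i (wirt_zbar i Q) z * S z) + sphere_int (\<lambda>z. wirt_zbar i Q z * wirt_z i S z) 
      = sphere_int (wirt_z i (\<lambda>z. wirt_zbar i Q z * S z))" by (simp add: int)
  qed
  also have "\<dots> = of_nat (CARD('d) + (l' + a)) * sphere_int (\<lambda>z. \<Sum>i\<in>UNIV. cnj (z $ i) * (wirt_zbar i Q z * S z))"
    by (simp add: sphere_int_wirt_z[OF G] Bochner_Integration.integral_sum int sum_distrib_left)
  also have "(\<lambda>z. \<Sum>i\<in>UNIV. cnj (z $ i) * (wirt_zbar i Q z * S z)) = (\<lambda>z. of_nat l * (Q z * S z))"
  proof
    fix z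
    have "(\<Sum>i\<in>UNIV. cnj (z $ i) * (wirt_zbar i Q z * S z)) = (\<Sum>i\<in>UNIV. cnj (z $ i) * wirt_zbar i Q z) * S z"
      by (simp add: sum_distrib_right mult.assoc)
    then show "(\<Sum>i\<in>UNIV. cnj (z $ i) * (wirt_zbar i Q z * S z)) = of_nat l * (Q z * S z)"
      by (simp add: euler_zbar[OF Q])
  qed
  also note Bochner_Integration.integral_mult_right_zero
  finally show ?thesis using Suc by (simp add: algebra_simps)
qed

lemma green_step_zbar:
  fixes Q S :: "complex ^ 'd::finite \<Rightarrow> complex"
  assumes Q: "bihom k l Q" and S: "bihom b a S"
  shows "(\<Sum>i\<in>UNIV. sphere_int (\<lambda>z. wirt_zbar i Q z * wirt_z i S z))
     = (of_nat (CARD('d) + k + b) - 1) * of_nat b * sphere_int (\<lambda>z. Q z * S z) - sphere_int (\<lambda>z. Q z * lapl' S z)"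
proof (cases b)
  case 0
  then have "wirt_z i S z = 0" for i z using S bihom_wirt(3) by blast
  with 0 show ?thesis using bihom_lapl_0(2)[OF S] by simp
next
  case (Suc b')
  have Si: "bihom b' a (wirt_z i S)" for i using S Suc bihom_wirt(1) by blast
  have G: "bihom (k + b') (l + a) (\<lambda>z. Q z * wirt_z i S z)" for i
    by (rule bihom_mult[OF Q Si])
  have int: "integrable surface_measure (\<lambda>z. Q z * wirt_zbar i (wirt_z i S) z)"
     "integrable surface_measure (\<lambda>z. wirt_zbar i Q z * wirt_z i S z)" 
     "integrable surface_measure (\<lambda>z. z $ i * (Q z * wirt_z i S z))" for i
    by (intro continuous_surface_integrable continuous_intros wirt_continuous[OF Si] wirt_continuous[OF Q]
       wirt_continuous[OF S] bihom_continuous[OF Q])+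
  have "sphere_int (\<lambda>z. Q z * lapl' S z) + (\<Sum>i\<in>UNIV. sphere_int (\<lambda>z. wirt_zbar i Q z * wirt_z i S z))
     = (\<Sum>i\<in>UNIV. sphere_int (\<lambda>z. Q z * wirt_zbar i (wirt_z i S) z) + sphere_int (\<lambda>z. wirt_zbar i Q z * wirt_z i S z))"
    by (simp add: lapl'_def sum_distrib_left Bochner_Integration.integral_sum int sum.distrib)
  also have "\<dots> = (\<Sum>i\<in>UNIV. sphere_int (wirt_zbar i (\<lambda>z. Q z * wirt_z i S z)))"
  proof (intro sum.cong refl)
    fix i :: 'd
    have "wirt_zbar i (\<lambda>z. Q z * wirt_z i S z) = (\<lambda>z. wirt_zbar i Q z * wirt_z i S z + Q z * wirt_zbar i (wirt_z i S) z)"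
      by (intro ext wirt_mult bihom_differentiable[OF Si] bihom_differentiable[OF Q])
    then show "sphere_int (\<lambda>z. Q z * wirt_zbar i (wirt_z i S) z) + sphere_int (\<lambda>z. wirt_zbar i Q z * wirt_z i S z) 
      = sphere_int (wirt_zbar i (\<lambda>z. Q z * wirt_z i S z))" by (simp add: int)
  qed
  also have "\<dots> = of_nat (CARD('d) + (k + b')) * sphere_int (\<lambda>z. \<Sum>i\<in>UNIV. z $ i * (Q z * wirt_z i S z))"
    by (simp add: sphere_int_wirt_zbar[OF G] Bochner_Integration.integral_sum int sum_distrib_left)
  also have "(\<lambda>z. \<Sum>i\<in>UNIV. z $ i * (Q z * wirt_z i S z)) = (\<lambda>z. of_nat b * (Q z * S z))"
  proof
    fix z
    have "(\<Sum>i\<in>UNIV. z $ i * (Q z * wirt_z i S z)) = Q z * (\<Sum>i\<in>UNIV. z $ i * wirt_z i S z)"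
      by (simp add: sum_distrib_left mult_ac)
    then show "(\<Sum>i\<in>UNIV. z $ i * (Q z * wirt_z i S z)) = of_nat b * (Q z * S z)"
      by (simp add: euler_z[OF S])
  qed
  also note Bochner_Integration.integral_mult_right_zero
  finally show ?thesis using Suc by (simp add: algebra_simps)
qed

text \<open>
  Both \<open>green_step_z\<close> and \<open>green_step_zbar\<close> evaluate the same mixed first order integral, once by
  moving a derivative from \<open>S\<close> to \<open>Q\<close> and once in the opposite direction.
\<close>

lemma green_identity:
  fixes Q S :: "complex ^ 'd::finite \<Rightarrow> complex"
  assumes Q: "bihom k l Q" and S: "bihom b a S"
  shows "sphere_int (\<lambda>z. lapl Q z * S z)
     = ((of_nat (CARD('d) + l + a) - 1) * of_nat l - (of_nat (CARD('d) + k + b) - 1) * of_nat b)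
         * sphere_int (\<lambda>z. Q z * S z) + sphere_int (\<lambda>z. Q z * lapl' S z)"
proof -
  have *: "L = A - B + L'" if "A - L = B - L'" for A B L L' :: complex
    using that by (simp add: algebra_simps)
  from *[OF trans[OF green_step_z[OF Q S, symmetric] green_step_zbar[OF Q S]]]
  show ?thesis by (simp only: left_diff_distrib)
qed

section \<open>Finite orthonormal families on the sphere\<close>

text \<open>
  By elimination of one equation and one unknown at a time.
\<close>

lemma underdetermined_system:
  fixes a :: "'j \<Rightarrow> 'i \<Rightarrow> 'a::field"
  assumes "finite J" "finite I" "card J < card I"
  shows "\<exists>c. (\<exists>i\<in>I. c i \<noteq> 0) \<and> (\<forall>j\<in>J. (\<Sum>i\<in>I. a j i * c i) = 0)"
  using assms
proof (induction J arbitrary: I a rule: finite_induct)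
  case empty
  then have "I \<noteq> {}" by auto
  then show ?case by (intro exI[of _ "\<lambda>_. 1"]) auto
next
  case (insert j J)
  show ?case
  proof (cases "\<forall>i\<in>I. a j i = 0")
    case True
    have "card J < card I" using insert.prems insert.hyps by simp
    from insert.IH[OF insert.prems(1) this, of a] obtain c
      where "\<exists>i\<in>I. c i \<noteq> 0" "\<forall>j\<in>J. (\<Sum>i\<in>I. a j i * c i) = 0" by auto
    then show ?thesis using True by (intro exI[of _ c]) auto
  next
    case False
    then obtain p where p: "p \<in> I" "a j p \<noteq> 0" by auto
    define b where "b = (\<lambda>k i. a k i - a k p * a j i / a j p)"
    have "card J < card (I - {p})" using insert.prems insert.hyps p by simp
    from insert.IH[OF _ this, of b] insert.prems obtain c
      where c: "\<exists>i\<in>I-{p}. c i \<noteq> 0" "\<forall>k\<in>J. (\<Sum>i\<in>I-{p}. b k i * c i) = 0" by auto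
    \<comment> \<open>the eliminated unknown is recovered from equation \<open>j\<close>\<close>
    define x where "x = - (\<Sum>i\<in>I-{p}. a j i * c i) / a j p"
    have s: "(\<Sum>i\<in>I. a k i * (c(p := x)) i) = a k p * x + (\<Sum>i\<in>I-{p}. a k i * c i)" for k
    proof -
      have "(\<Sum>i\<in>I-{p}. a k i * (c(p := x)) i) = (\<Sum>i\<in>I-{p}. a k i * c i)"
        by (intro sum.cong) auto
      then show ?thesis using insert.prems(1) p(1) by (subst sum.remove[of I p]) auto
    qed
    have "(\<Sum>i\<in>I. a j i * (c(p := x)) i) = 0"
      unfolding s using p by (simp add: x_def)
    moreover have "(\<Sum>i\<in>I. a k i * (c(p := x)) i) = 0" if "k \<in> J" for k
    proof -
      have "0 = (\<Sum>i\<in>I-{p}. a k i * c i) - (a k p / a j p) * (\<Sum>i\<in>I-{p}. a j i * c i)"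
        using c(2) that by (simp add: b_def left_diff_distrib sum_subtractf sum_distrib_left mult.assoc)
      then show ?thesis unfolding s by (simp add: x_def)
    qed
    moreover have "\<exists>i\<in>I. (c(p := x)) i \<noteq> 0" using c(1) by auto
    ultimately show ?thesis by (intro exI[of _ "c(p := x)"]) auto
  qed
qed

definition ip :: "(complex ^ 'd::finite \<Rightarrow> complex) \<Rightarrow> (complex ^ 'd \<Rightarrow> complex) \<Rightarrow> complex" where
  "ip f g = sphere_int (\<lambda>z. f z * cnj (g z))"

lemma ip_cong: "(\<And>z. z \<in> usph \<Longrightarrow> f z = f' z) \<Longrightarrow> (\<And>z. z \<in> usph \<Longrightarrow> g z = g' z) \<Longrightarrow> ip f g = ip f' g'"
  unfolding ip_def by (intro sphere_int_cong) auto

lemma ip_cnj: "cnj (ip f g) = ip g f"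
proof -
  have "cnj (ip f g) = sphere_int (\<lambda>z. cnj (f z * cnj (g z)))"
    unfolding ip_def by (rule Bochner_Integration.integral_cnj[symmetric])
  then show ?thesis by (simp add: ip_def mult.commute)
qed

lemma ip_integrable:
  "continuous_on usph f \<Longrightarrow> continuous_on usph g \<Longrightarrow> integrable surface_measure (\<lambda>z. f z * cnj (g z))"
  by (intro continuous_surface_integrable continuous_intros)

lemma ip_scale_left: "ip (\<lambda>z. c * f z) g = c * ip f g"
  unfolding ip_def by (simp add: mult.assoc)

lemma ip_diff_left:
  "continuous_on usph f \<Longrightarrow> continuous_on usph g \<Longrightarrow> continuous_on usph h \<Longrightarrow> ip (\<lambda>z. f z - g z) h = ip f h - ip g h"
  unfolding ip_def by (simp add: left_diff_distrib ip_integrable)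

lemma ip_sum_left:
  assumes "\<And>i. i \<in> I \<Longrightarrow> continuous_on usph (e i)" "continuous_on usph h"
  shows "ip (\<lambda>z. \<Sum>i\<in>I. c i * e i z) h = (\<Sum>i\<in>I. c i * ip (e i) h)"
  unfolding ip_def using assms
  by (simp add: sum_distrib_right Bochner_Integration.integral_sum ip_integrable mult.assoc)

lemma ip_self: "ip f f = of_real (LINT z|surface_measure. (norm (f z))\<^sup>2)"
proof -
  have "ip f f = sphere_int (\<lambda>z. of_real ((norm (f z))\<^sup>2))"
    unfolding ip_def by (simp only: complex_norm_square)
  then show ?thesis by (simp only: integral_complex_of_real)
qed

text \<open>
  A vanishing norm forces \<open>f = 0\<close> almost everywhere; the set where \<open>f\<close> is nonzero is relatively open and
  would have positive measure by \<open>surface_open_pos\<close>.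
\<close>

lemma ip_self_zero:
  assumes f: "continuous_on usph f" and "ip f f = 0" and z: "z \<in> usph"
  shows "f z = 0"
proof (rule ccontr)
  assume nz: "f z \<noteq> 0"
  have c: "continuous_on usph (\<lambda>z. (norm (f z))\<^sup>2)" by (intro continuous_intros f)
  have "(LINT z|surface_measure. (norm (f z))\<^sup>2) = 0" using assms(2) by (simp only: ip_self of_real_eq_0_iff)
  then have "AE z in surface_measure. (norm (f z))\<^sup>2 = 0"
    by (subst (asm) integral_nonneg_eq_0_iff_AE[OF continuous_surface_integrable[OF c]]) auto
  then have ae: "AE z in surface_measure. f z = 0" by simp
  have "openin (top_of_set usph) (usph \<inter> f -` (- {0}))"
    by (rule continuous_openin_preimage_gen[OF f]) auto
  then obtain U where U: "open U" "usph \<inter> f -` (- {0}) = usph \<inter> U"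
    unfolding openin_open by (elim exE conjE)
  have "U \<inter> usph \<noteq> {}" using U(2) nz z by blast
  from surface_open_pos[OF U(1) this] have "emeasure surface_measure (U \<inter> usph) \<noteq> 0" .
  moreover have "emeasure surface_measure (U \<inter> usph) = 0"
  proof -
    have "AE z in surface_measure. \<not> z \<in> U"
    proof (rule AE_mp[OF ae], rule AE_I2, rule impI, rule notI)
      fix z assume "z \<in> space (surface_measure :: (complex ^ 'a) measure)" "f z = 0" "z \<in> U"
      then have "z \<in> usph \<inter> U" by simp
      then have "z \<in> usph \<inter> f -` (- {0})" by (simp only: U(2))
      then show False using \<open>f z = 0\<close> by simp
    qed
    from emeasure_eq_0_AE[OF this] have "emeasure surface_measure {z \<in> usph. z \<in> U} = 0" by simp
    moreover have "{z \<in> usph. z \<in> U} = U \<inter> usph" by blast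
    ultimately show ?thesis by simp
  qed
  ultimately show False by simp
qed

definition ONfam :: "'i set \<Rightarrow> ('i \<Rightarrow> complex ^ 'd::finite \<Rightarrow> complex) \<Rightarrow> bool" where
  "ONfam I e \<longleftrightarrow> finite I \<and> (\<forall>i\<in>I. continuous_on usph (e i)) \<and>
     (\<forall>i\<in>I. \<forall>j\<in>I. ip (e i) (e j) = (if i = j then 1 else 0))"

text \<open>
  Only values on the sphere matter, so membership is up to equality there.
\<close>

definition sphere_span :: "'i set \<Rightarrow> ('i \<Rightarrow> complex ^ 'd::finite \<Rightarrow> complex) \<Rightarrow> (complex ^ 'd \<Rightarrow> complex) set" where
  "sphere_span I e = {f. \<exists>c. \<forall>z\<in>usph. f z = (\<Sum>i\<in>I. c i * e i z)}"

lemma fspanI: "(\<And>z. z \<in> usph \<Longrightarrow> f z = (\<Sum>i\<in>I. c i * e i z)) \<Longrightarrow> f \<in> sphere_span I e"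
  unfolding sphere_span_def by auto

lemma sphere_span_add: "f \<in> sphere_span I e \<Longrightarrow> g \<in> sphere_span I e \<Longrightarrow> (\<lambda>z. f z + g z) \<in> sphere_span I e"
  unfolding sphere_span_def mem_Collect_eq
proof (elim exE)
  fix c d assume "\<forall>z\<in>usph. f z = (\<Sum>i\<in>I. c i * e i z)" "\<forall>z\<in>usph. g z = (\<Sum>i\<in>I. d i * e i z)"
  then show "\<exists>c. \<forall>z\<in>usph. f z + g z = (\<Sum>i\<in>I. c i * e i z)"
    by (intro exI[of _ "\<lambda>i. c i + d i"]) (simp add: distrib_right sum.distrib)
qed

lemma sphere_span_scale: "f \<in> sphere_span I e \<Longrightarrow> (\<lambda>z. x * f z) \<in> sphere_span I e"
  unfolding sphere_span_def mem_Collect_eq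
proof (elim exE)
  fix c assume "\<forall>z\<in>usph. f z = (\<Sum>i\<in>I. c i * e i z)"
  then show "\<exists>c. \<forall>z\<in>usph. x * f z = (\<Sum>i\<in>I. c i * e i z)"
    by (intro exI[of _ "\<lambda>i. x * c i"]) (simp add: sum_distrib_left mult.assoc)
qed

lemma sphere_span_zero: "(\<lambda>z. 0) \<in> sphere_span I e"
  by (rule fspanI[where c = "\<lambda>_. 0"]) simp

lemma sphere_span_sum: "(\<And>j. j \<in> J \<Longrightarrow> f j \<in> sphere_span I e) \<Longrightarrow> (\<lambda>z. \<Sum>j\<in>J. f j z) \<in> sphere_span I e"
proof (induction J rule: infinite_finite_induct)
  case (insert j J)
  then have "f j \<in> sphere_span I e" "(\<lambda>z. \<Sum>j\<in>J. f j z) \<in> sphere_span I e" by simp_all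
  from sphere_span_add[OF this] show ?case using insert.hyps by simp
qed (simp_all add: sphere_span_zero)

lemma sphere_span_cong: "f \<in> sphere_span I e \<Longrightarrow> (\<And>z. z \<in> usph \<Longrightarrow> g z = f z) \<Longrightarrow> g \<in> sphere_span I e"
  unfolding sphere_span_def by auto

lemma ONfam_coeff:
  assumes on: "ONfam I e" and f: "\<And>z. z \<in> usph \<Longrightarrow> f z = (\<Sum>i\<in>I. c i * e i z)" and "i \<in> I"
  shows "ip f (e i) = c i"
proof -
  have "ip f (e i) = ip (\<lambda>z. \<Sum>i\<in>I. c i * e i z) (e i)" by (rule ip_cong) (auto simp: f)
  also have "\<dots> = (\<Sum>j\<in>I. c j * ip (e j) (e i))"
    using on \<open>i \<in> I\<close> by (intro ip_sum_left) (auto simp: ONfam_def)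
  also have "\<dots> = (\<Sum>j\<in>I. if j = i then c i else 0)"
    using on \<open>i \<in> I\<close> by (intro sum.cong) (auto simp: ONfam_def)
  also have "\<dots> = c i" using on \<open>i \<in> I\<close> by (simp add: ONfam_def)
  finally show ?thesis .
qed

lemma ONfam_expand:
  assumes on: "ONfam I e" and f: "f \<in> sphere_span I e" and z: "z \<in> usph"
  shows "f z = (\<Sum>i\<in>I. ip f (e i) * e i z)"
proof -
  obtain c where c: "\<And>z. z \<in> usph \<Longrightarrow> f z = (\<Sum>i\<in>I. c i * e i z)" using f unfolding sphere_span_def by auto
  then show ?thesis using ONfam_coeff[OF on c] z by simp
qed

lemma ONfam_ip:
  assumes on: "ONfam I e"
  shows "ip (\<lambda>z. \<Sum>i\<in>I. c i * e i z) (\<lambda>z. \<Sum>i\<in>I. d i * e i z) = (\<Sum>i\<in>I. c i * cnj (d i))"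
proof -
  have cont: "continuous_on usph (\<lambda>z. \<Sum>i\<in>I. d i * e i z)" 
    using on by (intro continuous_intros) (auto simp: ONfam_def)
  have "ip (\<lambda>z. \<Sum>i\<in>I. c i * e i z) (\<lambda>z. \<Sum>i\<in>I. d i * e i z) 
      = (\<Sum>i\<in>I. c i * ip (e i) (\<lambda>z. \<Sum>i\<in>I. d i * e i z))"
    by (rule ip_sum_left[OF _ cont]) (use on in \<open>auto simp: ONfam_def\<close>)
  also have "\<dots> = (\<Sum>i\<in>I. c i * cnj (d i))"
  proof (intro sum.cong refl)
    fix i assume "i \<in> I"
    have "ip (e i) (\<lambda>z. \<Sum>i\<in>I. d i * e i z) = cnj (ip (\<lambda>z. \<Sum>i\<in>I. d i * e i z) (e i))"
      by (simp add: ip_cnj)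
    then show "c i * ip (e i) (\<lambda>z. \<Sum>i\<in>I. d i * e i z) = c i * cnj (d i)"
      using ONfam_coeff[OF on _ \<open>i \<in> I\<close>, of _ d] by simp
  qed
  finally show ?thesis .
qed

text \<open>
  Otherwise \<open>underdetermined_system\<close> gives a nontrivial combination of the \<open>e i\<close> that vanishes on the
  sphere.
\<close>

lemma ONfam_card_le:
  assumes on: "ONfam I e" and fin: "finite K" and sp: "\<And>i. i \<in> I \<Longrightarrow> e i \<in> sphere_span K g"
  shows "card I \<le> card K"
proof (rule ccontr)
  assume "\<not> card I \<le> card K"
  then have lt: "card K < card I" by simp
  have "\<forall>i\<in>I. \<exists>c. \<forall>z\<in>usph. e i z = (\<Sum>k\<in>K. c k * g k z)" using sp unfolding sphere_span_def by auto
  then obtain C where C: "\<And>i z. i \<in> I \<Longrightarrow> z \<in> usph \<Longrightarrow> e i z = (\<Sum>k\<in>K. C i k * g k z)" by metis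
  have fI: "finite I" using on by (simp add: ONfam_def)
  obtain t where t: "\<exists>i\<in>I. t i \<noteq> 0" "\<And>k. k \<in> K \<Longrightarrow> (\<Sum>i\<in>I. C i k * t i) = 0"
    using underdetermined_system[OF fin fI lt, of "\<lambda>k i. C i k"] by blast
  have "(\<Sum>i\<in>I. t i * e i z) = 0" if "z \<in> usph" for z
  proof -
    have "(\<Sum>i\<in>I. t i * e i z) = (\<Sum>i\<in>I. \<Sum>k\<in>K. t i * (C i k * g k z))"
      using that by (simp add: C sum_distrib_left)
    also have "\<dots> = (\<Sum>k\<in>K. (\<Sum>i\<in>I. C i k * t i) * g k z)"
      by (subst sum.swap) (simp add: sum_distrib_left sum_distrib_right mult_ac)
    also have "\<dots> = 0" using t(2) by simp
    finally show ?thesis .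
  qed
  then have "t i = 0" if "i \<in> I" for i
    using ONfam_coeff[OF on _ that, of "\<lambda>z. 0" t] that by (simp add: ip_def)
  then show False using t(1) by auto
qed

definition fsubspace :: "(complex ^ 'd::finite \<Rightarrow> complex) set \<Rightarrow> bool" where
  "fsubspace V \<longleftrightarrow> (\<forall>f\<in>V. continuous_on usph f) \<and> (\<lambda>z. 0) \<in> V \<and>
     (\<forall>f\<in>V. \<forall>g\<in>V. (\<lambda>z. f z + g z) \<in> V) \<and> (\<forall>c. \<forall>f\<in>V. (\<lambda>z. c * f z) \<in> V)"

lemma fsubspace_add: "fsubspace V \<Longrightarrow> f \<in> V \<Longrightarrow> g \<in> V \<Longrightarrow> (\<lambda>z. f z + g z) \<in> V"
  and fsubspace_scale: "fsubspace V \<Longrightarrow> f \<in> V \<Longrightarrow> (\<lambda>z. c * f z) \<in> V"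
  unfolding fsubspace_def by simp_all

lemma fsubspace_diff:
  assumes "fsubspace V" "f \<in> V" "g \<in> V"
  shows "(\<lambda>z. f z - g z) \<in> V"
  using fsubspace_add[OF assms(1,2) fsubspace_scale[OF assms(1,3), of "-1"]] by simp

lemma fsubspace_sum:
  assumes "fsubspace V" "\<And>i. i \<in> I \<Longrightarrow> f i \<in> V"
  shows "(\<lambda>z. \<Sum>i\<in>I. c i * f i z) \<in> V"
  using assms(2)
proof (induction I rule: infinite_finite_induct)
  case (insert i I)
  then have "f i \<in> V" "(\<lambda>z. \<Sum>i\<in>I. c i * f i z) \<in> V" by simp_all
  from fsubspace_add[OF assms(1) fsubspace_scale[OF assms(1) this(1)] this(2), of "c i"]
  show ?case using insert.hyps by simp
qed (use assms(1) in \<open>simp_all add: fsubspace_def\<close>)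

text \<open>
  An orthonormal family of maximal size exists by \<open>ONfam_card_le\<close>; it spans, since a nonzero residual
  could be normalised and added to it.
\<close>

lemma ONbasis_exists:
  assumes V: "fsubspace V" and fin: "finite K" and sp: "V \<subseteq> sphere_span K g"
  shows "\<exists>r e. ONfam {..<r::nat} e \<and> (\<forall>i<r. e i \<in> V) \<and> V \<subseteq> sphere_span {..<r} e"
proof -
  define P where "P = (\<lambda>r::nat. \<exists>e. ONfam {..<r} e \<and> (\<forall>i<r. e i \<in> V))"
  have "P 0" by (auto simp: P_def ONfam_def)
  moreover have bd: "r \<le> card K" if Pr: "P r" for r
  proof -
    obtain e where "ONfam {..<r} e" "\<forall>i<r. e i \<in> V" using Pr unfolding P_def by blast
    from ONfam_card_le[OF this(1) fin, of g] this(2) sp show ?thesis by auto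
  qed
  ultimately have max: "P (Greatest P)" "\<And>r. P r \<Longrightarrow> r \<le> Greatest P"
    using GreatestI_nat[of P 0 "card K"] Greatest_le_nat[of P _ "card K"] by blast+
  define r where "r = Greatest P"
  have "P r" using max(1) by (simp add: r_def)
  then obtain e where e: "ONfam {..<r} e" "\<forall>i<r. e i \<in> V" unfolding P_def by blast
  have "f \<in> sphere_span {..<r} e" if f: "f \<in> V" for f
  proof (rule ccontr)
    assume nf: "f \<notin> sphere_span {..<r} e"
    define h where "h = (\<lambda>z. f z - (\<Sum>i<r. ip f (e i) * e i z))"
    have hV: "h \<in> V"
    proof -
      have "(\<lambda>z. \<Sum>i<r. ip f (e i) * e i z) \<in> V" using e(2) by (intro fsubspace_sum[OF V]) auto
      then show ?thesis unfolding h_def by (rule fsubspace_diff[OF V f])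
    qed
    have ce: "continuous_on usph (e i)" if "i < r" for i using e V that by (auto simp: fsubspace_def)
    have cf: "continuous_on usph f" and ch: "continuous_on usph h" using f hV V by (auto simp: fsubspace_def)
    have hort: "ip h (e i) = 0" if "i < r" for i
    proof -
      have "ip h (e i) = ip f (e i) - ip (\<lambda>z. \<Sum>i<r. ip f (e i) * e i z) (e i)"
        unfolding h_def using that by (intro ip_diff_left cf ce continuous_intros) auto
      also have "ip (\<lambda>z. \<Sum>i<r. ip f (e i) * e i z) (e i) = ip f (e i)"
        using that by (intro ONfam_coeff[OF e(1)]) auto
      finally show ?thesis by simp
    qed
    define s where "s = (LINT z|surface_measure. (norm (h z))\<^sup>2)"
    have hh: "ip h h = of_real s" by (simp add: ip_self s_def)
    have "s \<noteq> 0"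
    proof
      assume "s = 0"
      then have "h z = 0" if "z \<in> usph" for z using ip_self_zero[OF ch _ that] hh by simp
      then have "f \<in> sphere_span {..<r} e" by (intro fspanI[where c = "\<lambda>i. ip f (e i)"]) (simp add: h_def)
      with nf show False ..
    qed
    moreover have "s \<ge> 0" by (simp add: s_def)
    ultimately have s: "s > 0" by simp
    define n where "n = (\<lambda>z. of_real (1 / sqrt s) * h z)"
    have nV: "n \<in> V" unfolding n_def by (rule fsubspace_scale[OF V hV])
    have cn: "continuous_on usph n" using nV V by (auto simp: fsubspace_def)
    have nn: "ip n n = 1"
    proof -
      have "ip n n = of_real (1 / sqrt s) * ip h n" unfolding n_def by (rule ip_scale_left)
      also have "ip h n = cnj (ip n h)" by (simp add: ip_cnj)
      also have "ip n h = of_real (1 / sqrt s) * of_real s" unfolding n_def ip_scale_left hh ..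
      finally have "ip n n = of_real (1 / sqrt s * (1 / sqrt s * s))"
        by (simp only: of_real_mult[symmetric] complex_cnj_complex_of_real)
      also have "1 / sqrt s * (1 / sqrt s * s) = 1" using s by (simp add: real_sqrt_mult_self)
      finally show ?thesis by simp
    qed
    have ne: "ip n (e i) = 0" if "i < r" for i
      unfolding n_def ip_scale_left using hort[OF that] by simp
    have en: "ip (e i) n = 0" if "i < r" for i
      using ne[OF that] ip_cnj[of n "e i"] by simp
    define e' where "e' = e(r := n)"
    have "ONfam {..<Suc r} e'"
      using e(1) ce cn nn ne en unfolding ONfam_def by (auto simp: e'_def less_Suc_eq)
    moreover have "\<forall>i<Suc r. e' i \<in> V" using e(2) nV by (auto simp: e'_def less_Suc_eq)
    ultimately have "P (Suc r)" unfolding P_def by blast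
    from max(2)[OF this] show False by (simp add: r_def)
  qed
  then show ?thesis using e by blast
qed

section \<open>Harmonic components: orthogonality and the Fischer decomposition\<close>

definition harmonics :: "nat \<Rightarrow> nat \<Rightarrow> (complex ^ 'd::finite \<Rightarrow> complex) set" where
  "harmonics k l = {f. bihom k l f \<and> (\<forall>z. lapl f z = 0)}"

lemma fsubspace_bihom: "fsubspace {f. bihom k l f}"
  by (auto simp: fsubspace_def bihom_continuous bihom_zero bihom_add bihom_scale)

lemma lapl_add:
  assumes "bihom k l f" "bihom k l g"
  shows "lapl (\<lambda>z. f z + g z) z = lapl f z + lapl g z"
proof -
  have "wirt_zbar i (\<lambda>z. f z + g z) = (\<lambda>z. wirt_zbar i f z + wirt_zbar i g z)" for i
    using assms by (intro ext wirt_add bihom_differentiable)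
  moreover have "wirt_zbar i f differentiable (at z)" "wirt_zbar i g differentiable (at z)" for i
    using bihom_wirt_ex(2) assms bihom_differentiable by blast+
  ultimately show ?thesis by (simp add: lapl_def wirt_add sum.distrib)
qed

lemma lapl_scale:
  assumes "bihom k l f"
  shows "lapl (\<lambda>z. c * f z) z = c * lapl f z"
proof -
  have "wirt_zbar i (\<lambda>z. c * f z) = (\<lambda>z. c * wirt_zbar i f z)" for i
    using assms by (intro ext) (simp add: wirt_mult bihom_differentiable wirt_const)
  moreover have "wirt_zbar i f differentiable (at z)" for i
    using bihom_wirt_ex(2) assms bihom_differentiable by blast+
  ultimately show ?thesis by (simp add: lapl_def wirt_mult wirt_const sum_distrib_left)
qed

lemma fsubspace_harmonics: "fsubspace (harmonics k l)"
proof -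
  have "lapl (\<lambda>z. 0) z = 0" for z :: "complex ^ 'd"
    by (simp add: lapl_def wirt_const[abs_def])
  then show ?thesis
    by (auto simp: fsubspace_def harmonics_def bihom_continuous bihom_zero bihom_add bihom_scale lapl_add lapl_scale)
qed

definition expo :: "nat \<Rightarrow> nat \<Rightarrow> (('d::finite \<Rightarrow> nat) \<times> ('d \<Rightarrow> nat)) set" where
  "expo k l = {\<alpha>. sum \<alpha> UNIV = k} \<times> {\<beta>. sum \<beta> UNIV = l}"

lemma bihom_sphere_span: "bihom k l f \<Longrightarrow> f \<in> sphere_span (expo k l) (\<lambda>(\<alpha>, \<beta>). zmon \<alpha> \<beta>)"
proof -
  assume "bihom k l f"
  then obtain c where f: "f = (\<lambda>z. \<Sum>\<alpha> | sum \<alpha> UNIV = k. \<Sum>\<beta> | sum \<beta> UNIV = l. c \<alpha> \<beta> * zmon \<alpha> \<beta> z)"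
    unfolding bihom_iff by (rule bihomogeneous_polyE)
  show ?thesis
    by (rule fspanI[where c = "\<lambda>(\<alpha>, \<beta>). c \<alpha> \<beta>"])
       (simp add: f expo_def sum.cartesian_product case_prod_beta)
qed

lemma finite_expo: "finite (expo k l)"
  by (simp add: expo_def finite_exponents)

lemma bihom_basis: "\<exists>r e. ONfam {..<r::nat} e \<and> (\<forall>i<r. bihom k l (e i)) \<and> {f. bihom k l f} \<subseteq> sphere_span {..<r} e"
proof -
  have "{f. bihom k l f} \<subseteq> sphere_span (expo k l) (\<lambda>(\<alpha>, \<beta>). zmon \<alpha> \<beta>)" using bihom_sphere_span by blast
  from ONbasis_exists[OF fsubspace_bihom finite_expo this] show ?thesis by simp
qed

lemma harmonics_basis: "\<exists>r e. ONfam {..<r::nat} e \<and> (\<forall>i<r. e i \<in> harmonics k l) \<and> harmonics k l \<subseteq> sphere_span {..<r} e"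
proof (rule ONbasis_exists[OF fsubspace_harmonics finite_expo])
  show "harmonics k l \<subseteq> sphere_span (expo k l) (\<lambda>(\<alpha>, \<beta>). zmon \<alpha> \<beta>)"
    using bihom_sphere_span unfolding harmonics_def by blast
qed

text \<open>
  For harmonic \<open>h\<close> the identity \<open>green_identity\<close> relates the integral of \<open>h S\<close> to that of \<open>h lapl' S\<close> with a
  nonzero coefficient, and \<open>lapl' S\<close> has both degrees lower by one.  Iterating, one degree drops to
  zero, where \<open>lapl' S = 0\<close>.
\<close>

lemma harmonics_orth_lower:
  fixes h :: "complex ^ 'd::finite \<Rightarrow> complex"
  assumes h: "h \<in> harmonics k l"
  shows "bihom b a S \<Longrightarrow> k + b = l + a \<Longrightarrow> b < l \<Longrightarrow> sphere_int (\<lambda>z. h z * S z) = 0"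
proof (induction b arbitrary: a S)
  case (0 a S)
  have hbih: "bihom k l h" and "\<And>z. lapl h z = 0" using h by (auto simp: harmonics_def)
  have "lapl' S z = 0" for z using bihom_lapl_0(2)[OF 0(1)] by simp
  then have "((of_nat (CARD('d) + l + a) - 1) * of_nat l) * sphere_int (\<lambda>z. h z * S z) = 0"
    using green_identity[OF hbih 0(1)] \<open>\<And>z. lapl h z = 0\<close> by simp
  moreover have "(of_nat (CARD('d) + l + a) - 1 :: complex) = of_nat (CARD('d) + l + a - 1)"
    using 0(3) by (simp add: of_nat_diff)
  moreover have "CARD('d) + l + a - 1 > 0" using 0(3) zero_less_card_finite[where 'a='d] by linarith
  ultimately show ?case using 0(3) by (metis mult_eq_0_iff of_nat_eq_0_iff not_less_zero)
next
  case (Suc b a S)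
  have hbih: "bihom k l h" and lh: "\<And>z. lapl h z = 0" using h by (auto simp: harmonics_def)
  have s0: "sphere_int (\<lambda>z. h z * lapl' S z) = 0"
  proof (cases a)
    case 0
    then have "lapl' S z = 0" for z using bihom_lapl_0(2)[OF Suc.prems(1)] by simp
    then show ?thesis by simp
  next
    case (Suc a')
    then show ?thesis using Suc.prems by (intro Suc.IH[of a']) (auto intro: bihom_lapl)
  qed
  have kb: "CARD('d) + k + Suc b = CARD('d) + l + a" using Suc.prems by simp
  have e: "(of_nat (CARD('d) + l + a) - 1 :: complex) = of_nat (CARD('d) + l + a - 1)"
    using Suc.prems by (simp add: of_nat_diff)
  have "(of_nat (CARD('d) + l + a - 1) * of_nat l - of_nat (CARD('d) + l + a - 1) * of_nat (Suc b))
      * sphere_int (\<lambda>z. h z * S z) = 0"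
    using green_identity[OF hbih Suc.prems(1)] lh s0 unfolding kb e by simp
  then have "of_nat (CARD('d) + l + a - 1) * (of_nat l - of_nat (Suc b)) * sphere_int (\<lambda>z. h z * S z) = 0"
    by (simp only: right_diff_distrib)
  moreover have "(of_nat l - of_nat (Suc b) :: complex) = of_nat (l - Suc b)"
    using Suc.prems(3) by (simp add: of_nat_diff)
  moreover have "CARD('d) + l + a - 1 > 0" "l - Suc b > 0" using Suc.prems(3) zero_less_card_finite[where 'a='d] by linarith+
  ultimately show ?case by (metis mult_eq_0_iff of_nat_eq_0_iff less_numeral_extra(3))
qed

text \<open>
  If the charges differ, so that the product of \<open>f\<close> with the conjugate of \<open>g\<close> has nonzero charge, use
  \<open>sphere_int_charge\<close>.  Otherwise one bidegree dominates the other and \<open>harmonics_orth_lower\<close> applies, possibly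
  after conjugation.
\<close>

lemma harmonics_orth:
  assumes f: "f \<in> harmonics k l" and g: "g \<in> harmonics k' l'" and ne: "(k, l) \<noteq> (k', l')"
  shows "ip f g = 0"
proof -
  have *: "ip f g = 0" if "f \<in> harmonics k l" "g \<in> harmonics k' l'" "k + l' = l + k'" "l' < l" for f g k l k' l'
    unfolding ip_def using that by (intro harmonics_orth_lower[OF that(1), of l' k']) (auto simp: harmonics_def intro: bihom_cnj)
  have b: "bihom (k + l') (l + k') (\<lambda>z. f z * cnj (g z))"
    using f g by (intro bihom_mult bihom_cnj) (auto simp: harmonics_def)
  show ?thesis
  proof (cases "k + l' = l + k'")
    case False
    then show ?thesis unfolding ip_def by (rule sphere_int_charge[OF b])
  next
    case True
    then consider "l' < l" | "l < l'" using ne by fastforce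
    then show ?thesis
    proof cases
      case 1 then show ?thesis using *[OF f g True] by simp
    next
      case 2
      then have "ip g f = 0" using *[OF g f] True by simp
      then show ?thesis using ip_cnj[of g f] by simp
    qed
  qed
qed

lemma sphere_point: "\<exists>u::complex ^ 'd::finite. u \<in> usph"
proof -
  have "(axis undefined 1 :: complex ^ 'd) \<in> usph" by simp
  then show ?thesis by blast
qed

lemma bihom_zero_if_zero_on_sphere:
  assumes f: "bihom k l f" and z: "\<And>z. z \<in> usph \<Longrightarrow> f z = 0"
  shows "f z = 0"
proof -
  obtain u :: "complex ^ 'a" where u: "u \<in> usph" using sphere_point by blast
  obtain v where "v \<in> usph" "z = norm z *\<^sub>R v"
  proof (cases "z = 0")
    case True then show ?thesis using that[of u] u by simp
  next
    case False then show ?thesis using that[of "z /\<^sub>R norm z"] by simp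
  qed
  then have "f z = of_real (norm z) ^ (k + l) * f v" using bihom_homogeneous[OF f] by metis
  then show ?thesis using z[OF \<open>v \<in> usph\<close>] by simp
qed

text \<open>
  Let \<open>R\<close> be the projection of \<open>f\<close> onto the polynomials of bidegree \<open>(k, l)\<close> and \<open>Q = f - |z|\<^sup>2R\<close>.  Then
  \<open>Q\<close> is orthogonal on the sphere to all of bidegree \<open>(k, l)\<close>.  In \<open>green_identity\<close>, applied to \<open>Q\<close> and the
  conjugate of its own Laplacian \<open>W\<close>, both terms on the right are therefore zero: the factor multiplying
  \<open>Q\<close> has bidegree \<open>(l, k)\<close>, after multiplication by \<open>|z|\<^sup>2\<close> in the second term.  So \<open>W\<close> has norm zero.
\<close>

lemma fischer_step:
  fixes f :: "complex ^ 'd::finite \<Rightarrow> complex"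
  assumes f: "bihom (Suc k) (Suc l) f"
  shows "\<exists>Q R. Q \<in> harmonics (Suc k) (Suc l) \<and> bihom k l R \<and> (\<forall>z\<in>usph. f z = Q z + R z)"
proof -
  obtain r :: nat and e where e: "ONfam {..<r} (e :: nat \<Rightarrow> complex ^ 'd \<Rightarrow> complex)" "\<And>i. i < r \<Longrightarrow> bihom k l (e i)" "{f. bihom k l f} \<subseteq> sphere_span {..<r} e"
    using bihom_basis[of k l] by auto
  define R where "R = (\<lambda>z. \<Sum>i<r. ip f (e i) * e i z)"
  have R: "bihom k l R" unfolding R_def using e(2) by (intro bihom_sum bihom_scale) auto
  define Q where "Q = (\<lambda>z. f z - normsq z * R z)"
  have Q: "bihom (Suc k) (Suc l) Q"
    unfolding Q_def using bihom_mult[OF bihom_normsq R] by (intro bihom_diff f) simp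
  have Qe: "ip Q (e i) = 0" if "i < r" for i
  proof -
    have "ip Q (e i) = ip (\<lambda>z. f z - R z) (e i)"
      by (rule ip_cong) (auto simp: Q_def normsq_sphere)
    also have "\<dots> = ip f (e i) - ip R (e i)"
      using that by (intro ip_diff_left bihom_continuous[OF f] bihom_continuous[OF R] bihom_continuous[OF e(2)])
    also have "ip R (e i) = ip f (e i)" unfolding R_def using that by (intro ONfam_coeff[OF e(1)]) auto
    finally show ?thesis by simp
  qed
  have QS: "sphere_int (\<lambda>z. Q z * S z) = 0" if S: "bihom l k S" for S
  proof -
    have cS: "(\<lambda>z. cnj (S z)) \<in> sphere_span {..<r} e" using e(3) bihom_cnj[OF S] by auto
    have "sphere_int (\<lambda>z. Q z * S z) = cnj (ip (\<lambda>z. cnj (S z)) Q)"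
      by (simp add: ip_cnj) (simp add: ip_def)
    also have "ip (\<lambda>z. cnj (S z)) Q = ip (\<lambda>z. \<Sum>i<r. ip (\<lambda>z. cnj (S z)) (e i) * e i z) Q"
      by (rule ip_cong) (auto simp: ONfam_expand[OF e(1) cS, symmetric])
    also have "\<dots> = (\<Sum>i<r. ip (\<lambda>z. cnj (S z)) (e i) * ip (e i) Q)"
      by (intro ip_sum_left bihom_continuous[OF Q]) (auto intro: bihom_continuous[OF e(2)])
    also have "\<dots> = 0"
    proof -
      have "ip (e i) Q = 0" if "i < r" for i using Qe[OF that] ip_cnj[of Q "e i"] by simp
      then show ?thesis by simp
    qed
    finally show ?thesis by simp
  qed
  define W where "W = lapl Q"
  have W: "bihom k l W" unfolding W_def by (rule bihom_lapl(1)[OF Q])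
  have S: "bihom l k (\<lambda>z. cnj (W z))" by (rule bihom_cnj[OF W])
  have "sphere_int (\<lambda>z. Q z * lapl' (\<lambda>z. cnj (W z)) z) = 0"
  proof (cases "l = 0 \<or> k = 0")
    case True
    then have "lapl' (\<lambda>z. cnj (W z)) z = 0" for z using bihom_lapl_0(2)[OF S] by blast
    then show ?thesis by simp
  next
    case False
    then obtain l' k' where lk: "l = Suc l'" "k = Suc k'" by (meson not0_implies_Suc)
    have "bihom l' k' (lapl' (\<lambda>z. cnj (W z)))" using S lk bihom_lapl(2) by blast
    from bihom_mult[OF bihom_normsq this] have "bihom l k (\<lambda>z. normsq z * lapl' (\<lambda>z. cnj (W z)) z)"
      using lk by simp
    from QS[OF this] have "sphere_int (\<lambda>z. Q z * (normsq z * lapl' (\<lambda>z. cnj (W z)) z)) = 0" .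
    moreover have "sphere_int (\<lambda>z. Q z * (normsq z * lapl' (\<lambda>z. cnj (W z)) z)) = sphere_int (\<lambda>z. Q z * lapl' (\<lambda>z. cnj (W z)) z)"
      by (rule sphere_int_cong) (simp add: normsq_sphere)
    ultimately show ?thesis by simp
  qed
  then have "ip W W = 0"
    using green_identity[OF Q S] QS[OF S] by (simp add: ip_def W_def)
  then have "W z = 0" for z
    by (rule bihom_zero_if_zero_on_sphere[OF W ip_self_zero[OF bihom_continuous[OF W]]])
  then have "Q \<in> harmonics (Suc k) (Suc l)" using Q by (simp add: harmonics_def W_def)
  moreover have "\<forall>z\<in>usph. f z = Q z + R z" by (simp add: Q_def normsq_sphere)
  ultimately show ?thesis using R by blast
qed

section \<open>Reproducing kernels and the multiplier\<close>

lemma Hspace_harmonics: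
  "Hspace m n = {restrict P usph | P. P \<in> harmonics m n}"
  unfolding Hspace_def harmonics_def bihom_iff by (auto simp: complex_laplacian_def lapl_def)

definition hspace_dim :: "'d::finite itself \<Rightarrow> nat \<Rightarrow> nat \<Rightarrow> nat" where
  "hspace_dim _ k l = (SOME r. \<exists>e. ONfam {..<r::nat} (e :: nat \<Rightarrow> complex ^ 'd \<Rightarrow> complex) \<and> 
     (\<forall>i<r. e i \<in> harmonics k l) \<and> harmonics k l \<subseteq> sphere_span {..<r} e)"

text \<open>
  Fixed once and for all, so that one index type \<open>(k, l, i)\<close> serves all bidegrees.
\<close>

definition hspace_onb :: "nat \<Rightarrow> nat \<Rightarrow> nat \<Rightarrow> complex ^ 'd::finite \<Rightarrow> complex" where
  "hspace_onb k l = (SOME e. ONfam {..<hspace_dim TYPE('d) k l} e \<and> 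
     (\<forall>i<hspace_dim TYPE('d) k l. e i \<in> harmonics k l) \<and> harmonics k l \<subseteq> sphere_span {..<hspace_dim TYPE('d) k l} e)"

lemma hspace_onb:
  "ONfam {..<hspace_dim TYPE('d) k l} (hspace_onb k l :: nat \<Rightarrow> complex ^ 'd::finite \<Rightarrow> complex)"
  "i < hspace_dim TYPE('d) k l \<Longrightarrow> (hspace_onb k l i :: complex ^ 'd \<Rightarrow> complex) \<in> harmonics k l"
  "(harmonics k l :: (complex ^ 'd \<Rightarrow> complex) set) \<subseteq> sphere_span {..<hspace_dim TYPE('d) k l} (hspace_onb k l)"
proof -
  have "\<exists>e. ONfam {..<hspace_dim TYPE('d) k l} (e :: nat \<Rightarrow> complex ^ 'd \<Rightarrow> complex) \<and> 
     (\<forall>i<hspace_dim TYPE('d) k l. e i \<in> harmonics k l) \<and> harmonics k l \<subseteq> sphere_span {..<hspace_dim TYPE('d) k l} e"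
    unfolding hspace_dim_def by (rule someI_ex[OF harmonics_basis])
  from someI_ex[OF this] show 
    "ONfam {..<hspace_dim TYPE('d) k l} (hspace_onb k l :: nat \<Rightarrow> complex ^ 'd::finite \<Rightarrow> complex)"
    "i < hspace_dim TYPE('d) k l \<Longrightarrow> (hspace_onb k l i :: complex ^ 'd \<Rightarrow> complex) \<in> harmonics k l"
    "(harmonics k l :: (complex ^ 'd \<Rightarrow> complex) set) \<subseteq> sphere_span {..<hspace_dim TYPE('d) k l} (hspace_onb k l)"
    unfolding hspace_onb_def[symmetric] by blast+
qed

lemma harmonics_continuous: "f \<in> harmonics k l \<Longrightarrow> continuous_on A f"
  by (auto simp: harmonics_def intro: bihom_continuous)

text \<open>
  The usual expansion of the kernel in an orthonormal basis; it identifies the definite description in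
  \<^const>\<open>repr_kernel\<close>, because the difference of two kernels would be orthogonal to itself.
\<close>

lemma repr_kernel_eq:
  fixes w :: "complex ^ 'd::finite"
  assumes w: "w \<in> usph"
  shows "repr_kernel m n w = restrict (\<lambda>z. \<Sum>i<hspace_dim TYPE('d) m n. cnj (hspace_onb m n i w) * hspace_onb m n i z) usph"
  unfolding repr_kernel_def
proof (rule the_equality)
  let ?r = "hspace_dim TYPE('d) m n" and ?e = "hspace_onb m n :: nat \<Rightarrow> complex ^ 'd \<Rightarrow> complex"
  let ?K = "\<lambda>z. \<Sum>i<?r. cnj (?e i w) * ?e i z"
  have Kh: "?K \<in> harmonics m n" by (rule fsubspace_sum[OF fsubspace_harmonics]) (simp add: hspace_onb)
  have repK: "ip f ?K = f w" if f: "f \<in> harmonics m n" for f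
  proof -
    have fs: "f \<in> sphere_span {..<?r} ?e" using hspace_onb(3) f by blast
    have "ip f ?K = ip (\<lambda>z. \<Sum>i<?r. ip f (?e i) * ?e i z) ?K"
      by (rule ip_cong) (auto simp: ONfam_expand[OF hspace_onb(1) fs, symmetric])
    also have "\<dots> = (\<Sum>i<?r. ip f (?e i) * cnj (cnj (?e i w)))"
      by (rule ONfam_ip[OF hspace_onb(1)])
    also have "\<dots> = f w" using ONfam_expand[OF hspace_onb(1) fs w] by simp
    finally show ?thesis .
  qed
  have sph: "(LINT z|surface_measure. f z * cnj (restrict g usph z)) = ip f g" for f g :: "complex ^ 'd \<Rightarrow> complex"
    unfolding ip_def by (rule sphere_int_cong) auto
  have sph2: "(LINT z|surface_measure. restrict f usph z * cnj (restrict g usph z)) = ip f g" for f g :: "complex ^ 'd \<Rightarrow> complex"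
    unfolding ip_def by (rule sphere_int_cong) auto
  show "restrict ?K usph \<in> Hspace m n \<and> (\<forall>f\<in>Hspace m n. (LINT z|surface_measure. f z * cnj (restrict ?K usph z)) = f w)"
  proof (intro conjI ballI)
    show "restrict ?K usph \<in> Hspace m n" unfolding Hspace_harmonics using Kh by blast
    fix f :: "complex ^ 'd \<Rightarrow> complex" assume "f \<in> Hspace m n"
    then obtain P where P: "P \<in> harmonics m n" "f = restrict P usph" unfolding Hspace_harmonics by auto
    have "(LINT z|surface_measure. f z * cnj (restrict ?K usph z)) = ip P ?K" unfolding P(2) by (rule sph2)
    also have "\<dots> = f w" unfolding repK[OF P(1)] P(2) using w by simp
    finally show "(LINT z|surface_measure. f z * cnj (restrict ?K usph z)) = f w" .
  qed
  fix Z assume Z: "Z \<in> Hspace m n \<and> (\<forall>f\<in>Hspace m n. (LINT z|surface_measure. f z * cnj (Z z)) = f w)"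
  then obtain P where P: "P \<in> harmonics m n" "Z = restrict P usph" unfolding Hspace_harmonics by auto
  have repP: "ip f P = f w" if "f \<in> harmonics m n" for f
  proof -
    have "(LINT z|surface_measure. restrict f usph z * cnj (restrict P usph z)) = restrict f usph w"
    proof -
      have "restrict f usph \<in> Hspace m n" using that unfolding Hspace_harmonics by blast
      then show ?thesis using Z P(2) by blast
    qed
    then show ?thesis unfolding sph2 using w by simp
  qed
  define D where "D = (\<lambda>z. P z - ?K z)"
  have D: "D \<in> harmonics m n" unfolding D_def by (rule fsubspace_diff[OF fsubspace_harmonics P(1) Kh])
  have "ip D D = ip (\<lambda>z. P z - ?K z) D" by (simp only: D_def)
  also have "\<dots> = ip P D - ip ?K D"
    by (intro ip_diff_left harmonics_continuous[OF P(1)] harmonics_continuous[OF Kh] harmonics_continuous[OF D])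
  also have "ip P D = ip ?K D"
    using repP[OF D] repK[OF D] ip_cnj[of D P] ip_cnj[of D ?K] by metis
  also have "ip ?K D - ip ?K D = 0" by simp
  finally have "D z = 0" if "z \<in> usph" for z using ip_self_zero[OF harmonics_continuous[OF D]] that by blast
  then show "Z = restrict ?K usph" unfolding P(2) by (auto simp: D_def restrict_def)
qed

lemma zonal_conv_eq:
  fixes w :: "complex ^ 'd::finite"
  assumes w: "w \<in> usph" and phi: "continuous_on usph \<phi>"
  shows "zonal_conv \<phi> m n w = (\<Sum>i<hspace_dim TYPE('d) m n. ip \<phi> (hspace_onb m n i) * hspace_onb m n i w)"
proof -
  have "zonal_conv \<phi> m n w = sphere_int (\<lambda>z. \<Sum>i<hspace_dim TYPE('d) m n. hspace_onb m n i w * (\<phi> z * cnj (hspace_onb m n i z)))"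
    unfolding zonal_conv_def repr_kernel_eq[OF w]
    by (rule sphere_int_cong) (simp add: sum_distrib_left mult_ac)
  also have "\<dots> = (\<Sum>i<hspace_dim TYPE('d) m n. hspace_onb m n i w * ip \<phi> (hspace_onb m n i))"
    unfolding ip_def
    by (subst Bochner_Integration.integral_sum)
       (auto intro!: integrable_mult_right ip_integrable phi harmonics_continuous[OF hspace_onb(2)])
  finally show ?thesis by (simp add: mult.commute)
qed

definition hindex_all :: "'d::finite itself \<Rightarrow> (nat \<times> nat \<times> nat) set" where
  "hindex_all T = {(k, l, i). i < hspace_dim T k l}"

definition hbasis :: "nat \<times> nat \<times> nat \<Rightarrow> complex ^ 'd::finite \<Rightarrow> complex" where
  "hbasis = (\<lambda>(k, l, i). hspace_onb k l i)"

lemma hbasis_harmonics: "(k, l, i) \<in> hindex_all TYPE('d) \<Longrightarrow> (hbasis (k, l, i) :: complex ^ 'd::finite \<Rightarrow> complex) \<in> harmonics k l"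
  by (simp add: hindex_all_def hbasis_def hspace_onb)

lemma hbasis_continuous: "\<iota> \<in> hindex_all TYPE('d) \<Longrightarrow> continuous_on A (hbasis \<iota> :: complex ^ 'd::finite \<Rightarrow> complex)"
  using hbasis_harmonics harmonics_continuous by (metis prod_cases3)

lemma hbasis_ip:
  assumes "\<iota> \<in> hindex_all TYPE('d)" "\<kappa> \<in> hindex_all TYPE('d)"
  shows "ip (hbasis \<iota> :: complex ^ 'd::finite \<Rightarrow> complex) (hbasis \<kappa>) = (if \<iota> = \<kappa> then 1 else 0)"
proof -
  obtain k l i k' l' i' where x: "\<iota> = (k, l, i)" "\<kappa> = (k', l', i')" by (metis prod_cases3)
  show ?thesis
  proof (cases "(k, l) = (k', l')")
    case False
    then show ?thesis using harmonics_orth[OF hbasis_harmonics hbasis_harmonics, of k l i k' l' i'] assms x by auto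
  next
    case True
    then show ?thesis using assms x hspace_onb(1)[of k l, where 'd = 'd] by (auto simp: hbasis_def hindex_all_def ONfam_def)
  qed
qed

lemma hbasis_ONfam:
  "finite I \<Longrightarrow> I \<subseteq> hindex_all TYPE('d) \<Longrightarrow> ONfam I (hbasis :: _ \<Rightarrow> complex ^ 'd::finite \<Rightarrow> complex)"
  unfolding ONfam_def using hbasis_ip hbasis_continuous by blast

text \<open>
  By orthogonality the \<open>(m, n)\<close> component of a combination of basis elements keeps exactly the terms with
  index \<open>(m, n, i)\<close>.
\<close>

lemma multiplier_rel_hbasis:
  fixes c :: "nat \<times> nat \<times> nat \<Rightarrow> complex"
  assumes I: "finite I" "I \<subseteq> hindex_all TYPE('d::finite)"
  shows "multiplier_rel \<Lambda> (\<lambda>z::complex ^ 'd. \<Sum>\<iota>\<in>I. c \<iota> * hbasis \<iota> z)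
     (\<lambda>z. \<Sum>\<iota>\<in>I. (\<Lambda> (fst \<iota>) (fst (snd \<iota>)) * c \<iota>) * hbasis \<iota> z)"
proof -
  have cont: "continuous_on usph (\<lambda>z::complex ^ 'd. \<Sum>\<iota>\<in>I. c \<iota> * hbasis \<iota> z)" for c
    using I by (intro continuous_intros hbasis_continuous) auto
  have co: "ip (\<lambda>z::complex ^ 'd. \<Sum>\<iota>\<in>I. c \<iota> * hbasis \<iota> z) (hspace_onb m n i) = (if (m, n, i) \<in> I then c (m, n, i) else 0)"
    if "i < hspace_dim TYPE('d) m n" for m n i c
  proof -
    have x: "(m, n, i) \<in> hindex_all TYPE('d)" using that by (simp add: hindex_all_def)
    have "ip (\<lambda>z::complex ^ 'd. \<Sum>\<iota>\<in>I. c \<iota> * hbasis \<iota> z) (hbasis (m, n, i)) = (\<Sum>\<iota>\<in>I. c \<iota> * ip (hbasis \<iota> :: complex ^ 'd \<Rightarrow> complex) (hbasis (m, n, i)))"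
      using I x by (intro ip_sum_left hbasis_continuous) auto
    also have "\<dots> = (\<Sum>\<iota>\<in>I. if \<iota> = (m, n, i) then c \<iota> else 0)"
    proof (intro sum.cong refl)
      fix \<iota> assume "\<iota> \<in> I"
      then have "\<iota> \<in> hindex_all TYPE('d)" using I by blast
      from hbasis_ip[OF this x] show "c \<iota> * ip (hbasis \<iota> :: complex ^ 'd \<Rightarrow> complex) (hbasis (m, n, i)) = (if \<iota> = (m, n, i) then c \<iota> else 0)"
        by simp
    qed
    also have "\<dots> = (if (m, n, i) \<in> I then c (m, n, i) else 0)" using I by (simp add: if_distrib sum.delta)
    finally show ?thesis by (simp add: hbasis_def)
  qed
  show ?thesis unfolding multiplier_rel_def
  proof (intro allI ballI)
    fix m n and w :: "complex ^ 'd" assume w: "w \<in> usph"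
    let ?l = "\<lambda>\<iota>. \<Lambda> (fst \<iota>) (fst (snd \<iota>)) * c \<iota>"
    have "zonal_conv (\<lambda>z. \<Sum>\<iota>\<in>I. ?l \<iota> * hbasis \<iota> z) m n w
       = (\<Sum>i<hspace_dim TYPE('d) m n. (if (m, n, i) \<in> I then ?l (m, n, i) else 0) * hspace_onb m n i w)"
      unfolding zonal_conv_eq[OF w cont] by (intro sum.cong refl) (simp add: co)
    also have "\<dots> = \<Lambda> m n * (\<Sum>i<hspace_dim TYPE('d) m n. (if (m, n, i) \<in> I then c (m, n, i) else 0) * hspace_onb m n i w)"
      unfolding sum_distrib_left by (intro sum.cong refl) simp
    also have "(\<Sum>i<hspace_dim TYPE('d) m n. (if (m, n, i) \<in> I then c (m, n, i) else 0) * hspace_onb m n i w)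
       = zonal_conv (\<lambda>z. \<Sum>\<iota>\<in>I. c \<iota> * hbasis \<iota> z) m n w"
      unfolding zonal_conv_eq[OF w cont] by (intro sum.cong refl) (simp add: co)
    finally show "zonal_conv (\<lambda>z. \<Sum>\<iota>\<in>I. ?l \<iota> * hbasis \<iota> z) m n w
      = \<Lambda> m n * zonal_conv (\<lambda>z. \<Sum>\<iota>\<in>I. c \<iota> * hbasis \<iota> z) m n w" .
  qed
qed

section \<open>Spaces of polynomials with one fixed degree\<close>

text \<open>
  Sums of polynomials of bidegree \<open>(N, l)\<close> with \<open>l \<le> L\<close>.  Fixing the first degree keeps the bidegrees
  at different charges, and for \<open>L \<le> N\<close> every harmonic component has its first degree at least as large
  as the second.  The spaces are invariant under linear substitutions and stable under products.
\<close>

inductive bihom_le :: "nat \<Rightarrow> nat \<Rightarrow> (complex ^ 'd::finite \<Rightarrow> complex) \<Rightarrow> bool" where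
  bihom_le_base: "bihom N l f \<Longrightarrow> l \<le> L \<Longrightarrow> bihom_le N L f"
| bihom_le_add: "bihom_le N L f \<Longrightarrow> bihom_le N L g \<Longrightarrow> bihom_le N L (\<lambda>z. f z + g z)"

lemma bihom_le_scale: "bihom_le N L f \<Longrightarrow> bihom_le N L (\<lambda>z. c * f z)"
proof (induction rule: bihom_le.induct)
  case (bihom_le_base N l f L)
  then show ?case by (intro bihom_le.bihom_le_base bihom_scale)
next
  case (bihom_le_add N L f g)
  from bihom_le.bihom_le_add[OF bihom_le_add.IH] show ?case by (simp add: distrib_left)
qed

lemma bihom_le_zero: "bihom_le N L (\<lambda>z. 0)"
  by (rule bihom_le_base[OF bihom_zero le0])

lemma bihom_le_sum: "(\<And>i. i \<in> A \<Longrightarrow> bihom_le N L (f i)) \<Longrightarrow> bihom_le N L (\<lambda>z. \<Sum>i\<in>A. f i z)"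
proof (induction A rule: infinite_finite_induct)
  case (insert i A)
  then have "bihom_le N L (f i)" "bihom_le N L (\<lambda>z. \<Sum>i\<in>A. f i z)" by simp_all
  from bihom_le_add[OF this] show ?case using insert.hyps by simp
qed (simp_all add: bihom_le_zero)

lemma bihom_le_mult_bihom: "bihom_le N L f \<Longrightarrow> bihom M l g \<Longrightarrow> l \<le> K \<Longrightarrow> bihom_le (N + M) (L + K) (\<lambda>z. f z * g z)"
proof (induction rule: bihom_le.induct)
  case (bihom_le_base N l' f L)
  from bihom_mult[OF bihom_le_base.hyps(1) bihom_le_base.prems(1)] show ?case
    by (rule bihom_le.bihom_le_base) (use bihom_le_base in simp)
next
  case (bihom_le_add N L f f')
  from bihom_le.bihom_le_add[OF bihom_le_add.IH(1)[OF bihom_le_add.prems] bihom_le_add.IH(2)[OF bihom_le_add.prems]]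
  show ?case by (simp add: distrib_right)
qed

lemma bihom_le_mult:
  assumes f: "bihom_le N L f" and g: "bihom_le M K g"
  shows "bihom_le (N + M) (L + K) (\<lambda>z. f z * g z)"
  using g
proof (induction rule: bihom_le.induct)
  case (bihom_le_base M l g K)
  then show ?case by (rule bihom_le_mult_bihom[OF f])
next
  case (bihom_le_add M K g g')
  from bihom_le.bihom_le_add[OF bihom_le_add.IH] show ?case by (simp add: distrib_left)
qed

lemma bihom_le_power: "bihom_le N L f \<Longrightarrow> bihom_le (n * N) (n * L) (\<lambda>z. f z ^ n)"
proof (induction n)
  case 0
  show ?case using bihom_le_base[OF bihom_const[of 1], of 0] by simp
next
  case (Suc n)
  from bihom_le_mult[OF Suc.prems Suc.IH[OF Suc.prems]] show ?case by simp
qed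

lemma bihom_le_continuous: "bihom_le N L f \<Longrightarrow> continuous_on A f"
proof (induction rule: bihom_le.induct)
  case (bihom_le_base N l f L)
  then show ?case by (intro bihom_continuous)
next
  case (bihom_le_add N L f g)
  then show ?case by (intro continuous_on_add)
qed

lemma bihom_le_creflect: "bihom_le N L f \<Longrightarrow> bihom_le N L (\<lambda>z. f (creflect \<zeta> u z))"
proof (induction rule: bihom_le.induct)
  case (bihom_le_base N l f L)
  then show ?case by (intro bihom_le.bihom_le_base bihom_creflect)
next
  case (bihom_le_add N L f g)
  from bihom_le.bihom_le_add[OF bihom_le_add.IH] show ?case .
qed

text \<open>
  Basis indices of the harmonic spaces occurring in \<open>bihom_le N L\<close>: a polynomial of bidegree
  \<open>(N, l')\<close> decomposes into harmonics of bidegree \<open>(N - j, l' - j)\<close>, here with \<open>j = N - k\<close>.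
\<close>

definition hindex :: "'d::finite itself \<Rightarrow> nat \<Rightarrow> nat \<Rightarrow> (nat \<times> nat \<times> nat) set" where
  "hindex T N L = {(k, l, i). i < hspace_dim T k l \<and> k \<le> N \<and> l + (N - k) \<le> L}"

lemma hindex_subset: "hindex T N L \<subseteq> hindex_all T"
  by (auto simp: hindex_def hindex_all_def)

lemma finite_hindex: "finite (hindex T N L)"
proof (rule finite_subset)
  show "hindex T N L \<subseteq> (SIGMA k:{..N}. SIGMA l:{..L}. {..<hspace_dim T k l})"
    by (auto simp: hindex_def)
qed auto

lemma hindex_ONfam: "ONfam (hindex TYPE('d) N L) (hbasis :: _ \<Rightarrow> complex ^ 'd::finite \<Rightarrow> complex)"
  by (rule hbasis_ONfam[OF finite_hindex hindex_subset])

lemma sphere_span_basis: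
  assumes "finite I" "i \<in> I"
  shows "e i \<in> sphere_span I e"
proof -
  have "e i z = (\<Sum>j\<in>I. (if j = i then 1 else 0) * e j z)" for z
  proof -
    have "(\<Sum>j\<in>I. (if j = i then 1 else 0) * e j z) = (\<Sum>j\<in>I. if j = i then e j z else 0)"
      by (intro sum.cong) auto
    then show ?thesis using assms by simp
  qed
  then show ?thesis unfolding sphere_span_def mem_Collect_eq by (intro exI[of _ "\<lambda>j. if j = i then 1 else 0"] ballI)
qed

lemma harmonics_sphere_span:
  fixes h :: "complex ^ 'd::finite \<Rightarrow> complex"
  assumes h: "h \<in> harmonics k l" and "k \<le> N" "l + (N - k) \<le> L"
  shows "h \<in> sphere_span (hindex TYPE('d) N L) hbasis"
proof -
  obtain c where c: "\<And>z. z \<in> usph \<Longrightarrow> h z = (\<Sum>i<hspace_dim TYPE('d) k l. c i * hspace_onb k l i z)"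
    using hspace_onb(3)[of k l] h unfolding sphere_span_def by blast
  have "(\<lambda>z::complex ^ 'd. \<Sum>i<hspace_dim TYPE('d) k l. c i * hspace_onb k l i z) \<in> sphere_span (hindex TYPE('d) N L) hbasis"
  proof (intro sphere_span_sum sphere_span_scale)
    fix i assume "i \<in> {..<hspace_dim TYPE('d) k l}"
    then have "(k, l, i) \<in> hindex TYPE('d) N L" using assms by (simp add: hindex_def)
    from sphere_span_basis[OF finite_hindex this, of hbasis] show "(hspace_onb k l i :: complex ^ 'd \<Rightarrow> complex) \<in> sphere_span (hindex TYPE('d) N L) hbasis"
      by (simp add: hbasis_def)
  qed
  then show ?thesis by (rule sphere_span_cong) (rule c)
qed

text \<open>
  Iterate \<open>fischer_step\<close>: on the sphere the remainder \<open>R\<close> stands for \<open>|z|\<^sup>2R\<close>, so both degrees drop by one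
  and \<open>l + (N - k)\<close> keeps its value.
\<close>

lemma bihom_harmonic_expansion:
  fixes f :: "complex ^ 'd::finite \<Rightarrow> complex"
  shows "bihom k l f \<Longrightarrow> k \<le> N \<Longrightarrow> l + (N - k) \<le> L \<Longrightarrow> f \<in> sphere_span (hindex TYPE('d) N L) hbasis"
proof (induction k arbitrary: l f)
  case 0
  then have "f \<in> harmonics 0 l" using bihom_lapl_0(1)[OF 0(1)] by (simp add: harmonics_def)
  then show ?case using 0 by (intro harmonics_sphere_span)
next
  case (Suc k)
  show ?case
  proof (cases l)
    case 0
    then have "f \<in> harmonics (Suc k) l" using bihom_lapl_0(1)[OF Suc.prems(1)] Suc.prems(1) by (simp add: harmonics_def)
    then show ?thesis using Suc.prems by (intro harmonics_sphere_span)
  next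
    case (Suc l')
    obtain Q R where QR: "Q \<in> harmonics (Suc k) (Suc l')" "bihom k l' R" "\<And>z. z \<in> usph \<Longrightarrow> f z = Q z + R z"
      using fischer_step[of k l' f] Suc.prems(1) Suc by blast
    have "Q \<in> sphere_span (hindex TYPE('d) N L) hbasis" using Suc.prems Suc by (intro harmonics_sphere_span[OF QR(1)]) auto
    moreover have "R \<in> sphere_span (hindex TYPE('d) N L) hbasis" using Suc.prems Suc by (intro Suc.IH[OF QR(2)]) auto
    ultimately have "(\<lambda>z. Q z + R z) \<in> sphere_span (hindex TYPE('d) N L) hbasis" by (rule sphere_span_add)
    then show ?thesis by (rule sphere_span_cong) (rule QR(3))
  qed
qed

lemma bihom_le_sphere_span:
  fixes f :: "complex ^ 'd::finite \<Rightarrow> complex"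
  shows "bihom_le N L f \<Longrightarrow> f \<in> sphere_span (hindex TYPE('d) N L) hbasis"
proof (induction rule: bihom_le.induct)
  case (bihom_le_base N l f L)
  then show ?case by (intro bihom_harmonic_expansion) auto
next
  case (bihom_le_add N L f g)
  show ?case by (rule sphere_span_add[OF bihom_le_add.IH])
qed

text \<open>
  On the sphere a harmonic of bidegree \<open>(N - j, l)\<close> may be multiplied by \<open>|z|\<^sup>2\<^sup>j\<close>, which raises it to
  bidegree \<open>(N, l + j)\<close>.
\<close>

lemma hbasis_bihom_le:
  assumes "\<iota> \<in> hindex TYPE('d::finite) N L"
  shows "\<exists>g. bihom_le N L g \<and> (\<forall>z\<in>usph. (hbasis \<iota> :: complex ^ 'd \<Rightarrow> complex) z = g z)"
proof -
  obtain k l i where x: "\<iota> = (k, l, i)" "i < hspace_dim TYPE('d) k l" "k \<le> N" "l + (N - k) \<le> L"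
    using assms by (auto simp: hindex_def)
  have "bihom k l (hbasis \<iota> :: complex ^ 'd \<Rightarrow> complex)" using hspace_onb(2)[OF x(2)] x(1) by (simp add: hbasis_def harmonics_def)
  from bihom_mult[OF bihom_power[OF bihom_normsq, of "N - k"] this]
  have "bihom N (N - k + l) (\<lambda>z::complex ^ 'd. normsq z ^ (N - k) * hbasis \<iota> z)" using x(3) by simp
  then have "bihom_le N L (\<lambda>z::complex ^ 'd. normsq z ^ (N - k) * hbasis \<iota> z)" by (rule bihom_le_base) (use x in simp)
  then show ?thesis by (intro exI conjI) (auto simp: normsq_sphere)
qed

lemma sphere_span_bihom_le:
  assumes "f \<in> sphere_span (hindex TYPE('d::finite) N L) (hbasis :: _ \<Rightarrow> complex ^ 'd \<Rightarrow> complex)"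
  shows "\<exists>g. bihom_le N L g \<and> (\<forall>z\<in>usph. f z = g z)"
proof -
  obtain c where c: "\<And>z. z \<in> usph \<Longrightarrow> f z = (\<Sum>\<iota>\<in>hindex TYPE('d) N L. c \<iota> * hbasis \<iota> z)"
    using assms unfolding sphere_span_def by blast
  have "\<forall>\<iota>\<in>hindex TYPE('d) N L. \<exists>g. bihom_le N L g \<and> (\<forall>z\<in>usph. (hbasis \<iota> :: complex ^ 'd \<Rightarrow> complex) z = g z)"
    using hbasis_bihom_le by blast
  then obtain G where G: "\<And>\<iota>. \<iota> \<in> hindex TYPE('d) N L \<Longrightarrow> bihom_le N L (G \<iota>)"
    "\<And>\<iota> z. \<iota> \<in> hindex TYPE('d) N L \<Longrightarrow> z \<in> usph \<Longrightarrow> (hbasis \<iota> :: complex ^ 'd \<Rightarrow> complex) z = G \<iota> z"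
    by metis
  have "bihom_le N L (\<lambda>z. \<Sum>\<iota>\<in>hindex TYPE('d) N L. c \<iota> * G \<iota> z)" by (intro bihom_le_sum bihom_le_scale G)
  then show ?thesis by (intro exI conjI) (auto simp: c G)
qed

section \<open>The diagonal of the reproducing kernel\<close>

abbreviation sphere_area :: "'d::finite itself \<Rightarrow> real" where
  "sphere_area _ \<equiv> measure (surface_measure :: (complex ^ 'd) measure) usph"

lemma sphere_area_pos: "sphere_area TYPE('d::finite) > 0"
proof -
  obtain u :: "complex ^ 'd" where "u \<in> usph" using sphere_point by blast
  then have "emeasure (surface_measure :: (complex ^ 'd) measure) (UNIV \<inter> usph) \<noteq> 0"
    by (intro surface_open_pos) auto
  moreover have "emeasure (surface_measure :: (complex ^ 'd) measure) usph = ennreal (sphere_area TYPE('d))"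
    by (rule finite_measure.emeasure_eq_measure[OF surface_finite])
  ultimately show ?thesis by (simp add: zero_less_measure_iff)
qed

lemma cauchy_schwarz_sum:
  fixes a b :: "'i \<Rightarrow> complex"
  shows "(norm (\<Sum>i\<in>I. a i * b i))\<^sup>2 \<le> (\<Sum>i\<in>I. (norm (a i))\<^sup>2) * (\<Sum>i\<in>I. (norm (b i))\<^sup>2)"
proof -
  have "norm (\<Sum>i\<in>I. a i * b i) \<le> (\<Sum>i\<in>I. norm (a i) * norm (b i))"
    by (rule order_trans[OF norm_sum]) (simp add: norm_mult)
  then have "(norm (\<Sum>i\<in>I. a i * b i))\<^sup>2 \<le> (\<Sum>i\<in>I. norm (a i) * norm (b i))\<^sup>2"
    by (simp add: power_mono)
  also have "\<dots> \<le> (\<Sum>i\<in>I. (norm (a i))\<^sup>2) * (\<Sum>i\<in>I. (norm (b i))\<^sup>2)"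
    by (rule Cauchy_Schwarz_ineq_sum)
  finally show ?thesis .
qed

lemma ip_hbasis_norm:
  "ip (\<lambda>z::complex ^ 'd::finite. \<Sum>\<iota>\<in>hindex TYPE('d) N L. c \<iota> * hbasis \<iota> z)
      (\<lambda>z. \<Sum>\<iota>\<in>hindex TYPE('d) N L. c \<iota> * hbasis \<iota> z) = of_real (\<Sum>\<iota>\<in>hindex TYPE('d) N L. (norm (c \<iota>))\<^sup>2)"
  unfolding ONfam_ip[OF hindex_ONfam] of_real_sum by (simp only: complex_norm_square)

text \<open>
  Let \<open>f\<close> be the kernel at \<open>x\<close> and \<open>K\<close> the sum in question, so that \<open>f x = |f|\<^sup>2 = K x\<close>.  Composing \<open>f\<close>
  with a reflection taking \<open>y\<close> to \<open>x\<close> gives an element of the same space and of the same norm whose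
  value at \<open>y\<close> is \<open>K x\<close>; the Cauchy-Schwarz inequality at \<open>y\<close> yields \<open>(K x)\<^sup>2 \<le> K x * K y\<close>.
\<close>

lemma kernel_diag_le:
  fixes x y :: "complex ^ 'd::finite"
  assumes x: "x \<in> usph" and y: "y \<in> usph"
  shows "(\<Sum>\<iota>\<in>hindex TYPE('d) N L. (norm (hbasis \<iota> x))\<^sup>2) \<le> (\<Sum>\<iota>\<in>hindex TYPE('d) N L. (norm (hbasis \<iota> y))\<^sup>2)"
proof (cases "x = y")
  case False
  let ?I = "hindex TYPE('d) N L"
  define K where "K = (\<lambda>w::complex ^ 'd. \<Sum>\<iota>\<in>?I. (norm (hbasis \<iota> w))\<^sup>2)"
  obtain \<zeta> and u :: "complex ^ 'd" where U: "norm \<zeta> = 1" "u \<noteq> 0" "creflect \<zeta> u y = x"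
    using creflect_transitive[OF y x] False by blast
  define f where "f = (\<lambda>z::complex ^ 'd. \<Sum>\<iota>\<in>?I. cnj (hbasis \<iota> x) * hbasis \<iota> z)"
  have cf: "continuous_on usph f" unfolding f_def
    using hindex_ONfam by (intro continuous_intros) (auto simp: ONfam_def)
  have "f \<in> sphere_span ?I hbasis" unfolding f_def by (rule fspanI) simp
  from sphere_span_bihom_le[OF this] obtain F where F: "bihom_le N L F" "\<And>z. z \<in> usph \<Longrightarrow> f z = F z" by blast
  define g where "g = (\<lambda>z. f (creflect \<zeta> u z))"
  have "g z = F (creflect \<zeta> u z)" if "z \<in> usph" for z
    unfolding g_def using that by (intro F) (simp add: norm_creflect U)
  from sphere_span_cong[OF bihom_le_sphere_span[OF bihom_le_creflect[OF F(1)]] this]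
  obtain c where c: "\<And>z. z \<in> usph \<Longrightarrow> g z = (\<Sum>\<iota>\<in>?I. c \<iota> * hbasis \<iota> z)"
    unfolding sphere_span_def by blast
  have fx: "f x = of_real (K x)"
    unfolding f_def K_def of_real_sum complex_norm_square by (intro sum.cong refl mult.commute)
  have Kx0: "K x \<ge> 0" by (simp add: K_def sum_nonneg)
  have "ip g g = ip (\<lambda>z::complex ^ 'd. \<Sum>\<iota>\<in>?I. c \<iota> * hbasis \<iota> z) (\<lambda>z. \<Sum>\<iota>\<in>?I. c \<iota> * hbasis \<iota> z)"
    by (rule ip_cong) (auto simp: c)
  then have gg: "ip g g = of_real (\<Sum>\<iota>\<in>?I. (norm (c \<iota>))\<^sup>2)" by (simp only: ip_hbasis_norm)
  have "ip g g = ip f f"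
    unfolding ip_def g_def by (rule sphere_int_creflect[OF U(1,2)]) (intro continuous_intros cf)
  also have "ip f f = of_real (K x)" unfolding f_def ip_hbasis_norm K_def by simp
  finally have cK: "(\<Sum>\<iota>\<in>?I. (norm (c \<iota>))\<^sup>2) = K x" using gg by (simp only: of_real_eq_iff)
  have "g y = f x" by (simp add: g_def U)
  then have "(K x)\<^sup>2 = (norm (g y))\<^sup>2" by (simp add: fx)
  also have "\<dots> \<le> (\<Sum>\<iota>\<in>?I. (norm (c \<iota>))\<^sup>2) * (\<Sum>\<iota>\<in>?I. (norm (hbasis \<iota> y))\<^sup>2)"
    unfolding c[OF y] by (rule cauchy_schwarz_sum)
  also have "\<dots> = K x * K y" unfolding cK by (simp add: K_def)
  finally have "K x * K x \<le> K x * K y" by (simp add: power2_eq_square)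
  moreover have "K y \<ge> 0" by (simp add: K_def sum_nonneg)
  ultimately have "K x \<le> K y" using Kx0 by (cases "K x = 0") auto
  then show ?thesis by (simp add: K_def)
qed simp

text \<open>
  By \<open>kernel_diag_le\<close> the left side is constant on the sphere, and its integral is the number of basis
  elements.
\<close>

lemma kernel_diag:
  fixes x :: "complex ^ 'd::finite"
  assumes x: "x \<in> usph"
  shows "(\<Sum>\<iota>\<in>hindex TYPE('d) N L. (norm (hbasis \<iota> x))\<^sup>2) = card (hindex TYPE('d) N L) / sphere_area TYPE('d)"
proof -
  let ?I = "hindex TYPE('d) N L"
  have c: "(\<Sum>\<iota>\<in>?I. (norm (hbasis \<iota> y))\<^sup>2) = (\<Sum>\<iota>\<in>?I. (norm (hbasis \<iota> x))\<^sup>2)" if "y \<in> usph" for y :: "complex ^ 'd"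
    by (rule antisym[OF kernel_diag_le[OF that x] kernel_diag_le[OF x that]])
  have on: "(LINT z|(surface_measure :: (complex ^ 'd) measure). (norm (hbasis \<iota> z))\<^sup>2) = 1" if "\<iota> \<in> ?I" for \<iota>
  proof -
    have "of_real (LINT z|(surface_measure :: (complex ^ 'd) measure). (norm (hbasis \<iota> z))\<^sup>2) = (1::complex)"
      using hbasis_ip[of \<iota> \<iota>, where 'd='d] that hindex_subset by (subst ip_self[symmetric]) auto
    then show ?thesis by (simp only: of_real_eq_1_iff)
  qed
  have "(\<Sum>\<iota>\<in>?I. (norm (hbasis \<iota> x))\<^sup>2) * sphere_area TYPE('d)
     = (LINT z|(surface_measure :: (complex ^ 'd) measure). (\<Sum>\<iota>\<in>?I. (norm (hbasis \<iota> x))\<^sup>2))"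
    by simp
  also have "\<dots> = (LINT z|(surface_measure :: (complex ^ 'd) measure). (\<Sum>\<iota>\<in>?I. (norm (hbasis \<iota> z))\<^sup>2))"
    by (intro Bochner_Integration.integral_cong refl c[symmetric]) simp
  also have "\<dots> = (\<Sum>\<iota>\<in>?I. LINT z|(surface_measure :: (complex ^ 'd) measure). (norm (hbasis \<iota> z :: complex))\<^sup>2)"
  proof (rule Bochner_Integration.integral_sum)
    fix \<iota> assume "\<iota> \<in> ?I"
    then have "continuous_on usph (hbasis \<iota> :: complex ^ 'd \<Rightarrow> complex)"
      using hindex_subset by (intro hbasis_continuous) auto
    then show "integrable (surface_measure :: (complex ^ 'd) measure) (\<lambda>z. (norm (hbasis \<iota> z))\<^sup>2)"
      by (intro continuous_surface_integrable continuous_intros)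
  qed
  also have "\<dots> = card ?I" by (simp add: on)
  finally show ?thesis using sphere_area_pos[where 'd='d] by (simp add: field_simps)
qed

section \<open>Counting monomials\<close>

text \<open>
  Exponents of the monomials spanning \<open>bihom_le N L\<close>.
\<close>

definition exponent_pairs :: "nat \<Rightarrow> nat \<Rightarrow> (('d::finite \<Rightarrow> nat) \<times> ('d \<Rightarrow> nat)) set" where
  "exponent_pairs N L = {\<alpha>. sum \<alpha> UNIV = N} \<times> {\<beta>. sum \<beta> UNIV \<le> L}"

definition zmon_pair :: "('d::finite \<Rightarrow> nat) \<times> ('d \<Rightarrow> nat) \<Rightarrow> complex ^ 'd \<Rightarrow> complex" where
  "zmon_pair = (\<lambda>(\<alpha>, \<beta>). zmon \<alpha> \<beta>)"

lemma finite_exponents_le: "finite {\<alpha> :: 'd::finite \<Rightarrow> nat. sum \<alpha> UNIV \<le> m}"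
  and card_exponents_le: "card {\<alpha> :: 'd::finite \<Rightarrow> nat. sum \<alpha> UNIV \<le> m} \<le> (m + 1) ^ CARD('d)"
proof -
  have sub: "{\<alpha> :: 'd \<Rightarrow> nat. sum \<alpha> UNIV \<le> m} \<subseteq> (UNIV :: 'd set) \<rightarrow>\<^sub>E {..m}"
  proof
    fix \<alpha> :: "'d \<Rightarrow> nat" assume "\<alpha> \<in> {\<alpha>. sum \<alpha> UNIV \<le> m}"
    then have "\<alpha> i \<le> m" for i using member_le_sum[of i UNIV \<alpha>] by simp
    then show "\<alpha> \<in> (UNIV :: 'd set) \<rightarrow>\<^sub>E {..m}" by auto
  qed
  have fin: "finite ((UNIV :: 'd set) \<rightarrow>\<^sub>E {..m})" by (intro finite_PiE) auto
  show "finite {\<alpha> :: 'd \<Rightarrow> nat. sum \<alpha> UNIV \<le> m}" by (rule finite_subset[OF sub fin])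
  have "card {\<alpha> :: 'd \<Rightarrow> nat. sum \<alpha> UNIV \<le> m} \<le> card ((UNIV :: 'd set) \<rightarrow>\<^sub>E {..m})"
    by (rule card_mono[OF fin sub])
  then show "card {\<alpha> :: 'd \<Rightarrow> nat. sum \<alpha> UNIV \<le> m} \<le> (m + 1) ^ CARD('d)"
    by (simp add: card_PiE)
qed

lemma finite_exponent_pairs: "finite (exponent_pairs N L)"
  by (simp add: exponent_pairs_def finite_exponents finite_exponents_le)

lemma card_exponent_pairs_le: "card (exponent_pairs N L :: (('d::finite \<Rightarrow> nat) \<times> _) set) \<le> ((N + 1) * (L + 1)) ^ CARD('d)"
proof -
  have "card {\<alpha> :: 'd \<Rightarrow> nat. sum \<alpha> UNIV = N} \<le> card {\<alpha> :: 'd \<Rightarrow> nat. sum \<alpha> UNIV \<le> N}"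
    by (intro card_mono finite_exponents_le) auto
  also have "\<dots> \<le> (N + 1) ^ CARD('d)" by (rule card_exponents_le)
  finally have "card {\<alpha> :: 'd \<Rightarrow> nat. sum \<alpha> UNIV = N} * card {\<beta> :: 'd \<Rightarrow> nat. sum \<beta> UNIV \<le> L}
     \<le> (N + 1) ^ CARD('d) * (L + 1) ^ CARD('d)"
    by (intro mult_mono card_exponents_le) auto
  then show ?thesis unfolding exponent_pairs_def card_cartesian_product power_mult_distrib .
qed

lemma card_hindex_le: "card (hindex TYPE('d::finite) N L) \<le> ((N + 1) * (L + 1)) ^ CARD('d)"
proof -
  have W: "f \<in> sphere_span (exponent_pairs N L) zmon_pair" if "bihom_le N L f" for f :: "complex ^ 'd \<Rightarrow> complex"
    using that
  proof (induction rule: bihom_le.induct)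
    case (bihom_le_base N l f L)
    then obtain c where f: "f = (\<lambda>z. \<Sum>\<alpha> | sum \<alpha> UNIV = N. \<Sum>\<beta> | sum \<beta> UNIV = l. c \<alpha> \<beta> * zmon \<alpha> \<beta> z)"
      unfolding bihom_iff by (elim bihomogeneous_polyE)
    have "zmon \<alpha> \<beta> \<in> sphere_span (exponent_pairs N L) zmon_pair" if "sum \<alpha> UNIV = N" "sum \<beta> UNIV = l" for \<alpha> \<beta> :: "'d \<Rightarrow> nat"
      using sphere_span_basis[OF finite_exponent_pairs, of "(\<alpha>, \<beta>)" N L zmon_pair] that bihom_le_base(2) by (simp add: exponent_pairs_def zmon_pair_def)
    then show ?case unfolding f by (intro sphere_span_sum sphere_span_scale) auto
  next
    case (bihom_le_add N L f g)
    show ?case by (rule sphere_span_add[OF bihom_le_add.IH])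
  qed
  have "card (hindex TYPE('d) N L) \<le> card (exponent_pairs N L :: (('d \<Rightarrow> nat) \<times> _) set)"
  proof (rule ONfam_card_le[OF hindex_ONfam finite_exponent_pairs])
    fix \<iota> assume "\<iota> \<in> hindex TYPE('d) N L"
    from hbasis_bihom_le[OF this] obtain g where g: "bihom_le N L g" "\<And>z. z \<in> usph \<Longrightarrow> (hbasis \<iota> :: complex ^ 'd \<Rightarrow> complex) z = g z" by blast
    from sphere_span_cong[OF W[OF g(1)] g(2)] show "(hbasis \<iota> :: complex ^ 'd \<Rightarrow> complex) \<in> sphere_span (exponent_pairs N L) zmon_pair" .
  qed
  with card_exponent_pairs_le show ?thesis by (rule order_trans[rotated])
qed

lemma wirt_power:
  "f differentiable (at z) \<Longrightarrow> wirt_z j (\<lambda>z. f z ^ n) z = of_nat n * f z ^ (n - 1) * wirt_z j f z"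
proof (induction n)
  case 0 show ?case by (simp add: wirt_const)
next
  case (Suc n)
  have d: "(\<lambda>z. f z ^ n) differentiable (at z)" by (rule differentiable_power[OF Suc.prems])
  have "wirt_z j (\<lambda>z. f z * f z ^ n) z = wirt_z j f z * f z ^ n + f z * (of_nat n * f z ^ (n - 1) * wirt_z j f z)"
    by (simp only: wirt_mult(1)[OF Suc.prems d] Suc.IH[OF Suc.prems])
  then show ?case by (cases n) (simp_all add: algebra_simps)
qed

lemma wirt_prod_zero:
  assumes "finite A" "\<And>i. i \<in> A \<Longrightarrow> f i differentiable (at z)" "\<And>i. i \<in> A \<Longrightarrow> wirt_z j (f i) z = 0"
  shows "wirt_z j (\<lambda>z. \<Prod>i\<in>A. f i z) z = 0 \<and> (\<lambda>z. \<Prod>i\<in>A. f i z) differentiable (at z)"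
  using assms
proof (induction A rule: finite_induct)
  case empty show ?case by (simp add: wirt_const)
next
  case (insert i A)
  then have d: "f i differentiable (at z)" "(\<lambda>z. \<Prod>i\<in>A. f i z) differentiable (at z)" 
    "wirt_z j (f i) z = 0" "wirt_z j (\<lambda>z. \<Prod>i\<in>A. f i z) z = 0" by auto
  have "wirt_z j (\<lambda>z. f i z * (\<Prod>i\<in>A. f i z)) z = 0"
    by (simp only: wirt_mult(1)[OF d(1,2)] d) simp
  then show ?case using insert.hyps d by simp
qed

lemma wirt_zmon_0:
  assumes "\<alpha> j = 0"
  shows "wirt_z j (zmon \<alpha> \<beta>) z = 0"
proof -
  have d: "(\<lambda>z::complex^'a. (z $ i) ^ \<alpha> i) differentiable (at z)" "(\<lambda>z::complex^'a. cnj (z $ i) ^ \<beta> i) differentiable (at z)" for i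
    by (intro differentiable_power bihom_coord_differentiable)+
  have "wirt_z j (\<lambda>z::complex^'a. (z $ i) ^ \<alpha> i * cnj (z $ i) ^ \<beta> i) z = 0" for i
    using assms by (cases "i = j")
      (simp_all add: wirt_mult(1)[OF d] wirt_power[OF bihom_coord_differentiable(1)] wirt_power[OF bihom_coord_differentiable(2)] wirt_coord)
  then show ?thesis
    unfolding zmon_def[abs_def] using wirt_prod_zero[of UNIV "\<lambda>i z. (z $ i) ^ \<alpha> i * cnj (z $ i) ^ \<beta> i" z j] d by simp
qed

lemma zmon_differentiable: "zmon \<alpha> \<beta> differentiable (at z)"
  by (rule bihom_differentiable[OF bihom_zmon])

lemma wirt_zmon: "wirt_z j (zmon \<alpha> \<beta>) z = of_nat (\<alpha> j) * zmon (\<alpha>(j := \<alpha> j - 1)) \<beta> z"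
proof (induction "\<alpha> j" arbitrary: \<alpha>)
  case 0
  then show ?case by (simp add: wirt_zmon_0)
next
  case (Suc n)
  define \<alpha>' where "\<alpha>' = \<alpha>(j := n)"
  have \<alpha>: "\<alpha> = \<alpha>'(j := Suc (\<alpha>' j))" using Suc(2) by (auto simp: \<alpha>'_def fun_eq_iff)
  have e: "zmon \<alpha> \<beta> = (\<lambda>z. z $ j * zmon \<alpha>' \<beta> z)" by (rule ext) (simp only: \<alpha> zmon_zmul)
  have n: "n = \<alpha>' j" by (simp add: \<alpha>'_def)
  have "wirt_z j (zmon \<alpha> \<beta>) z = zmon \<alpha>' \<beta> z + z $ j * (of_nat n * zmon (\<alpha>'(j := n - 1)) \<beta> z)"
    unfolding e wirt_zmul(1)[OF zmon_differentiable] Suc(1)[of \<alpha>', OF n] by (simp add: n)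
  also have "z $ j * (of_nat n * zmon (\<alpha>'(j := n - 1)) \<beta> z) = of_nat n * zmon \<alpha>' \<beta> z"
  proof (cases n)
    case (Suc n')
    have "\<alpha>' = (\<alpha>'(j := n - 1))(j := Suc ((\<alpha>'(j := n - 1)) j))" using Suc by (auto simp: \<alpha>'_def fun_eq_iff)
    then have "z $ j * zmon (\<alpha>'(j := n - 1)) \<beta> z = zmon \<alpha>' \<beta> z" by (metis zmon_zmul)
    then show ?thesis by (simp add: mult.left_commute)
  qed simp
  also have "zmon \<alpha>' \<beta> z + of_nat n * zmon \<alpha>' \<beta> z = of_nat (Suc n) * zmon \<alpha>' \<beta> z" by (simp add: algebra_simps)
  also have "\<alpha>' = \<alpha>(j := \<alpha> j - 1)" using Suc(2)[symmetric] by (simp add: \<alpha>'_def)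
  finally show ?case by (simp only: Suc(2))
qed

lemma wirt_lincomb:
  assumes "finite A" "\<And>i. i \<in> A \<Longrightarrow> f i differentiable (at z)"
  shows "wirt_z j (\<lambda>z. \<Sum>i\<in>A. c i * f i z) z = (\<Sum>i\<in>A. c i * wirt_z j (f i) z) \<and> (\<lambda>z. \<Sum>i\<in>A. c i * f i z) differentiable (at z)"
  using assms
proof (induction A rule: finite_induct)
  case empty show ?case by (simp add: wirt_const)
next
  case (insert i A)
  then have d: "(\<lambda>z. c i * f i z) differentiable (at z)" "f i differentiable (at z)" "(\<lambda>z. \<Sum>i\<in>A. c i * f i z) differentiable (at z)"
    "wirt_z j (\<lambda>z. \<Sum>i\<in>A. c i * f i z) z = (\<Sum>i\<in>A. c i * wirt_z j (f i) z)" by auto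
  have "wirt_z j (\<lambda>z. c i * f i z + (\<Sum>i\<in>A. c i * f i z)) z = c i * wirt_z j (f i) z + (\<Sum>i\<in>A. c i * wirt_z j (f i) z)"
    by (simp only: wirt_add(1)[OF d(1,3)] d(4) wirt_mult(1)[OF differentiable_const d(2)] wirt_const) simp
  then show ?case using insert.hyps d by simp
qed

definition exponent_pairs_total :: "nat \<Rightarrow> (('d::finite \<Rightarrow> nat) \<times> ('d \<Rightarrow> nat)) set" where
  "exponent_pairs_total n = {(\<alpha>, \<beta>). sum \<alpha> UNIV + sum \<beta> UNIV \<le> n}"

lemma finite_exponent_pairs_total: "finite (exponent_pairs_total n)"
proof (rule finite_subset)
  show "exponent_pairs_total n \<subseteq> {\<alpha>. sum \<alpha> UNIV \<le> n} \<times> {\<beta>. sum \<beta> UNIV \<le> n}" by (auto simp: exponent_pairs_total_def)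
qed (simp add: finite_exponents_le)

lemma cnj_zmon: "cnj (zmon \<alpha> \<beta> z) = zmon \<beta> \<alpha> z"
  by (simp add: zmon_def mult.commute)

text \<open>
  Differentiating a vanishing combination in \<open>z\<^sub>j\<close> gives a vanishing combination of lower degree, whose
  coefficients are positive multiples of those of the monomials containing \<open>z\<^sub>j\<close>.
\<close>

lemma exponent_pairs_total_derivative_coeff:
  fixes c :: "('d::finite \<Rightarrow> nat) \<times> ('d \<Rightarrow> nat) \<Rightarrow> complex"
  assumes IH: "\<And>c :: ('d \<Rightarrow> nat) \<times> ('d \<Rightarrow> nat) \<Rightarrow> complex. (\<And>z. (\<Sum>\<mu>\<in>exponent_pairs_total n. c \<mu> * zmon_pair \<mu> z) = 0) \<Longrightarrow> \<forall>\<mu>\<in>exponent_pairs_total n. c \<mu> = 0"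
    and z: "\<And>z. (\<Sum>\<mu>\<in>exponent_pairs_total (Suc n). c \<mu> * zmon_pair \<mu> z) = 0"
    and \<mu>: "(\<alpha>, \<beta>) \<in> exponent_pairs_total (Suc n)" "\<alpha> j > 0"
  shows "c (\<alpha>, \<beta>) = 0"
proof -
  let ?up = "\<lambda>(\<alpha>, \<beta>). (\<alpha>(j := Suc (\<alpha> j)), \<beta>) :: ('d \<Rightarrow> nat) \<times> ('d \<Rightarrow> nat)"
  define b where "b = (\<lambda>\<mu>. c (?up \<mu>) * of_nat (Suc (fst \<mu> j)))"
  have "(\<Sum>\<mu>\<in>exponent_pairs_total n. b \<mu> * zmon_pair \<mu> z) = 0" for z
  proof -
    have "(\<lambda>z. \<Sum>\<mu>\<in>exponent_pairs_total (Suc n). c \<mu> * zmon_pair \<mu> z) = (\<lambda>z. 0)" using z by auto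
    then have "0 = wirt_z j (\<lambda>z. \<Sum>\<mu>\<in>exponent_pairs_total (Suc n). c \<mu> * zmon_pair \<mu> z) z" by (simp add: wirt_const)
    also have "\<dots> = (\<Sum>\<mu>\<in>exponent_pairs_total (Suc n). c \<mu> * wirt_z j (zmon_pair \<mu>) z)"
      by (rule conjunct1[OF wirt_lincomb]) (auto simp: finite_exponent_pairs_total zmon_pair_def zmon_differentiable)
    also have "\<dots> = (\<Sum>\<mu>\<in>?up ` exponent_pairs_total n. c \<mu> * wirt_z j (zmon_pair \<mu>) z)"
    proof (rule sum.mono_neutral_right[OF finite_exponent_pairs_total])
      show "?up ` exponent_pairs_total n \<subseteq> exponent_pairs_total (Suc n)"
        by (auto simp: exponent_pairs_total_def sum_upd_Suc simp del: fun_upd_apply)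
      show "\<forall>\<mu>\<in>exponent_pairs_total (Suc n) - ?up ` exponent_pairs_total n. c \<mu> * wirt_z j (zmon_pair \<mu>) z = 0"
      proof (intro ballI)
        fix \<mu> :: "('d \<Rightarrow> nat) \<times> ('d \<Rightarrow> nat)"
        assume m: "\<mu> \<in> exponent_pairs_total (Suc n) - ?up ` exponent_pairs_total n"
        obtain \<alpha> \<beta> where ab: "\<mu> = (\<alpha>, \<beta>)" by (cases \<mu>)
        have "\<alpha> j = 0"
        proof (rule ccontr)
          assume "\<alpha> j \<noteq> 0"
          then have e: "\<alpha> = (\<alpha>(j := \<alpha> j - 1))(j := Suc ((\<alpha>(j := \<alpha> j - 1)) j))" by (auto simp: fun_eq_iff)
          have "sum \<alpha> UNIV = Suc (sum (\<alpha>(j := \<alpha> j - 1)) UNIV)" by (subst e) (rule sum_upd_Suc)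
          then have "(\<alpha>(j := \<alpha> j - 1), \<beta>) \<in> exponent_pairs_total n" using m ab by (auto simp: exponent_pairs_total_def simp del: fun_upd_apply)
          then have "?up (\<alpha>(j := \<alpha> j - 1), \<beta>) \<in> ?up ` exponent_pairs_total n" by (rule imageI)
          then show False using m ab e by auto
        qed
        then show "c \<mu> * wirt_z j (zmon_pair \<mu>) z = 0" by (simp add: ab zmon_pair_def wirt_zmon_0)
      qed
    qed
    also have "\<dots> = (\<Sum>\<mu>\<in>exponent_pairs_total n. c (?up \<mu>) * wirt_z j (zmon_pair (?up \<mu>)) z)"
    proof (rule sum.reindex[unfolded o_def])
      show "inj_on ?up (exponent_pairs_total n)"
      proof (rule inj_onI)
        fix \<mu> \<nu> :: "('d \<Rightarrow> nat) \<times> ('d \<Rightarrow> nat)" assume e: "?up \<mu> = ?up \<nu>"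
        obtain a b a' b' where ab: "\<mu> = (a, b)" "\<nu> = (a', b')" by (cases \<mu>, cases \<nu>)
        have u: "a(j := Suc (a j)) = a'(j := Suc (a' j))" "b = b'" using e ab by auto
        have "a i = a' i" for i using fun_cong[OF u(1), of i] by (cases "i = j") auto
        then show "\<mu> = \<nu>" using u ab by auto
      qed
    qed
    also have "\<dots> = (\<Sum>\<mu>\<in>exponent_pairs_total n. b \<mu> * zmon_pair \<mu> z)"
      by (intro sum.cong refl) (auto simp: zmon_pair_def wirt_zmon b_def)
    finally show ?thesis by simp
  qed
  from IH[OF this] have b0: "\<forall>\<mu>\<in>exponent_pairs_total n. b \<mu> = 0" .
  define \<alpha>' where "\<alpha>' = \<alpha>(j := \<alpha> j - 1)"
  have e: "\<alpha> = \<alpha>'(j := Suc (\<alpha>' j))" using \<mu>(2) by (auto simp: \<alpha>'_def fun_eq_iff)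
  have "sum \<alpha> UNIV = Suc (sum \<alpha>' UNIV)" by (subst e) (rule sum_upd_Suc)
  then have "(\<alpha>', \<beta>) \<in> exponent_pairs_total n" using \<mu>(1) by (simp add: exponent_pairs_total_def)
  with b0 have "b (\<alpha>', \<beta>) = 0" by blast
  then show ?thesis using e by (simp add: b_def del: of_nat_Suc)
qed

text \<open>
  By induction on the degree: \<open>exponent_pairs_total_derivative_coeff\<close> handles monomials containing some \<open>z\<^sub>j\<close>, the
  conjugate combination those containing some \<open>\<bar>z\<^sub>j\<close>, and evaluation at \<open>0\<close> the constant.
\<close>

lemma zmon_independent:
  fixes c :: "('d::finite \<Rightarrow> nat) \<times> ('d \<Rightarrow> nat) \<Rightarrow> complex"
  assumes "\<And>z. (\<Sum>\<mu>\<in>exponent_pairs_total n. c \<mu> * zmon_pair \<mu> z) = 0"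
  shows "\<forall>\<mu>\<in>exponent_pairs_total n. c \<mu> = 0"
  using assms
proof (induction n arbitrary: c)
  case 0
  have "exponent_pairs_total 0 = {(\<lambda>_::'d. 0, \<lambda>_::'d. 0)}" by (auto simp: exponent_pairs_total_def)
  then show ?case using 0[of 0] by (simp add: zmon_pair_def zmon_def)
next
  case (Suc n)
  have pos: "c (\<alpha>, \<beta>) = 0" if "(\<alpha>, \<beta>) \<in> exponent_pairs_total (Suc n)" "\<alpha> j > 0" for \<alpha> \<beta> j
    using exponent_pairs_total_derivative_coeff[OF Suc.IH Suc.prems that] by blast
  \<comment> \<open>the coefficients of the conjugate combination\<close>
  define c' where "c' = (\<lambda>\<mu>. cnj (c (prod.swap \<mu>)))"
  have "(\<Sum>\<mu>\<in>exponent_pairs_total (Suc n). c' \<mu> * zmon_pair \<mu> z) = 0" for z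
  proof -
    have "0 = cnj (\<Sum>\<mu>\<in>exponent_pairs_total (Suc n). c \<mu> * zmon_pair \<mu> z)" using Suc.prems by simp
    also have "\<dots> = (\<Sum>\<mu>\<in>exponent_pairs_total (Suc n). c' (prod.swap \<mu>) * zmon_pair (prod.swap \<mu>) z)"
      unfolding cnj_sum by (intro sum.cong refl) (auto simp: c'_def zmon_pair_def cnj_zmon)
    also have "\<dots> = (\<Sum>\<mu>\<in>prod.swap ` exponent_pairs_total (Suc n). c' \<mu> * zmon_pair \<mu> z)"
      by (subst sum.reindex) (auto intro: inj_on_subset[OF inj_swap])
    also have "prod.swap ` exponent_pairs_total (Suc n) = (exponent_pairs_total (Suc n) :: (('d \<Rightarrow> nat) \<times> ('d \<Rightarrow> nat)) set)"
    proof
      show "prod.swap ` exponent_pairs_total (Suc n) \<subseteq> (exponent_pairs_total (Suc n) :: (('d \<Rightarrow> nat) \<times> ('d \<Rightarrow> nat)) set)" by (auto simp: exponent_pairs_total_def)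
      show "(exponent_pairs_total (Suc n) :: (('d \<Rightarrow> nat) \<times> ('d \<Rightarrow> nat)) set) \<subseteq> prod.swap ` exponent_pairs_total (Suc n)"
      proof
        fix \<mu> :: "('d \<Rightarrow> nat) \<times> ('d \<Rightarrow> nat)" assume "\<mu> \<in> exponent_pairs_total (Suc n)"
        then have "prod.swap \<mu> \<in> exponent_pairs_total (Suc n)" by (auto simp: exponent_pairs_total_def)
        then show "\<mu> \<in> prod.swap ` exponent_pairs_total (Suc n)" by (intro image_eqI[of _ _ "prod.swap \<mu>"]) auto
      qed
    qed
    finally show ?thesis by simp
  qed
  from exponent_pairs_total_derivative_coeff[OF Suc.IH this]
  have "c' (\<alpha>, \<beta>) = 0" if "(\<alpha>, \<beta>) \<in> exponent_pairs_total (Suc n)" "\<alpha> j > 0" for \<alpha> \<beta> j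
    using that by blast
  then have pos': "c (\<alpha>, \<beta>) = 0" if "(\<alpha>, \<beta>) \<in> exponent_pairs_total (Suc n)" "\<beta> j > 0" for \<alpha> \<beta> j
    using that by (fastforce simp: c'_def exponent_pairs_total_def add.commute)
  let ?o = "(\<lambda>_::'d. 0::nat, \<lambda>_::'d. 0::nat)"
  have nz: "c \<mu> = 0" if "\<mu> \<in> exponent_pairs_total (Suc n)" "\<mu> \<noteq> ?o" for \<mu>
  proof -
    obtain \<alpha> \<beta> where ab: "\<mu> = (\<alpha>, \<beta>)" by (cases \<mu>)
    then have "(\<exists>j. \<alpha> j > 0) \<or> (\<exists>j. \<beta> j > 0)" using that(2) by (auto simp: fun_eq_iff)
    then show ?thesis using pos pos' that(1) ab by blast
  qed
  have oin: "?o \<in> exponent_pairs_total (Suc n)" by (simp add: exponent_pairs_total_def)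
  have "(\<Sum>\<mu>\<in>exponent_pairs_total (Suc n). c \<mu> * zmon_pair \<mu> 0) = (\<Sum>\<mu>\<in>{?o}. c \<mu> * zmon_pair \<mu> 0)"
    by (rule sum.mono_neutral_right[OF finite_exponent_pairs_total]) (use oin nz in auto)
  then have "c ?o = 0" using Suc.prems[of 0] by (simp add: zmon_pair_def zmon_def)
  then show ?case using nz by blast
qed

text \<open>
  On the sphere monomials of different total degree can be dependent.  Here the parts of bidegree
  \<open>(N, l)\<close> have different charges \<open>N - l\<close>, hence are orthogonal and vanish separately; each is
  homogeneous, so it vanishes on the whole space.
\<close>

lemma zmon_independent_sphere:
  fixes c :: "('d::finite \<Rightarrow> nat) \<times> ('d \<Rightarrow> nat) \<Rightarrow> complex"
  assumes 0: "\<And>z. z \<in> usph \<Longrightarrow> (\<Sum>\<mu>\<in>exponent_pairs N L. c \<mu> * zmon_pair \<mu> z) = 0"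
  shows "\<forall>\<mu>\<in>exponent_pairs N L. c \<mu> = 0"
proof -
  define F where "F = (\<lambda>l (z::complex ^ 'd). \<Sum>\<mu>\<in>expo N l. c \<mu> * zmon_pair \<mu> z)"
  have bF: "bihom N l (F l)" for l
    unfolding F_def
  proof (intro bihom_sum bihom_scale)
    fix \<mu> :: "('d \<Rightarrow> nat) \<times> ('d \<Rightarrow> nat)" assume "\<mu> \<in> expo N l"
    then show "bihom N l (zmon_pair \<mu>)" using bihom_zmon by (auto simp: expo_def zmon_pair_def)
  qed
  have split: "(\<Sum>\<mu>\<in>exponent_pairs N L. c \<mu> * zmon_pair \<mu> z) = (\<Sum>l\<le>L. F l z)" for z
  proof -
    have U: "exponent_pairs N L = (\<Union>l\<in>{..L}. expo N l)" by (auto simp: exponent_pairs_def expo_def)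
    have "(\<Sum>\<mu>\<in>(\<Union>l\<in>{..L}. expo N l). c \<mu> * zmon_pair \<mu> z) = (\<Sum>l\<le>L. \<Sum>\<mu>\<in>expo N l. c \<mu> * zmon_pair \<mu> z)"
    proof (rule sum.UNION_disjoint)
      show "\<forall>l\<in>{..L}. \<forall>l'\<in>{..L}. l \<noteq> l' \<longrightarrow> expo N l \<inter> (expo N l' :: (('d \<Rightarrow> nat) \<times> _) set) = {}"
        by (auto simp: expo_def)
    qed (simp_all add: finite_expo)
    then show ?thesis by (simp only: U F_def)
  qed
  have Fl0: "F l z = 0" if "l \<le> L" for l z
  proof -
    have orth: "ip (F l') (F l) = 0" if "l' \<noteq> l" for l'
      unfolding ip_def using that by (intro sphere_int_charge[OF bihom_mult[OF bF bihom_cnj[OF bF]]]) simp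
    have "0 = ip (\<lambda>z. 0) (F l)" by (simp add: ip_def)
    also have "\<dots> = ip (\<lambda>z. \<Sum>l'\<le>L. 1 * F l' z) (F l)"
      by (rule ip_cong) (auto simp: 0 split[symmetric])
    also have "\<dots> = (\<Sum>l'\<le>L. 1 * ip (F l') (F l))"
      by (intro ip_sum_left bihom_continuous[OF bF])
    also have "\<dots> = (\<Sum>l'\<le>L. if l' = l then ip (F l) (F l) else 0)"
      using orth by (intro sum.cong) auto
    also have "\<dots> = ip (F l) (F l)" using that by simp
    finally have "ip (F l) (F l) = 0" by simp
    then show ?thesis
      by (rule bihom_zero_if_zero_on_sphere[OF bF ip_self_zero[OF bihom_continuous[OF bF]]])
  qed
  define c' where "c' = (\<lambda>\<mu>. if \<mu> \<in> exponent_pairs N L then c \<mu> else 0)"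
  have sub: "exponent_pairs N L \<subseteq> exponent_pairs_total (N + L)" by (auto simp: exponent_pairs_def exponent_pairs_total_def)
  have "(\<Sum>\<mu>\<in>exponent_pairs_total (N + L). c' \<mu> * zmon_pair \<mu> z) = 0" for z
  proof -
    have "(\<Sum>\<mu>\<in>exponent_pairs_total (N + L). c' \<mu> * zmon_pair \<mu> z) = (\<Sum>\<mu>\<in>exponent_pairs N L. c' \<mu> * zmon_pair \<mu> z)"
      by (rule sum.mono_neutral_right[OF finite_exponent_pairs_total sub]) (simp add: c'_def)
    also have "\<dots> = (\<Sum>\<mu>\<in>exponent_pairs N L. c \<mu> * zmon_pair \<mu> z)" by (intro sum.cong) (auto simp: c'_def)
    also have "\<dots> = 0" unfolding split using Fl0 by simp
    finally show ?thesis .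
  qed
  from zmon_independent[OF this] have c'0: "\<forall>\<mu>\<in>exponent_pairs_total (N + L). c' \<mu> = 0" .
  show ?thesis
  proof
    fix \<mu> :: "('d \<Rightarrow> nat) \<times> ('d \<Rightarrow> nat)" assume \<mu>: "\<mu> \<in> exponent_pairs N L"
    then have "c' \<mu> = 0" using c'0 sub by blast
    then show "c \<mu> = 0" using \<mu> by (simp add: c'_def)
  qed
qed

text \<open>
  Otherwise some nontrivial combination of the monomials would be orthogonal to a basis of the space
  that contains them, contrary to \<open>zmon_independent_sphere\<close>.
\<close>

lemma card_exponent_pairs_le_hindex:
  "card (exponent_pairs N L :: (('d::finite \<Rightarrow> nat) \<times> ('d \<Rightarrow> nat)) set) \<le> card (hindex TYPE('d) N L)"
proof (rule ccontr)
  assume "\<not> ?thesis"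
  then have lt: "card (hindex TYPE('d) N L) < card (exponent_pairs N L :: (('d \<Rightarrow> nat) \<times> ('d \<Rightarrow> nat)) set)" by simp
  obtain c where c: "\<exists>\<mu>\<in>exponent_pairs N L. c \<mu> \<noteq> 0"
    "\<And>\<iota>. \<iota> \<in> hindex TYPE('d) N L \<Longrightarrow> (\<Sum>\<mu>\<in>exponent_pairs N L. ip (zmon_pair \<mu> :: complex ^ 'd \<Rightarrow> complex) (hbasis \<iota>) * c \<mu>) = 0"
    using underdetermined_system[OF finite_hindex finite_exponent_pairs lt, of "\<lambda>\<iota> \<mu>. ip (zmon_pair \<mu>) (hbasis \<iota>)"] by blast
  define F where "F = (\<lambda>z::complex ^ 'd. \<Sum>\<mu>\<in>exponent_pairs N L. c \<mu> * zmon_pair \<mu> z)"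
  have Wm: "bihom_le N L (zmon_pair \<mu> :: complex ^ 'd \<Rightarrow> complex)" if "\<mu> \<in> exponent_pairs N L" for \<mu>
    using that bihom_le_base[OF bihom_zmon] by (auto simp: exponent_pairs_def zmon_pair_def)
  have "bihom_le N L F" unfolding F_def by (intro bihom_le_sum bihom_le_scale Wm)
  then have FS: "F \<in> sphere_span (hindex TYPE('d) N L) hbasis" by (rule bihom_le_sphere_span)
  have "F z = 0" if "z \<in> usph" for z
  proof -
    have "ip F (hbasis \<iota>) = 0" if "\<iota> \<in> hindex TYPE('d) N L" for \<iota>
    proof -
      have "ip F (hbasis \<iota>) = (\<Sum>\<mu>\<in>exponent_pairs N L. c \<mu> * ip (zmon_pair \<mu>) (hbasis \<iota>))"
        unfolding F_def using that hindex_subset by (intro ip_sum_left bihom_le_continuous[OF Wm] hbasis_continuous) auto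
      then show ?thesis using c(2)[OF that] by (simp add: mult.commute)
    qed
    then show ?thesis using ONfam_expand[OF hindex_ONfam FS that] by simp
  qed
  then have "\<forall>\<mu>\<in>exponent_pairs N L. c \<mu> = 0" unfolding F_def by (rule zmon_independent_sphere)
  then show False using c(1) by blast
qed

text \<open>
  All exponents may be chosen freely in \<open>{0..t}\<close>, except for one exponent of \<open>z\<close>, which the degree \<open>N\<close>
  determines.
\<close>

lemma card_exponent_pairs_ge:
  assumes "CARD('d::finite) * t \<le> L" "CARD('d) * t \<le> N"
  shows "(t + 1) ^ (2 * CARD('d) - 1) \<le> card (exponent_pairs N L :: (('d \<Rightarrow> nat) \<times> ('d \<Rightarrow> nat)) set)"
proof -
  define p where "p = (undefined :: 'd)"
  let ?A = "(UNIV - {p}) \<rightarrow>\<^sub>E {..t} :: ('d \<Rightarrow> nat) set" and ?B = "(UNIV :: 'd set) \<rightarrow>\<^sub>E {..t}"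
  define h where "h = (\<lambda>(a, b). (a(p := N - sum a (UNIV - {p})), b) :: ('d \<Rightarrow> nat) \<times> ('d \<Rightarrow> nat))"
  have sA: "sum a (UNIV - {p}) \<le> CARD('d) * t" if "a \<in> ?A" for a
  proof -
    have "sum a (UNIV - {p}) \<le> of_nat (card (UNIV - {p})) * t"
      using that by (intro sum_bounded_above) auto
    also have "\<dots> \<le> CARD('d) * t" by (simp add: card_Diff_singleton)
    finally show ?thesis .
  qed
  have sB: "sum b UNIV \<le> CARD('d) * t" if "b \<in> ?B" for b
    using sum_bounded_above[of UNIV b t] that by auto
  have img: "h ` (?A \<times> ?B) \<subseteq> exponent_pairs N L"
  proof
    fix \<mu> assume "\<mu> \<in> h ` (?A \<times> ?B)"
    then obtain a b where ab: "a \<in> ?A" "b \<in> ?B" "\<mu> = h (a, b)" by auto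
    have "sum (a(p := N - sum a (UNIV - {p}))) (UNIV - {p}) = sum a (UNIV - {p})" by (intro sum.cong) auto
    then have "sum (a(p := N - sum a (UNIV - {p}))) UNIV = N"
      using sA[OF ab(1)] assms(2) by (subst sum.remove[of UNIV p]) auto
    moreover have "sum b UNIV \<le> L" using sB[OF ab(2)] assms(1) by simp
    ultimately show "\<mu> \<in> exponent_pairs N L" by (simp add: ab(3) h_def exponent_pairs_def)
  qed
  have inj: "inj_on h (?A \<times> ?B)"
  proof (rule inj_onI)
    fix x y assume x: "x \<in> ?A \<times> ?B" and y: "y \<in> ?A \<times> ?B" and e: "h x = h y"
    obtain a b a' b' where ab: "x = (a, b)" "y = (a', b')" by (cases x, cases y)
    have u: "a(p := N - sum a (UNIV - {p})) = a'(p := N - sum a' (UNIV - {p}))" "b = b'"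
      using e ab by (auto simp: h_def)
    have "a = a'"
    proof (rule PiE_ext)
      show "a \<in> ?A" "a' \<in> ?A" using x y ab by auto
      fix i assume "i \<in> UNIV - {p}"
      then show "a i = a' i" using fun_cong[OF u(1), of i] by simp
    qed
    then show "x = y" using u ab by simp
  qed
  have "card (?A \<times> ?B) = (t + 1) ^ (CARD('d) - 1) * (t + 1) ^ CARD('d)"
    by (simp add: card_cartesian_product card_PiE card_Diff_singleton)
  also have "\<dots> = (t + 1) ^ (2 * CARD('d) - 1)"
    using zero_less_card_finite[where 'a='d] by (simp add: power_add[symmetric] mult_2 del: power_Suc)
  finally have "(t + 1) ^ (2 * CARD('d) - 1) = card (h ` (?A \<times> ?B))"
    by (simp add: card_image[OF inj])
  also have "\<dots> \<le> card (exponent_pairs N L :: (('d \<Rightarrow> nat) \<times> ('d \<Rightarrow> nat)) set)"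
    by (rule card_mono[OF finite_exponent_pairs img])
  finally show ?thesis .
qed

section \<open>Moments of random signs\<close>

text \<open>
  Hoeffding's lemma for a fair coin.
\<close>

lemma cosh_subgaussian: "exp a + exp (- a) \<le> 2 * exp (a\<^sup>2 / 2)" for a :: real
proof -
  have nonneg: "exp a + exp (- a) \<le> 2 * exp (a\<^sup>2 / 2)" if "a \<ge> 0" for a :: real
  proof -
    have "- (2 * a) * (1/2) + ln (1 + 1/2 * (exp (2 * a) - 1)) \<le> (2 * a)\<^sup>2 / 8"
      using that by (intro Hoeffdings_lemma_aux) auto
    then have "ln (1 + 1/2 * (exp (2 * a) - 1)) \<le> a + a\<^sup>2 / 2" by (simp add: power2_eq_square)
    moreover have p: "1 + 1/2 * (exp (2 * a) - 1) > 0" using exp_gt_zero[of "2 * a"] by (simp add: algebra_simps add_pos_nonneg)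
    ultimately have "1 + 1/2 * (exp (2 * a) - 1) \<le> exp (a + a\<^sup>2 / 2)"
      by (metis exp_le_cancel_iff exp_ln)
    then have "1 + 1/2 * (exp (2 * a) - 1) \<le> exp a * exp (a\<^sup>2 / 2)" by (simp only: exp_add)
    moreover have "1 + x \<le> 2 * y" if "1 + 1/2 * (x - 1) \<le> y" for x y :: real
      using that by (simp add: field_simps)
    ultimately have "1 + exp (2 * a) \<le> 2 * (exp a * exp (a\<^sup>2 / 2))" by blast
    then have "exp (- a) * (1 + exp (2 * a)) \<le> exp (- a) * (2 * (exp a * exp (a\<^sup>2 / 2)))"
      by (intro mult_left_mono) auto
    then show ?thesis by (simp add: algebra_simps flip: exp_add)
  qed
  show ?thesis using nonneg[of a] nonneg[of "- a"] by (cases "a \<ge> 0") (auto simp: add.commute)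
qed

abbreviation signs :: "'s set \<Rightarrow> ('s \<Rightarrow> real) set" where
  "signs S \<equiv> S \<rightarrow>\<^sub>E {-1, 1}"

lemma card_signs: "finite S \<Longrightarrow> card (signs S) = 2 ^ card S"
  by (simp add: card_PiE card_insert_if numeral_2_eq_2)

lemma signs_exp_sum:
  fixes a :: "'s \<Rightarrow> real"
  assumes S: "finite S"
  shows "(\<Sum>\<epsilon>\<in>signs S. exp (\<Sum>s\<in>S. \<epsilon> s * a s)) \<le> 2 ^ card S * exp ((\<Sum>s\<in>S. (a s)\<^sup>2) / 2)"
proof -
  have "(\<Sum>\<epsilon>\<in>signs S. exp (\<Sum>s\<in>S. \<epsilon> s * a s)) = (\<Sum>\<epsilon>\<in>signs S. \<Prod>s\<in>S. exp (\<epsilon> s * a s))"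
    by (simp add: exp_sum S)
  also have "\<dots> = (\<Prod>s\<in>S. \<Sum>y\<in>{-1, 1}. exp (y * a s))"
    by (rule prod_sum_PiE[symmetric]) (use S in auto)
  also have "\<dots> = (\<Prod>s\<in>S. exp (a s) + exp (- a s))" by (simp add: add.commute)
  also have "\<dots> \<le> (\<Prod>s\<in>S. 2 * exp ((a s)\<^sup>2 / 2))"
    by (intro prod_mono conjI cosh_subgaussian add_nonneg_nonneg) auto
  also have "\<dots> = 2 ^ card S * exp ((\<Sum>s\<in>S. (a s)\<^sup>2) / 2)"
    by (simp add: prod.distrib exp_sum[OF S, symmetric] sum_divide_distrib)
  finally show ?thesis .
qed

lemma power_le_fact_exp: "y ^ n \<le> fact n * exp y" if "y \<ge> 0" for y :: real
proof -
  have "sum (\<lambda>n. y ^ n /\<^sub>R fact n) {n} \<le> (\<Sum>n. y ^ n /\<^sub>R fact n)"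
    by (rule sum_le_suminf[OF summable_exp_generic]) (use that in auto)
  then have "y ^ n / fact n \<le> exp y" by (simp add: exp_def divide_inverse mult.commute)
  then show ?thesis by (simp add: divide_le_eq mult.commute)
qed

lemma even_power_le_fact_exp: "x ^ (2 * k) \<le> fact (2 * k) * (exp x + exp (- x))" for x :: real
proof -
  have "x ^ (2 * k) = \<bar>x\<bar> ^ (2 * k)" by (simp add: power_mult)
  also have "\<dots> \<le> fact (2 * k) * exp \<bar>x\<bar>" by (rule power_le_fact_exp) simp
  also have "\<dots> \<le> fact (2 * k) * (exp x + exp (- x))"
    by (intro mult_left_mono) (auto simp: abs_if)
  finally show ?thesis .
qed

lemma sum_scaled_add: "(\<Sum>i\<in>I. c * (f i + g i)) = c * ((\<Sum>i\<in>I. f i) + (\<Sum>i\<in>I. g i))" for c :: real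
  by (simp add: sum_distrib_left sum.distrib distrib_left)

text \<open>
  Khintchine's inequality with the growth \<open>\<surd>k\<close> of the constant, by the exponential method: bound
  \<open>x\<^sup>2\<^sup>k\<close> by \<open>(2k)! (e\<^sup>x + e\<^sup>-\<^sup>x)\<close> after scaling by \<open>t\<close>, and choose \<open>t\<^sup>2 = 2k / A\<close>.
\<close>

lemma signs_moment_real:
  fixes a :: "'s \<Rightarrow> real"
  assumes S: "finite S" and k: "k \<ge> 1"
  shows "(\<Sum>\<epsilon>\<in>signs S. (\<Sum>s\<in>S. \<epsilon> s * a s) ^ (2 * k)) \<le> 2 ^ card S * (12 * real k * (\<Sum>s\<in>S. (a s)\<^sup>2)) ^ k"
proof -
  define A where "A = (\<Sum>s\<in>S. (a s)\<^sup>2)"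
  have A0: "A \<ge> 0" by (simp add: A_def sum_nonneg)
  show ?thesis
  proof (cases "A = 0")
    case True
    then have "\<forall>s\<in>S. a s = 0" using S by (simp add: A_def sum_nonneg_eq_0_iff)
    then have "(\<Sum>\<epsilon>\<in>signs S. (\<Sum>s\<in>S. \<epsilon> s * a s) ^ (2 * k)) = 0" using k by simp
    then show ?thesis using A0 unfolding A_def by simp
  next
    case False
    then have Ap: "A > 0" using A0 by simp
    \<comment> \<open>this value of \<open>t\<close> makes \<open>t\<^sup>2 A / 2 = k\<close>, so the exponential factor is only \<open>e\<^sup>k\<close>\<close>
    define t where "t = sqrt (2 * k / A)"
    have t2: "t\<^sup>2 = 2 * k / A" using Ap by (simp add: t_def)
    let ?X = "\<lambda>\<epsilon>. \<Sum>s\<in>S. \<epsilon> s * a s"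
    have E: "(\<Sum>\<epsilon>\<in>signs S. exp (c * ?X \<epsilon>)) \<le> 2 ^ card S * exp (c\<^sup>2 * A / 2)" for c
      using signs_exp_sum[OF S, of "\<lambda>s. c * a s"]
      by (simp add: sum_distrib_left power_mult_distrib A_def mult.left_commute)
    have e2: "t\<^sup>2 * A / 2 = k" using Ap by (simp add: t2)
    have "t ^ (2 * k) * (\<Sum>\<epsilon>\<in>signs S. ?X \<epsilon> ^ (2 * k)) = (\<Sum>\<epsilon>\<in>signs S. (t * ?X \<epsilon>) ^ (2 * k))"
      by (simp only: sum_distrib_left[of "t ^ (2 * k)"] power_mult_distrib)
    also have "\<dots> \<le> (\<Sum>\<epsilon>\<in>signs S. fact (2 * k) * (exp (t * ?X \<epsilon>) + exp (- (t * ?X \<epsilon>))))"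
      by (intro sum_mono even_power_le_fact_exp)
    also have "\<dots> = fact (2 * k) * ((\<Sum>\<epsilon>\<in>signs S. exp (t * ?X \<epsilon>)) + (\<Sum>\<epsilon>\<in>signs S. exp ((- t) * ?X \<epsilon>)))"
      by (simp only: sum_scaled_add mult_minus_left)
    also have "\<dots> \<le> fact (2 * k) * (2 ^ card S * exp (t\<^sup>2 * A / 2) + 2 ^ card S * exp ((- t)\<^sup>2 * A / 2))"
      by (intro mult_left_mono add_mono E) auto
    also have "\<dots> = fact (2 * k) * (2 * 2 ^ card S * exp (real k))"
      by (simp only: power2_minus e2) simp
    also have "\<dots> \<le> real (2 * k) ^ (2 * k) * (2 * 2 ^ card S * 3 ^ k)"
    proof (intro mult_mono)
      show "(fact (2 * k) :: real) \<le> real (2 * k) ^ (2 * k)" by (metis fact_le_power of_nat_le_iff of_nat_fact of_nat_power order_refl)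
      show "exp (real k) \<le> 3 ^ k"
        using power_mono[OF exp_le, of k] by (simp add: exp_of_nat_mult[symmetric])
    qed auto
    finally have main: "(2 * k / A) ^ k * (\<Sum>\<epsilon>\<in>signs S. ?X \<epsilon> ^ (2 * k)) \<le> real (2 * k) ^ (2 * k) * (2 * 2 ^ card S * 3 ^ k)"
      by (simp only: power_mult t2)
    have kp: "real k > 0" using k by simp
    have "(\<Sum>\<epsilon>\<in>signs S. ?X \<epsilon> ^ (2 * k)) = (A / (2 * k)) ^ k * ((2 * k / A) ^ k * (\<Sum>\<epsilon>\<in>signs S. ?X \<epsilon> ^ (2 * k)))"
      using Ap kp by (simp add: power_divide power_mult_distrib)
    also have "\<dots> \<le> (A / (2 * k)) ^ k * (real (2 * k) ^ (2 * k) * (2 * 2 ^ card S * 3 ^ k))"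
      using Ap kp by (intro mult_left_mono main) auto
    also have "real (2 * k) ^ (2 * k) = (2 * real k) ^ k * (2 * real k) ^ k"
      unfolding mult_2[of k] power_add by simp
    also have "(A / (2 * k)) ^ k * ((2 * real k) ^ k * (2 * real k) ^ k * (2 * 2 ^ card S * 3 ^ k))
       = 2 ^ card S * (2 * (6 * real k * A) ^ k)"
    proof -
      have "A / (2 * k) * (2 * real k) = A" using kp by simp
      then have "(A / (2 * k)) ^ k * (2 * real k) ^ k = A ^ k"
        by (simp only: power_mult_distrib[symmetric])
      then have "(A / (2 * k)) ^ k * ((2 * real k) ^ k * (2 * real k) ^ k * (2 * 2 ^ card S * 3 ^ k))
         = A ^ k * (2 * real k) ^ k * (2 * 2 ^ card S * 3 ^ k)" by (simp only: mult.assoc[symmetric])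
      also have "\<dots> = 2 ^ card S * (2 * ((2 * real k) * 3 * A) ^ k)" by (simp only: power_mult_distrib mult_ac)
      finally show ?thesis by simp
    qed
    also have "\<dots> \<le> 2 ^ card S * (12 * real k * A) ^ k"
    proof (intro mult_left_mono)
      have "(2::real) \<le> 2 ^ k" using power_increasing[OF k, of "2::real"] by simp
      then have "2 * (6 * real k * A) ^ k \<le> 2 ^ k * (6 * real k * A) ^ k"
        using A0 by (intro mult_right_mono) auto
      also have "\<dots> = (2 * (6 * real k * A)) ^ k" by (rule power_mult_distrib[symmetric])
      also have "2 * (6 * real k * A) = 12 * real k * A" by simp
      finally show "2 * (6 * real k * A) ^ k \<le> (12 * real k * A) ^ k" .
    qed auto
    finally show ?thesis by (simp add: A_def)
  qed
qed

lemma signs_moment_complex: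
  fixes a :: "'s \<Rightarrow> complex"
  assumes S: "finite S" and k: "k \<ge> 1"
  shows "(\<Sum>\<epsilon>\<in>signs S. norm (\<Sum>s\<in>S. of_real (\<epsilon> s) * a s) ^ (2 * k)) \<le> 2 ^ card S * (48 * real k * (\<Sum>s\<in>S. (norm (a s))\<^sup>2)) ^ k"
proof -
  define A where "A = (\<Sum>s\<in>S. (norm (a s))\<^sup>2)"
  have A0: "A \<ge> 0" by (simp add: A_def sum_nonneg)
  have el: "norm z ^ (2 * k) \<le> 2 ^ k * (Re z ^ (2 * k) + Im z ^ (2 * k))" for z :: complex
  proof -
    have m: "(x + y) ^ k \<le> 2 ^ k * (x ^ k + y ^ k)" if "x \<ge> 0" "y \<ge> 0" "x \<le> y" for x y :: real
    proof -
      have "(x + y) ^ k \<le> (2 * y) ^ k" using that by (intro power_mono) auto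
      also have "\<dots> \<le> 2 ^ k * (x ^ k + y ^ k)" using that by (simp add: power_mult_distrib)
      finally show ?thesis .
    qed
    have "norm z ^ (2 * k) = ((Re z)\<^sup>2 + (Im z)\<^sup>2) ^ k" by (simp add: power_mult cmod_power2)
    also have "\<dots> \<le> 2 ^ k * (((Re z)\<^sup>2) ^ k + ((Im z)\<^sup>2) ^ k)"
      using m[of "(Re z)\<^sup>2" "(Im z)\<^sup>2"] m[of "(Im z)\<^sup>2" "(Re z)\<^sup>2"]
      by (cases "(Re z)\<^sup>2 \<le> (Im z)\<^sup>2") (auto simp: add.commute)
    finally show ?thesis by (simp add: power_mult)
  qed
  have part: "(\<Sum>\<epsilon>\<in>signs S. (\<Sum>s\<in>S. \<epsilon> s * h (a s)) ^ (2 * k)) \<le> 2 ^ card S * (12 * real k * A) ^ k"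
    if h: "\<And>z. (h z)\<^sup>2 \<le> (norm z)\<^sup>2" for h :: "complex \<Rightarrow> real"
  proof -
    have "(\<Sum>s\<in>S. (h (a s))\<^sup>2) \<le> A" unfolding A_def by (intro sum_mono h)
    then have "2 ^ card S * (12 * real k * (\<Sum>s\<in>S. (h (a s))\<^sup>2)) ^ k \<le> 2 ^ card S * (12 * real k * A) ^ k"
      by (intro mult_left_mono power_mono) (auto simp: sum_nonneg)
    then show ?thesis using signs_moment_real[OF S k, of "\<lambda>s. h (a s)"] by (rule order_trans[rotated])
  qed
  have "(\<Sum>\<epsilon>\<in>signs S. norm (\<Sum>s\<in>S. of_real (\<epsilon> s) * a s) ^ (2 * k))
     \<le> (\<Sum>\<epsilon>\<in>signs S. 2 ^ k * ((\<Sum>s\<in>S. \<epsilon> s * Re (a s)) ^ (2 * k) + (\<Sum>s\<in>S. \<epsilon> s * Im (a s)) ^ (2 * k)))"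
  proof (rule sum_mono)
    fix \<epsilon> :: "'s \<Rightarrow> real"
    have "Re (\<Sum>s\<in>S. of_real (\<epsilon> s) * a s) = (\<Sum>s\<in>S. \<epsilon> s * Re (a s))"
      "Im (\<Sum>s\<in>S. of_real (\<epsilon> s) * a s) = (\<Sum>s\<in>S. \<epsilon> s * Im (a s))" by simp_all
    then show "norm (\<Sum>s\<in>S. of_real (\<epsilon> s) * a s) ^ (2 * k) \<le>
       2 ^ k * ((\<Sum>s\<in>S. \<epsilon> s * Re (a s)) ^ (2 * k) + (\<Sum>s\<in>S. \<epsilon> s * Im (a s)) ^ (2 * k))"
      using el[of "\<Sum>s\<in>S. of_real (\<epsilon> s) * a s"] by simp
  qed
  also have "\<dots> = 2 ^ k * ((\<Sum>\<epsilon>\<in>signs S. (\<Sum>s\<in>S. \<epsilon> s * Re (a s)) ^ (2 * k)) + (\<Sum>\<epsilon>\<in>signs S. (\<Sum>s\<in>S. \<epsilon> s * Im (a s)) ^ (2 * k)))"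
    by (rule sum_scaled_add)
  also have "\<dots> \<le> 2 ^ k * (2 ^ card S * (12 * real k * A) ^ k + 2 ^ card S * (12 * real k * A) ^ k)"
    by (intro mult_left_mono add_mono part) (auto simp: cmod_power2)
  also have "\<dots> = 2 ^ card S * (2 * (24 * real k * A) ^ k)"
  proof -
    have e: "24 * real k * A = 2 * (12 * real k * A)" by simp
    have "(24 * real k * A) ^ k = 2 ^ k * (12 * real k * A) ^ k"
      unfolding e by (rule power_mult_distrib)
    then show ?thesis by (simp only: mult_2 distrib_left mult_ac)
  qed
  also have "\<dots> \<le> 2 ^ card S * (48 * real k * A) ^ k"
  proof (intro mult_left_mono)
    have "(2::real) \<le> 2 ^ k" using power_increasing[OF k, of "2::real"] by simp
    then have "2 * (24 * real k * A) ^ k \<le> 2 ^ k * (24 * real k * A) ^ k"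
      using A0 by (intro mult_right_mono) auto
    also have "\<dots> = (2 * (24 * real k * A)) ^ k" by (rule power_mult_distrib[symmetric])
    also have "2 * (24 * real k * A) = 48 * real k * A" by simp
    finally show "2 * (24 * real k * A) ^ k \<le> (48 * real k * A) ^ k" .
  qed auto
  finally show ?thesis by (simp add: A_def)
qed

section \<open>Flat polynomials in subspaces of small codimension\<close>

text \<open>
  Coordinate vectors are added one at a time: solve for the given equations together with
  orthogonality to the vectors already found.
\<close>

lemma orthonormal_kernel:
  fixes a :: "'j \<Rightarrow> 'i \<Rightarrow> complex"
  assumes "finite I" "finite J" "r + card J \<le> card I"
  shows "\<exists>v :: nat \<Rightarrow> 'i \<Rightarrow> complex. (\<forall>s<r. \<forall>t<r. (\<Sum>i\<in>I. v s i * cnj (v t i)) = (if s = t then 1 else 0)) \<and>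
     (\<forall>s<r. \<forall>j\<in>J. (\<Sum>i\<in>I. a j i * v s i) = 0)"
  using assms(3)
proof (induction r)
  case 0 then show ?case by simp
next
  case (Suc r)
  then have "r + card J \<le> card I" by simp
  from Suc.IH[OF this] obtain v :: "nat \<Rightarrow> 'i \<Rightarrow> complex" where
    v0: "\<forall>s<r. \<forall>t<r. (\<Sum>i\<in>I. v s i * cnj (v t i)) = (if s = t then 1 else 0)"
      "\<forall>s<r. \<forall>j\<in>J. (\<Sum>i\<in>I. a j i * v s i) = 0" by blast
  have v: "\<And>s t. s < r \<Longrightarrow> t < r \<Longrightarrow> (\<Sum>i\<in>I. v s i * cnj (v t i)) = (if s = t then 1 else 0)"
     "\<And>s j. s < r \<Longrightarrow> j \<in> J \<Longrightarrow> (\<Sum>i\<in>I. a j i * v s i) = 0"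
    using v0 by blast+
  define b where "b = case_sum a (\<lambda>t i. cnj (v t i))"
  have "card (J <+> {..<r}) < card I" using Suc.prems assms(2) by (simp add: card_Plus)
  from underdetermined_system[OF _ assms(1) this, of b] assms(2) obtain c where
    c: "\<exists>i\<in>I. c i \<noteq> 0" "\<And>x. x \<in> J <+> {..<r} \<Longrightarrow> (\<Sum>i\<in>I. b x i * c i) = 0" by auto
  have cJ: "(\<Sum>i\<in>I. a j i * c i) = 0" if "j \<in> J" for j
    using c(2)[OF InlI[OF that]] by (simp add: b_def)
  have cv: "(\<Sum>i\<in>I. cnj (v t i) * c i) = 0" if "t < r" for t
    using c(2)[OF InrI, of t] that by (simp add: b_def)
  define n where "n = (\<Sum>i\<in>I. (norm (c i))\<^sup>2)"
  have "n \<noteq> 0" using c(1) assms(1) by (auto simp: n_def sum_nonneg_eq_0_iff)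
  then have n: "n > 0" using sum_nonneg[of I "\<lambda>i. (norm (c i))\<^sup>2"] by (simp add: n_def)
  define w where "w = (\<lambda>i. c i / of_real (sqrt n))"
  define v' where "v' = v(r := w)"
  have ww: "(\<Sum>i\<in>I. w i * cnj (w i)) = 1"
  proof -
    have "(\<Sum>i\<in>I. w i * cnj (w i)) = (\<Sum>i\<in>I. c i * cnj (c i)) / of_real (sqrt n * sqrt n)"
      unfolding w_def sum_divide_distrib of_real_mult by (intro sum.cong refl) simp
    also have "(\<Sum>i\<in>I. c i * cnj (c i)) = of_real n"
      unfolding n_def of_real_sum complex_norm_square ..
    finally show ?thesis using n by simp
  qed
  have wv: "(\<Sum>i\<in>I. w i * cnj (v t i)) = 0" if "t < r" for t
    using cv[OF that] by (simp add: w_def sum_divide_distrib[symmetric] mult.commute)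
  have vw: "(\<Sum>i\<in>I. v t i * cnj (w i)) = 0" if "t < r" for t
  proof -
    have "(\<Sum>i\<in>I. v t i * cnj (w i)) = cnj (\<Sum>i\<in>I. w i * cnj (v t i))" by (simp add: mult.commute)
    then show ?thesis using wv[OF that] by simp
  qed
  have wJ: "(\<Sum>i\<in>I. a j i * w i) = 0" if "j \<in> J" for j
    using cJ[OF that] by (simp add: w_def sum_divide_distrib[symmetric])
  have "\<forall>s<Suc r. \<forall>t<Suc r. (\<Sum>i\<in>I. v' s i * cnj (v' t i)) = (if s = t then 1 else 0)"
    using v(1) ww wv vw by (auto simp: v'_def less_Suc_eq)
  moreover have "\<forall>s<Suc r. \<forall>j\<in>J. (\<Sum>i\<in>I. a j i * v' s i) = 0"
    using v(2) wJ by (auto simp: v'_def less_Suc_eq)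
  ultimately show ?case by blast
qed

lemma bessel_coordinates:
  fixes v :: "nat \<Rightarrow> 'i \<Rightarrow> complex"
  assumes v: "\<And>s t. s < r \<Longrightarrow> t < r \<Longrightarrow> (\<Sum>i\<in>I. v s i * cnj (v t i)) = (if s = t then 1 else 0)"
  shows "(\<Sum>s<r. (norm (\<Sum>i\<in>I. v s i * x i))\<^sup>2) \<le> (\<Sum>i\<in>I. (norm (x i))\<^sup>2)"
proof -
  define b where "b = (\<lambda>s. \<Sum>i\<in>I. v s i * x i)"
  define p where "p = (\<lambda>i. \<Sum>s<r. b s * cnj (v s i))"
  have cb: "cnj (b s) = (\<Sum>i\<in>I. cnj (v s i) * cnj (x i))" for s by (simp add: b_def)
  have xp: "(\<Sum>i\<in>I. x i * cnj (p i)) = (\<Sum>s<r. b s * cnj (b s))"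
  proof -
    have "(\<Sum>i\<in>I. x i * cnj (p i)) = (\<Sum>i\<in>I. \<Sum>s<r. cnj (b s) * (v s i * x i))"
      by (simp add: p_def sum_distrib_left mult_ac)
    also have "\<dots> = (\<Sum>s<r. cnj (b s) * b s)" by (subst sum.swap) (simp add: b_def sum_distrib_left)
    finally show ?thesis by (simp add: mult.commute)
  qed
  have px: "(\<Sum>i\<in>I. p i * cnj (x i)) = (\<Sum>s<r. b s * cnj (b s))"
  proof -
    have "(\<Sum>i\<in>I. p i * cnj (x i)) = cnj (\<Sum>i\<in>I. x i * cnj (p i))" by (simp add: mult.commute)
    also have "\<dots> = (\<Sum>s<r. b s * cnj (b s))" unfolding xp by (simp add: mult.commute)
    finally show ?thesis .
  qed
  have pp: "(\<Sum>i\<in>I. p i * cnj (p i)) = (\<Sum>s<r. b s * cnj (b s))"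
  proof -
    have "(\<Sum>i\<in>I. p i * cnj (p i)) = (\<Sum>i\<in>I. \<Sum>s<r. \<Sum>t<r. b s * cnj (b t) * (v t i * cnj (v s i)))"
      by (simp add: p_def sum_product mult_ac)
    also have "\<dots> = (\<Sum>s<r. \<Sum>i\<in>I. \<Sum>t<r. b s * cnj (b t) * (v t i * cnj (v s i)))"
      by (rule sum.swap)
    also have "\<dots> = (\<Sum>s<r. \<Sum>t<r. \<Sum>i\<in>I. b s * cnj (b t) * (v t i * cnj (v s i)))"
      by (intro sum.cong refl sum.swap)
    also have "\<dots> = (\<Sum>s<r. \<Sum>t<r. if t = s then b s * cnj (b t) else 0)"
      by (intro sum.cong refl) (simp add: sum_distrib_left[symmetric] v)
    also have "\<dots> = (\<Sum>s<r. b s * cnj (b s))" by simp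
    finally show ?thesis .
  qed
  have "of_real (\<Sum>i\<in>I. (norm (x i - p i))\<^sup>2) = (\<Sum>i\<in>I. (x i - p i) * cnj (x i - p i))"
    unfolding of_real_sum complex_norm_square ..
  also have "\<dots> = (\<Sum>i\<in>I. x i * cnj (x i)) - (\<Sum>i\<in>I. x i * cnj (p i)) - (\<Sum>i\<in>I. p i * cnj (x i)) + (\<Sum>i\<in>I. p i * cnj (p i))"
    by (simp add: algebra_simps sum.distrib sum_subtractf)
  also have "\<dots> = (\<Sum>i\<in>I. x i * cnj (x i)) - (\<Sum>s<r. b s * cnj (b s))" unfolding xp px pp by simp
  also have "\<dots> = of_real ((\<Sum>i\<in>I. (norm (x i))\<^sup>2) - (\<Sum>s<r. (norm (b s))\<^sup>2))"
    unfolding of_real_diff of_real_sum complex_norm_square ..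
  finally have "(\<Sum>i\<in>I. (norm (x i - p i))\<^sup>2) = (\<Sum>i\<in>I. (norm (x i))\<^sup>2) - (\<Sum>s<r. (norm (b s))\<^sup>2)"
    by (simp only: of_real_eq_iff)
  moreover have "(\<Sum>i\<in>I. (norm (x i - p i))\<^sup>2) \<ge> 0" by (simp add: sum_nonneg)
  ultimately show ?thesis by (simp add: b_def)
qed

text \<open>
  The functions \<open>u s\<close> with coordinates from \<open>orthonormal_kernel\<close> satisfy the \<open>m\<close> conditions, and Bessel's
  inequality bounds \<open>\<Sum>|u s z|\<^sup>2\<close> by the constant \<open>kernel_diag\<close>.  Averaging the \<open>2k\<close>-th moment over all
  signs produces one choice of signs that is at most the average; as at least half of the dimension is
  left, dividing by the \<open>L\<^sup>2\<close> norm \<open>\<surd>r\<close> removes the dimension from the bound.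
\<close>

lemma flat_polynomial:
  fixes a :: "nat \<Rightarrow> nat \<times> nat \<times> nat \<Rightarrow> complex"
  assumes m: "2 * m \<le> card (hindex TYPE('d::finite) N L)" and D: "card (hindex TYPE('d) N L) > 0" and k: "k \<ge> 1"
  shows "\<exists>c. (\<Sum>\<iota>\<in>hindex TYPE('d) N L. (norm (c \<iota>))\<^sup>2) = 1 \<and>
    (\<forall>j<m. (\<Sum>\<iota>\<in>hindex TYPE('d) N L. a j \<iota> * c \<iota>) = 0) \<and>
    (LINT z|(surface_measure :: (complex ^ 'd) measure). norm (\<Sum>\<iota>\<in>hindex TYPE('d) N L. c \<iota> * hbasis \<iota> z) ^ (2 * k))
      \<le> sphere_area TYPE('d) * (96 * real k / sphere_area TYPE('d)) ^ k"
proof -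
  let ?I = "hindex TYPE('d) N L" and ?S = "sphere_area TYPE('d)" and ?M = "surface_measure :: (complex ^ 'd) measure"
  define r where "r = card ?I - m"
  have rm: "r + card {..<m} \<le> card ?I" using m by (simp add: r_def)
  have r2: "2 * r \<ge> card ?I" using m by (simp add: r_def)
  then have rp: "r > 0" using D by linarith
  obtain v where v0: "\<forall>s<r. \<forall>t<r. (\<Sum>i\<in>?I. v s i * cnj (v t i)) = (if s = t then 1 else 0)"
      "\<forall>s<r. \<forall>j\<in>{..<m}. (\<Sum>i\<in>?I. a j i * v s i) = 0"
    using orthonormal_kernel[OF finite_hindex _ rm, of a] by blast
  have v: "\<And>s t. s < r \<Longrightarrow> t < r \<Longrightarrow> (\<Sum>i\<in>?I. v s i * cnj (v t i)) = (if s = t then 1 else 0)"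
     "\<And>s j. s < r \<Longrightarrow> j < m \<Longrightarrow> (\<Sum>i\<in>?I. a j i * v s i) = 0"
    using v0 by blast+
  define u where "u = (\<lambda>s (z::complex ^ 'd). \<Sum>\<iota>\<in>?I. v s \<iota> * hbasis \<iota> z)"
  have cu: "continuous_on usph (u s)" for s unfolding u_def
    using hindex_ONfam by (intro continuous_intros) (auto simp: ONfam_def)
  define f where "f = (\<lambda>\<epsilon> (z::complex ^ 'd). \<Sum>s<r. of_real (\<epsilon> s) * u s z)"
  have cf: "continuous_on usph (f \<epsilon>)" for \<epsilon> unfolding f_def by (intro continuous_intros cu)
  define B where "B = (48 * real k * (card ?I / ?S)) ^ k"
  have pointwise: "(\<Sum>\<epsilon>\<in>signs {..<r}. norm (f \<epsilon> z) ^ (2 * k)) \<le> 2 ^ r * B" if "z \<in> usph" for z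
  proof -
    have "(\<Sum>s<r. (norm (u s z))\<^sup>2) \<le> (\<Sum>\<iota>\<in>?I. (norm (hbasis \<iota> z))\<^sup>2)"
      unfolding u_def by (rule bessel_coordinates) (rule v(1))
    also have "\<dots> = card ?I / ?S" by (rule kernel_diag[OF that])
    finally have "2 ^ r * (48 * real k * (\<Sum>s<r. (norm (u s z))\<^sup>2)) ^ k \<le> 2 ^ r * B"
      unfolding B_def by (intro mult_left_mono power_mono) (auto simp: sum_nonneg)
    moreover have "(\<Sum>\<epsilon>\<in>signs {..<r}. norm (f \<epsilon> z) ^ (2 * k)) \<le> 2 ^ r * (48 * real k * (\<Sum>s<r. (norm (u s z))\<^sup>2)) ^ k"
      using signs_moment_complex[of "{..<r}" k "\<lambda>s. u s z"] k by (simp add: f_def)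
    ultimately show ?thesis by (rule order_trans[rotated])
  qed
  have int: "integrable ?M (\<lambda>z. norm (f \<epsilon> z) ^ (2 * k))" for \<epsilon>
    by (intro continuous_surface_integrable continuous_intros cf)
  have "(\<Sum>\<epsilon>\<in>signs {..<r}. LINT z|?M. norm (f \<epsilon> z) ^ (2 * k)) = (LINT z|?M. (\<Sum>\<epsilon>\<in>signs {..<r}. norm (f \<epsilon> z) ^ (2 * k)))"
    by (rule Bochner_Integration.integral_sum[symmetric]) (rule int)
  also have "\<dots> \<le> (LINT z|?M. 2 ^ r * B)"
  proof (rule integral_mono)
    show "integrable ?M (\<lambda>z. \<Sum>\<epsilon>\<in>signs {..<r}. norm (f \<epsilon> z) ^ (2 * k))" by (intro Bochner_Integration.integrable_sum int)
    show "integrable ?M (\<lambda>z. 2 ^ r * B)" by (intro continuous_surface_integrable continuous_intros)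
  qed (simp add: pointwise)
  also have "\<dots> = 2 ^ r * B * ?S" by simp
  finally have avg: "(\<Sum>\<epsilon>\<in>signs {..<r}. LINT z|?M. norm (f \<epsilon> z) ^ (2 * k)) \<le> 2 ^ r * B * ?S" .
  have "\<exists>\<epsilon>\<in>signs {..<r}. (LINT z|?M. norm (f \<epsilon> z) ^ (2 * k)) \<le> B * ?S"
  proof (rule ccontr)
    assume "\<not> ?thesis"
    then have "(\<Sum>\<epsilon>\<in>signs {..<r}. B * ?S) < (\<Sum>\<epsilon>\<in>signs {..<r}. LINT z|?M. norm (f \<epsilon> z) ^ (2 * k))"
      by (intro sum_strict_mono finite_PiE) (auto simp: not_le PiE_eq_empty_iff)
    then show False using avg by (simp add: card_signs)
  qed
  then obtain \<epsilon> where e: "\<epsilon> \<in> signs {..<r}" "(LINT z|?M. norm (f \<epsilon> z) ^ (2 * k)) \<le> B * ?S" by blast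
  define g where "g = (\<lambda>\<iota>. \<Sum>s<r. of_real (\<epsilon> s) * v s \<iota>)"
  have fg: "f \<epsilon> z = (\<Sum>\<iota>\<in>?I. g \<iota> * hbasis \<iota> z)" for z
    unfolding f_def u_def g_def by (simp add: sum_distrib_left sum_distrib_right mult_ac) (rule sum.swap)
  have e1: "\<epsilon> s * \<epsilon> s = 1" if "s < r" for s
  proof -
    have "\<epsilon> s \<in> {-1, 1}" using e(1) that by (intro PiE_mem[of \<epsilon> "{..<r}"]) auto
    then show ?thesis by auto
  qed
  have gn: "(\<Sum>\<iota>\<in>?I. (norm (g \<iota>))\<^sup>2) = real r"
  proof -
    have "of_real (\<Sum>\<iota>\<in>?I. (norm (g \<iota>))\<^sup>2) = (\<Sum>\<iota>\<in>?I. g \<iota> * cnj (g \<iota>))"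
      unfolding of_real_sum complex_norm_square ..
    also have "\<dots> = (\<Sum>\<iota>\<in>?I. \<Sum>s<r. \<Sum>t<r. of_real (\<epsilon> s * \<epsilon> t) * (v s \<iota> * cnj (v t \<iota>)))"
      by (simp add: g_def sum_product mult_ac)
    also have "\<dots> = (\<Sum>s<r. \<Sum>\<iota>\<in>?I. \<Sum>t<r. of_real (\<epsilon> s * \<epsilon> t) * (v s \<iota> * cnj (v t \<iota>)))"
      by (rule sum.swap)
    also have "\<dots> = (\<Sum>s<r. \<Sum>t<r. \<Sum>\<iota>\<in>?I. of_real (\<epsilon> s * \<epsilon> t) * (v s \<iota> * cnj (v t \<iota>)))"
      by (intro sum.cong refl sum.swap)
    also have "\<dots> = (\<Sum>s<r. \<Sum>t<r. if s = t then of_real (\<epsilon> s * \<epsilon> t) else 0)"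
    proof (intro sum.cong refl)
      fix s t assume "s \<in> {..<r}" "t \<in> {..<r}"
      then have "(\<Sum>\<iota>\<in>?I. v s \<iota> * cnj (v t \<iota>)) = (if s = t then 1 else 0)" using v(1) by simp
      then show "(\<Sum>\<iota>\<in>?I. of_real (\<epsilon> s * \<epsilon> t) * (v s \<iota> * cnj (v t \<iota>))) = (if s = t then of_real (\<epsilon> s * \<epsilon> t) else 0 :: complex)"
        by (simp only: sum_distrib_left[symmetric]) simp
    qed
    also have "\<dots> = (\<Sum>s<r. of_real (\<epsilon> s * \<epsilon> s))" by simp
    also have "\<dots> = (\<Sum>s<r. 1)" by (intro sum.cong refl) (simp only: e1 lessThan_iff of_real_1)
    finally have "of_real (\<Sum>\<iota>\<in>?I. (norm (g \<iota>))\<^sup>2) = (of_real (real r) :: complex)" by simp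
    then show ?thesis by (simp only: of_real_eq_iff)
  qed
  define c where "c = (\<lambda>\<iota>. g \<iota> / of_real (sqrt (real r)))"
  have n1: "(\<Sum>\<iota>\<in>?I. (norm (c \<iota>))\<^sup>2) = 1"
    using rp gn by (simp add: c_def norm_divide power_divide sum_divide_distrib[symmetric])
  have n2: "(\<Sum>\<iota>\<in>?I. a j \<iota> * c \<iota>) = 0" if "j < m" for j
  proof -
    have "(\<Sum>\<iota>\<in>?I. a j \<iota> * g \<iota>) = (\<Sum>s<r. of_real (\<epsilon> s) * (\<Sum>\<iota>\<in>?I. a j \<iota> * v s \<iota>))"
      unfolding g_def by (simp add: sum_distrib_left mult_ac) (rule sum.swap)
    also have "\<dots> = 0" using v(2) that by simp
    finally show ?thesis by (simp add: c_def sum_divide_distrib[symmetric])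
  qed
  have n3: "(LINT z|?M. norm (\<Sum>\<iota>\<in>?I. c \<iota> * hbasis \<iota> z) ^ (2 * k)) \<le> ?S * (96 * real k / ?S) ^ k"
  proof -
    have "norm (\<Sum>\<iota>\<in>?I. c \<iota> * hbasis \<iota> z) ^ (2 * k) = norm (f \<epsilon> z) ^ (2 * k) / real r ^ k" for z :: "complex ^ 'd"
    proof -
      have "(\<Sum>\<iota>\<in>?I. c \<iota> * hbasis \<iota> z) = f \<epsilon> z / of_real (sqrt (real r))"
        by (simp add: fg c_def sum_divide_distrib)
      then show ?thesis by (simp add: norm_divide power_divide power_mult)
    qed
    then have "(LINT z|?M. norm (\<Sum>\<iota>\<in>?I. c \<iota> * hbasis \<iota> z) ^ (2 * k)) = (LINT z|?M. norm (f \<epsilon> z) ^ (2 * k)) / real r ^ k"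
      by simp
    also have "\<dots> \<le> B * ?S / real r ^ k" by (intro divide_right_mono e) auto
    also have "\<dots> = ?S * (48 * real k * (card ?I / ?S) / real r) ^ k"
      by (simp add: B_def power_divide power_mult_distrib)
    also have "\<dots> \<le> ?S * (96 * real k / ?S) ^ k"
    proof (intro mult_left_mono power_mono)
      have "real (card ?I) \<le> 2 * real r" using r2 by linarith
      then have "real (card ?I) / real r \<le> 2" using rp by (simp add: divide_le_eq)
      then have "48 * real k / ?S * (real (card ?I) / real r) \<le> 48 * real k / ?S * 2"
        using sphere_area_pos[where 'd='d] by (intro mult_left_mono) auto
      then show "48 * real k * (card ?I / ?S) / real r \<le> 96 * real k / ?S" by simp
    qed auto
    finally show ?thesis .
  qed
  show ?thesis by (intro exI[of _ c] conjI allI impI n1 n2 n3)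
qed

text \<open>
  A Nikolskii inequality.  The \<open>k\<close>-th power lies in the space with degrees \<open>(kN, kL)\<close>, where the maximum
  is controlled by the \<open>L\<^sup>2\<close> norm through the kernel diagonal; the root of order \<open>k\<close> makes the dimension
  harmless once \<open>k\<close> is of order \<open>ln N\<close>.
\<close>

lemma norm_le_of_moment:
  fixes c :: "nat \<times> nat \<times> nat \<Rightarrow> complex" and z :: "complex ^ 'd::finite"
  assumes "z \<in> usph"
  shows "norm (\<Sum>\<iota>\<in>hindex TYPE('d) N L. c \<iota> * hbasis \<iota> z) ^ (2 * k) \<le> 
    real (((k * N + 1) * (k * L + 1)) ^ CARD('d)) / sphere_area TYPE('d) * 
    (LINT z|(surface_measure :: (complex ^ 'd) measure). norm (\<Sum>\<iota>\<in>hindex TYPE('d) N L. c \<iota> * hbasis \<iota> z) ^ (2 * k))"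
proof -
  let ?M = "surface_measure :: (complex ^ 'd) measure" and ?I = "hindex TYPE('d) (k * N) (k * L)"
  let ?f = "\<lambda>z::complex ^ 'd. \<Sum>\<iota>\<in>hindex TYPE('d) N L. c \<iota> * hbasis \<iota> z"
  have "?f \<in> sphere_span (hindex TYPE('d) N L) hbasis" by (rule fspanI) simp
  from sphere_span_bihom_le[OF this] obtain F where F: "bihom_le N L F" "\<And>z. z \<in> usph \<Longrightarrow> ?f z = F z" by blast
  have "(\<lambda>z. F z ^ k) \<in> sphere_span ?I hbasis" by (rule bihom_le_sphere_span[OF bihom_le_power[OF F(1)]])
  then obtain b where b: "\<And>z. z \<in> usph \<Longrightarrow> F z ^ k = (\<Sum>\<iota>\<in>?I. b \<iota> * hbasis \<iota> z)"
    unfolding sphere_span_def by blast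
  have "of_real (\<Sum>\<iota>\<in>?I. (norm (b \<iota>))\<^sup>2) = ip (\<lambda>z::complex ^ 'd. \<Sum>\<iota>\<in>?I. b \<iota> * hbasis \<iota> z) (\<lambda>z. \<Sum>\<iota>\<in>?I. b \<iota> * hbasis \<iota> z)"
    by (rule ip_hbasis_norm[symmetric])
  also have "\<dots> = ip (\<lambda>z. ?f z ^ k) (\<lambda>z. ?f z ^ k)"
    by (rule ip_cong) (simp_all add: F b)
  also have "\<dots> = of_real (LINT z|?M. norm (?f z) ^ (2 * k))"
    unfolding ip_self by (simp add: norm_power power_mult[symmetric] mult.commute)
  finally have bn: "(\<Sum>\<iota>\<in>?I. (norm (b \<iota>))\<^sup>2) = (LINT z|?M. norm (?f z) ^ (2 * k))"
    by (simp only: of_real_eq_iff)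
  have "norm (?f z) ^ (2 * k) = (norm (F z ^ k))\<^sup>2"
    using F(2)[OF assms] by (simp add: norm_power power_mult[symmetric] mult.commute)
  also have "\<dots> \<le> (\<Sum>\<iota>\<in>?I. (norm (b \<iota>))\<^sup>2) * (\<Sum>\<iota>\<in>?I. (norm (hbasis \<iota> z))\<^sup>2)"
    unfolding b[OF assms] by (rule cauchy_schwarz_sum)
  also have "\<dots> = (card ?I / sphere_area TYPE('d)) * (LINT z|?M. norm (?f z) ^ (2 * k))"
    unfolding bn kernel_diag[OF assms] by (rule mult.commute)
  also have "\<dots> \<le> real (((k * N + 1) * (k * L + 1)) ^ CARD('d)) / sphere_area TYPE('d) * (LINT z|?M. norm (?f z) ^ (2 * k))"
  proof (intro mult_right_mono divide_right_mono)
    show "real (card ?I) \<le> real (((k * N + 1) * (k * L + 1)) ^ CARD('d))"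
      by (rule of_nat_mono[OF card_hindex_le])
  qed simp_all
  finally show ?thesis .
qed

section \<open>Lebesgue spaces on the sphere\<close>

lemma Lp_measurable: "f \<in> Lp p \<Longrightarrow> f \<in> borel_measurable surface_measure"
  by (simp add: Lp_def)

lemma surface_integrable_const: "integrable (surface_measure :: (complex ^ 'd::finite) measure) (\<lambda>z. c :: real)"
  by (intro continuous_surface_integrable continuous_intros)

lemma surface_emeasure_less_top [simp]:
  "emeasure (surface_measure :: (complex ^ 'd::finite) measure) usph < top"
  using finite_measure.emeasure_finite[OF surface_finite, of usph] by (simp add: less_top)

lemma integral_one_add:
  fixes f :: "complex ^ 'd::finite \<Rightarrow> real"
  assumes "integrable surface_measure f"
  shows "(LINT z|surface_measure. 1 + f z) = sphere_area TYPE('d) + integral\<^sup>L surface_measure f"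
  by (subst Bochner_Integration.integral_add[OF surface_integrable_const assms]) simp

lemma powr_add_le: "(x + y) powr r \<le> 2 powr r * (x powr r + y powr r)" if "x \<ge> 0" "y \<ge> 0" "r \<ge> 0" for x y r :: real
proof -
  have m: "(x + y) powr r \<le> 2 powr r * (x powr r + y powr r)" if "x \<ge> 0" "y \<ge> 0" "x \<le> y" for x y :: real
  proof -
    have "(x + y) powr r \<le> (2 * y) powr r" using that \<open>r \<ge> 0\<close> by (intro powr_mono2) auto
    also have "\<dots> = 2 powr r * y powr r" using that by (simp add: powr_mult)
    also have "\<dots> \<le> 2 powr r * (x powr r + y powr r)" by (intro mult_left_mono) auto
    finally show ?thesis .
  qed
  show ?thesis using m[of x y] m[of y x] that by (cases "x \<le> y") (auto simp: add.commute)
qed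

lemma Lp_add:
  fixes f g :: "complex ^ 'd::finite \<Rightarrow> complex"
  assumes f: "f \<in> Lp q" and g: "g \<in> Lp q"
  shows "(\<lambda>z. f z + g z) \<in> Lp q"
proof (cases "q = \<infinity>")
  case True
  obtain C D where "AE z in surface_measure. norm (f z) \<le> C" "AE z in surface_measure. norm (g z) \<le> D"
    using f g True by (auto simp: Lp_def)
  then have "AE z in surface_measure. norm (f z + g z) \<le> C + D"
    by eventually_elim (rule norm_triangle_le, simp)
  then show ?thesis using f g True by (auto simp: Lp_def)
next
  case False
  define r where "r = enn2real q"
  have r0: "r \<ge> 0" by (simp add: r_def)
  have mf[measurable]: "f \<in> borel_measurable surface_measure" "g \<in> borel_measurable surface_measure"
    using f g by (auto simp: Lp_def)
  have i: "integrable surface_measure (\<lambda>z. norm (f z) powr r)" "integrable surface_measure (\<lambda>z. norm (g z) powr r)"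
    using f g False by (auto simp: Lp_def r_def)
  have "integrable surface_measure (\<lambda>z. norm (f z + g z) powr r)"
  proof (rule Bochner_Integration.integrable_bound)
    show "integrable surface_measure (\<lambda>z. 2 powr r * (norm (f z) powr r + norm (g z) powr r))"
      using i by simp
    have "norm (f z + g z) powr r \<le> 2 powr r * (norm (f z) powr r + norm (g z) powr r)" for z
      by (rule order_trans[OF powr_mono2[OF r0 norm_ge_zero norm_triangle_ineq] powr_add_le]) (auto simp: r0)
    then show "AE z in surface_measure. norm (norm (f z + g z) powr r) \<le> norm (2 powr r * (norm (f z) powr r + norm (g z) powr r))"
      by (intro AE_I2) simp
  qed measurable
  then show ?thesis using False by (simp add: Lp_def r_def)
qed

lemma Lp_scale:
  fixes f :: "complex ^ 'd::finite \<Rightarrow> complex"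
  assumes f: "f \<in> Lp q"
  shows "(\<lambda>z. c * f z) \<in> Lp q"
proof (cases "q = \<infinity>")
  case True
  obtain C where "AE z in surface_measure. norm (f z) \<le> C"
    using f True by (auto simp: Lp_def)
  then have "AE z in surface_measure. norm (c * f z) \<le> norm c * C"
    by eventually_elim (simp add: norm_mult mult_left_mono)
  then show ?thesis using f True by (auto simp: Lp_def)
next
  case False
  then show ?thesis using f by (auto simp: Lp_def norm_mult powr_mult)
qed

lemma continuous_surface_bounded:
  fixes f :: "complex ^ 'd::finite \<Rightarrow> complex"
  assumes "continuous_on usph f"
  obtains B where "\<And>z. z \<in> usph \<Longrightarrow> norm (f z) \<le> B"
proof -
  have "bounded (f ` usph)"
    using assms compact_continuous_image compact_imp_bounded compact_sphere by blast
  then obtain B where "\<forall>y\<in>f ` usph. norm y \<le> B" unfolding bounded_iff by blast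
  then show ?thesis using that[of B] by blast
qed

lemma continuous_Lp:
  fixes f :: "complex ^ 'd::finite \<Rightarrow> complex"
  assumes f: "continuous_on usph f"
  shows "f \<in> Lp q"
proof -
  have m[measurable]: "f \<in> borel_measurable surface_measure"
    by (rule continuous_surface_measurable[OF f])
  obtain B where B: "\<And>z. z \<in> usph \<Longrightarrow> norm (f z) \<le> B"
    using continuous_surface_bounded[OF f] by blast
  have ae: "AE z in surface_measure. norm (f z) \<le> B" by (rule AE_I2) (simp add: B)
  show ?thesis
  proof (cases "q = \<infinity>")
    case True then show ?thesis using ae m by (auto simp: Lp_def)
  next
    case False
    have "integrable surface_measure (\<lambda>z. norm (f z) powr enn2real q)"
    proof (rule finite_measure.integrable_const_bound[OF surface_finite])
      show "AE z in surface_measure. norm (norm (f z) powr enn2real q) \<le> B powr enn2real q"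
        using ae by eventually_elim (auto intro: powr_mono2)
    qed measurable
    then show ?thesis using False m by (simp add: Lp_def)
  qed
qed

lemma le_one_add_powr: "a \<le> 1 + a powr r" if "a \<ge> 0" "r \<ge> 1" for a r :: real
proof (cases "a \<le> 1")
  case False
  then have "a powr 1 \<le> a powr r" using that by (intro powr_mono) auto
  then show ?thesis using False by simp
qed (simp add: add_increasing2)

lemma enn2real_ge: "1 \<le> enn2real q" if "1 \<le> q" "q \<noteq> \<infinity>" for q :: ennreal
  using that by (cases q) (auto simp: ennreal_1[symmetric] simp del: ennreal_1)

lemma Lp_integrable:
  fixes f :: "complex ^ 'd::finite \<Rightarrow> complex"
  assumes f: "f \<in> Lp q" and q: "1 \<le> q"
  shows "integrable surface_measure f"
proof -
  have m[measurable]: "f \<in> borel_measurable surface_measure" by (rule Lp_measurable[OF f])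
  show ?thesis
  proof (cases "q = \<infinity>")
    case True
    then obtain C where "AE z in surface_measure. norm (f z) \<le> C" using f by (auto simp: Lp_def)
    then show ?thesis using m by (intro finite_measure.integrable_const_bound[OF surface_finite])
  next
    case False
    show ?thesis
    proof (rule Bochner_Integration.integrable_bound)
      show "integrable surface_measure (\<lambda>z. 1 + norm (f z) powr enn2real q)"
        using f False surface_integrable_const by (intro Bochner_Integration.integrable_add) (auto simp: Lp_def)
      show "AE z in surface_measure. norm (f z) \<le> norm (1 + norm (f z) powr enn2real q)"
        using le_one_add_powr[OF norm_ge_zero enn2real_ge[OF q False], of "f z" for z]
        by (intro AE_I2) (simp add: abs_of_nonneg)
    qed measurable
  qed
qed

lemma integrable_times_continuous:
  fixes f g :: "complex ^ 'd::finite \<Rightarrow> complex"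
  assumes f: "integrable surface_measure f" and g: "continuous_on usph g"
  shows "integrable surface_measure (\<lambda>z. f z * cnj (g z))"
proof -
  have m: "g \<in> borel_measurable surface_measure" by (rule continuous_surface_measurable[OF g])
  obtain B where B: "\<And>z. z \<in> usph \<Longrightarrow> norm (g z) \<le> B"
    using continuous_surface_bounded[OF g] by blast
  show ?thesis
  proof (rule Bochner_Integration.integrable_bound)
    show "integrable surface_measure (\<lambda>z. B * norm (f z))" using f by simp
    show "(\<lambda>z. f z * cnj (g z)) \<in> borel_measurable surface_measure"
      using borel_measurable_integrable[OF f] continuous_surface_measurable[OF continuous_on_cnj[OF g]]
      by (rule borel_measurable_times)
    show "AE z in surface_measure. norm (f z * cnj (g z)) \<le> norm (B * norm (f z))"
    proof (rule AE_I2)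
      fix z :: "complex ^ 'd" assume "z \<in> space surface_measure"
      then have "norm (g z) \<le> \<bar>B\<bar>" using B[of z] by simp
      then have "norm (f z) * norm (g z) \<le> norm (f z) * \<bar>B\<bar>" by (intro mult_left_mono) auto
      then show "norm (f z * cnj (g z)) \<le> norm (B * norm (f z))" by (simp add: norm_mult abs_mult mult.commute)
    qed
  qed
qed

section \<open>Duality\<close>

text \<open>
  A crude form of Young's inequality for exponents \<open>r\<close> and \<open>2k\<close> with \<open>1/r + 1/(2k) \<le> 1\<close>.  The additive
  \<open>1\<close> allows strict inequality of the exponents and costs only a constant on a finite measure space.
\<close>

lemma young_type:
  fixes a b r :: real
  assumes a: "a \<ge> 0" and b: "b \<ge> 0" and k: "k \<ge> 1" and r: "real (2 * k) / real (2 * k - 1) \<le> r"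
  shows "a * b \<le> a powr r + b ^ (2 * k) + 1"
proof -
  have k1: "real (2 * k - 1) > 0" using k by simp
  have "1 \<le> real (2 * k) / real (2 * k - 1)" using k by (simp add: le_divide_eq)
  then have r1: "r \<ge> 1" using r by (rule order_trans)
  show ?thesis
  proof (cases "b \<le> 1")
    case True
    then have "a * b \<le> a" using a b by (simp add: mult_left_le)
    also have "\<dots> \<le> 1 + a powr r" by (rule le_one_add_powr[OF a r1])
    finally have "a * b \<le> 1 + a powr r" .
    moreover have "0 \<le> b ^ (2 * k)" using b by simp
    ultimately show ?thesis by linarith
  next
    case False
    then have b1: "b > 1" by simp
    have sk: "2 * k = Suc (2 * k - 1)" using k by simp
    show ?thesis
    proof (cases "a \<le> b ^ (2 * k - 1)")
      case True
      then have "a * b \<le> b ^ (2 * k - 1) * b" using b by (intro mult_right_mono)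
      also have "\<dots> = b ^ (2 * k)" by (subst (2) sk) simp
      finally show ?thesis by (simp add: add_increasing add_increasing2)
    next
      case nl: False
      have "1 \<le> b ^ (2 * k - 1)" using b1 by (simp add: one_le_power)
      then have a1: "a > 1" using nl by linarith
      have "b = (b ^ (2 * k - 1)) powr (1 / real (2 * k - 1))"
        using b1 k1 by (simp add: powr_realpow[symmetric] powr_powr del: of_nat_diff)
      also have "\<dots> \<le> a powr (1 / real (2 * k - 1))"
        using nl b1 by (intro powr_mono2) auto
      finally have "a * b \<le> a powr 1 * a powr (1 / real (2 * k - 1))" using a1 by (simp add: mult_left_mono)
      also have "\<dots> = a powr (1 + 1 / real (2 * k - 1))" by (simp add: powr_add)
      also have "1 + 1 / real (2 * k - 1) = real (2 * k) / real (2 * k - 1)"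
      proof -
        have "real (2 * k) = real (2 * k - 1) + 1" by (subst sk) simp
        then show ?thesis using k1 by (simp add: field_simps)
      qed
      also have "a powr (real (2 * k) / real (2 * k - 1)) \<le> a powr r" using a1 r by (intro powr_mono) auto
      finally show ?thesis using b by (simp add: add_increasing2)
    qed
  qed
qed

lemma norm_ip_le_integral:
  fixes f g :: "complex ^ 'd::finite \<Rightarrow> complex"
  shows "norm (ip f g) \<le> (LINT z|surface_measure. norm (f z) * norm (g z))"
  unfolding ip_def by (rule order_trans[OF integral_norm_bound]) (simp add: norm_mult)

text \<open>
  Hoelder's inequality up to a constant: after division of \<open>f\<close> by its norm, integrate \<open>young_type\<close>.
\<close>

lemma dual_bound_finite:
  fixes f g :: "complex ^ 'd::finite \<Rightarrow> complex"
  assumes f: "f \<in> Lp q" and q: "1 \<le> q" "q \<noteq> \<infinity>" and g: "continuous_on usph g"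
    and k: "k \<ge> 1" and r: "real (2 * k) / real (2 * k - 1) \<le> enn2real q"
  shows "norm (ip f g) \<le> (1 + sphere_area TYPE('d) + (LINT z|surface_measure. norm (g z) ^ (2 * k))) * Lp_norm q f"
proof -
  define r where "r = enn2real q"
  have r1: "r \<ge> 1" unfolding r_def by (rule enn2real_ge[OF q])
  have m[measurable]: "f \<in> borel_measurable surface_measure" by (rule Lp_measurable[OF f])
  have fi: "integrable surface_measure (\<lambda>z. norm (f z) powr r)" using f q by (simp add: Lp_def r_def)
  have gi: "integrable surface_measure (\<lambda>z. norm (g z) ^ (2 * k))"
    by (intro continuous_surface_integrable continuous_intros g)
  have fgi: "integrable surface_measure (\<lambda>z. norm (f z) * norm (g z))"
    using integrable_norm[OF integrable_times_continuous[OF Lp_integrable[OF f q(1)] g]] by (simp add: norm_mult)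
  define J where "J = (LINT z|surface_measure. norm (f z) powr r)"
  have J0: "J \<ge> 0" by (simp add: J_def)
  define n where "n = Lp_norm q f"
  have n: "n = J powr (1 / r)" using q by (simp add: n_def Lp_norm_def J_def r_def)
  show ?thesis
  proof (cases "J = 0")
    case True
    then have "AE z in surface_measure. norm (f z) powr r = 0"
      unfolding J_def by (subst (asm) integral_nonneg_eq_0_iff_AE[OF fi]) auto
    then have "AE z in surface_measure. f z * cnj (g z) = 0" by eventually_elim simp
    then have "ip f g = 0" unfolding ip_def by (rule integral_eq_zero_AE)
    then show ?thesis using n by (simp add: n_def[symmetric] True)
  next
    case False
    then have np: "n > 0" using J0 n by simp
    have nr: "n powr r = J" using r1 J0 by (simp add: n powr_powr)
    have pw: "norm (f z) * norm (g z) \<le> n * (1 + (norm (f z) powr r / J + norm (g z) ^ (2 * k)))" for z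
    proof -
      have "norm (f z) / n * norm (g z) \<le> (norm (f z) / n) powr r + norm (g z) ^ (2 * k) + 1"
        using np k r unfolding r_def by (intro young_type) auto
      also have "(norm (f z) / n) powr r = norm (f z) powr r / J" using np by (simp add: powr_divide nr)
      finally show ?thesis using np by (simp add: field_simps)
    qed
    have "norm (ip f g) \<le> (LINT z|surface_measure. norm (f z) * norm (g z))" by (rule norm_ip_le_integral)
    also have "\<dots> \<le> (LINT z|surface_measure. n * (1 + (norm (f z) powr r / J + norm (g z) ^ (2 * k))))"
      by (intro integral_mono fgi pw integrable_mult_right integrable_divide Bochner_Integration.integrable_add fi gi surface_integrable_const)
    also have "\<dots> = n * (sphere_area TYPE('d) + ((LINT z|surface_measure. norm (f z) powr r) / J + (LINT z|surface_measure. norm (g z) ^ (2 * k))))"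
      using fi gi by (simp add: integral_one_add)
    also have "(LINT z|surface_measure. norm (f z) powr r) / J = 1" using False by (simp add: J_def[symmetric])
    finally show ?thesis by (simp add: n_def algebra_simps)
  qed
qed

lemma dual_bound_L1:
  fixes f g :: "complex ^ 'd::finite \<Rightarrow> complex"
  assumes f: "f \<in> Lp 1" and g: "continuous_on usph g" and B: "\<And>z. z \<in> usph \<Longrightarrow> norm (g z) \<le> B"
  shows "norm (ip f g) \<le> B * Lp_norm 1 f"
proof -
  have fi: "integrable surface_measure f" by (rule Lp_integrable[OF f]) simp
  have fgi: "integrable surface_measure (\<lambda>z. norm (f z) * norm (g z))"
    using integrable_norm[OF integrable_times_continuous[OF fi g]] by (simp add: norm_mult)
  have "norm (ip f g) \<le> (LINT z|surface_measure. norm (f z) * norm (g z))" by (rule norm_ip_le_integral)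
  also have "\<dots> \<le> (LINT z|surface_measure. B * norm (f z))"
  proof (rule integral_mono[OF fgi])
    fix z :: "complex ^ 'd" assume "z \<in> space surface_measure"
    then have "norm (f z) * norm (g z) \<le> norm (f z) * B" using B by (intro mult_left_mono) auto
    then show "norm (f z) * norm (g z) \<le> B * norm (f z)" by (simp add: mult.commute)
  qed (use fi in simp)
  also have "\<dots> = B * Lp_norm 1 f" by (simp add: Lp_norm_def)
  finally show ?thesis .
qed

lemma dual_bound_Linf:
  fixes f g :: "complex ^ 'd::finite \<Rightarrow> complex"
  assumes f: "f \<in> Lp \<infinity>" and g: "continuous_on usph g"
  shows "norm (ip f g) \<le> (1 + sphere_area TYPE('d) + (LINT z|surface_measure. norm (g z) ^ 2)) * Lp_norm \<infinity> f"
proof -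
  let ?M = "surface_measure :: (complex ^ 'd) measure"
  have m[measurable]: "f \<in> borel_measurable ?M" by (rule Lp_measurable[OF f])
  obtain C where C: "AE z in ?M. norm (f z) \<le> C" using f by (auto simp: Lp_def)
  define E where "E = esssup ?M (\<lambda>z. ereal (norm (f z)))"
  have ae: "AE z in ?M. ereal (norm (f z)) \<le> E" unfolding E_def by (rule esssup_AE)
  have "E \<le> ereal C" unfolding E_def by (rule esssup_I) (use C in auto)
  moreover have "E \<ge> 0"
  proof -
    have nz: "emeasure ?M (space ?M) \<noteq> 0"
      using sphere_area_pos[where 'd='d] by (auto simp: measure_def)
    have "esssup ?M (\<lambda>z. 0::ereal) \<le> E" unfolding E_def by (rule esssup_mono) auto
    then show ?thesis by (simp only: esssup_const[OF nz])
  qed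
  ultimately obtain n where En: "E = ereal n" by (cases E) auto
  have n: "Lp_norm \<infinity> f = n" by (simp add: Lp_norm_def E_def[symmetric] En)
  have n0: "n \<ge> 0" using \<open>E \<ge> 0\<close> En by simp
  have aen: "AE z in ?M. norm (f z) \<le> n" using ae by (simp add: En)
  have fi: "integrable ?M f" by (rule Lp_integrable[OF f]) simp
  have fgi: "integrable ?M (\<lambda>z. norm (f z) * norm (g z))"
    using integrable_norm[OF integrable_times_continuous[OF fi g]] by (simp add: norm_mult)
  have gi: "integrable ?M (\<lambda>z. norm (g z) ^ 2)"
    by (intro continuous_surface_integrable continuous_intros g)
  have le: "x \<le> 1 + x ^ 2" if "x \<ge> 0" for x :: real
    using le_one_add_powr[of x 2] that by (cases "x = 0") (auto simp: powr_numeral)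
  have "norm (ip f g) \<le> (LINT z|?M. norm (f z) * norm (g z))" by (rule norm_ip_le_integral)
  also have "\<dots> \<le> (LINT z|?M. n * (1 + norm (g z) ^ 2))"
  proof (rule integral_mono_AE[OF fgi])
    show "integrable ?M (\<lambda>z. n * (1 + norm (g z) ^ 2))"
      by (intro integrable_mult_right Bochner_Integration.integrable_add gi surface_integrable_const)
    show "AE z in ?M. norm (f z) * norm (g z) \<le> n * (1 + norm (g z) ^ 2)"
      using aen by eventually_elim (use n0 le in \<open>auto intro!: mult_mono\<close>)
  qed
  also have "\<dots> = n * (sphere_area TYPE('d) + (LINT z|?M. norm (g z) ^ 2))"
    using gi by (simp add: integral_one_add)
  also have "\<dots> \<le> (1 + sphere_area TYPE('d) + (LINT z|?M. norm (g z) ^ 2)) * n" using n0 by (simp add: algebra_simps)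
  finally show ?thesis by (simp only: n)
qed

text \<open>
  The duality principle: a functional \<open>g\<close> that annihilates a subspace and is bounded by \<open>B\<close> separates
  \<open>\<psi>\<close> from it by \<open>|\<langle>\<psi>, g\<rangle>| / B\<close>.
\<close>

lemma kolmogorov_width_ge:
  fixes A :: "(complex ^ 'd::finite \<Rightarrow> complex) set"
  assumes q: "1 \<le> q" and B: "B > 0"
    and dual: "\<And>b. (\<And>i. i < m \<Longrightarrow> b i \<in> Lp q) \<Longrightarrow> \<exists>\<psi>\<in>A. \<psi> \<in> Lp q \<and> (\<exists>g. continuous_on usph g \<and>
        (\<forall>i<m. ip (b i) g = 0) \<and> (\<forall>f\<in>Lp q. norm (ip f g) \<le> B * Lp_norm q f) \<and> w * B \<le> norm (ip \<psi> g))"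
  shows "kolmogorov_width m A q \<ge> ennreal w"
  unfolding kolmogorov_width_def
proof (rule INF_greatest)
  fix X assume "X \<in> (Lp_subspaces q m :: (complex ^ 'd \<Rightarrow> complex) set set)"
  then obtain b where b: "\<And>i. i < m \<Longrightarrow> b i \<in> Lp q" and X: "X = {(\<lambda>x. \<Sum>i<m. c i * b i x) | c. True}"
    unfolding Lp_subspaces_def by blast
  obtain \<psi> g where \<psi>: "\<psi> \<in> A" "\<psi> \<in> Lp q" and g: "continuous_on usph g" "\<And>i. i < m \<Longrightarrow> ip (b i) g = 0"
     "\<And>f. f \<in> Lp q \<Longrightarrow> norm (ip f g) \<le> B * Lp_norm q f" "w * B \<le> norm (ip \<psi> g)"
  proof -
    have "\<exists>\<psi>\<in>A. \<psi> \<in> Lp q \<and> (\<exists>g. continuous_on usph g \<and>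
        (\<forall>i<m. ip (b i) g = 0) \<and> (\<forall>f\<in>Lp q. norm (ip f g) \<le> B * Lp_norm q f) \<and> w * B \<le> norm (ip \<psi> g))"
      by (rule dual) (rule b)
    then show ?thesis using that by blast
  qed
  have "ennreal w \<le> (INF x\<in>X. ennreal (Lp_norm q (\<lambda>z. \<psi> z - x z)))"
  proof (rule INF_greatest)
    fix x assume "x \<in> X"
    then obtain c where x: "x = (\<lambda>z. \<Sum>i<m. c i * b i z)" unfolding X by blast
    have xs: "(\<lambda>z. \<Sum>i\<in>I. c i * b i z) \<in> Lp q" if "I \<subseteq> {..<m}" for I
      using finite_subset[OF that finite_lessThan] that
    proof (induction I rule: finite_induct)
      case empty show ?case by (simp add: continuous_Lp)
    next
      case (insert i I)
      then have "(\<lambda>z. c i * b i z + (\<Sum>i\<in>I. c i * b i z)) \<in> Lp q" by (intro Lp_add Lp_scale b) auto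
      then show ?case using insert.hyps by simp
    qed
    have xL: "x \<in> Lp q" unfolding x by (rule xs) simp
    have bi: "integrable surface_measure (\<lambda>z. b i z * cnj (g z))" if "i < m" for i
      by (rule integrable_times_continuous[OF Lp_integrable[OF b[OF that] q] g(1)])
    have "ip x g = (\<Sum>i<m. c i * ip (b i) g)"
      unfolding ip_def x sum_distrib_right
      by (subst Bochner_Integration.integral_sum) (auto simp: mult.assoc bi)
    then have xg: "ip x g = 0" using g(2) by simp
    have "ip (\<lambda>z. \<psi> z - x z) g = ip \<psi> g - ip x g"
      unfolding ip_def left_diff_distrib
      by (intro Bochner_Integration.integral_diff integrable_times_continuous g(1) Lp_integrable[OF _ q] \<psi> xL)
    then have "ip (\<lambda>z. \<psi> z - x z) g = ip \<psi> g" using xg by simp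
    moreover have "(\<lambda>z. \<psi> z - x z) \<in> Lp q"
      using Lp_add[OF \<psi>(2) Lp_scale[OF xL, of "-1"]] by simp
    ultimately have "w * B \<le> B * Lp_norm q (\<lambda>z. \<psi> z - x z)" using g(3,4) by fastforce
    then have "w \<le> Lp_norm q (\<lambda>z. \<psi> z - x z)" using B by (simp add: mult.commute)
    then show "ennreal w \<le> ennreal (Lp_norm q (\<lambda>z. \<psi> z - x z))" by (rule ennreal_leI)
  qed
  also have "\<dots> \<le> (SUP f\<in>A. INF x\<in>X. ennreal (Lp_norm q (\<lambda>z. f z - x z)))"
    by (rule SUP_upper[OF \<psi>(1)])
  finally show "ennreal w \<le> (SUP f\<in>A. INF x\<in>X. ennreal (Lp_norm q (\<lambda>z. f z - x z)))" .
qed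

section \<open>Membership in unit balls\<close>

text \<open>
  With \<open>s\<close> the scaling factor and \<open>r\<close> the exponent, \<open>s \<le> 1 \<le> r\<close> gives \<open>s\<^sup>r \<le> s\<close>, and \<open>|f|\<^sup>r \<le> 1 + |f|\<^sup>2\<^sup>k\<close>;
  hence the integral of \<open>|s f|\<^sup>r\<close> is at most \<open>1\<close>.
\<close>

lemma moment_unit_ball:
  fixes f :: "complex ^ 'd::finite \<Rightarrow> complex"
  assumes f: "continuous_on usph f" and p: "1 \<le> p" "p \<noteq> \<infinity>" and k: "enn2real p \<le> real (2 * k)"
    and Y: "(LINT z|surface_measure. norm (f z) ^ (2 * k)) \<le> Y"
  shows "(\<lambda>z. of_real (1 / (1 + sphere_area TYPE('d) + Y)) * f z) \<in> Lp_unit_ball p"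
proof -
  let ?M = "surface_measure :: (complex ^ 'd) measure"
  define r where "r = enn2real p"
  have r1: "r \<ge> 1" unfolding r_def by (rule enn2real_ge[OF p])
  have Y0: "Y \<ge> 0" by (rule order_trans[OF _ Y]) simp
  define s where "s = 1 / (1 + sphere_area TYPE('d) + Y)"
  have den: "1 + sphere_area TYPE('d) + Y > 0" using Y0 sphere_area_pos[where 'd='d] by linarith
  have s: "s > 0" "s \<le> 1" unfolding s_def using den Y0 sphere_area_pos[where 'd='d] by (auto simp: divide_le_eq)
  have gi: "integrable ?M (\<lambda>z. norm (f z) ^ (2 * k))"
    by (intro continuous_surface_integrable continuous_intros f)
  have L: "(\<lambda>z. of_real s * f z) \<in> Lp p" by (intro continuous_Lp continuous_intros f)
  then have Li: "integrable ?M (\<lambda>z. norm (of_real s * f z) powr r)" using p by (simp add: Lp_def r_def)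
  have pw: "norm (of_real s * f z) powr r \<le> s * (1 + norm (f z) ^ (2 * k))" for z
  proof -
    have "norm (of_real s * f z) powr r = s powr r * norm (f z) powr r"
      using s by (simp add: norm_mult powr_mult)
    also have "\<dots> \<le> s * (1 + norm (f z) ^ (2 * k))"
    proof (intro mult_mono)
      have "s powr r \<le> s powr 1" using s r1 by (intro powr_mono') auto
      then show "s powr r \<le> s" using s by simp
      show "norm (f z) powr r \<le> 1 + norm (f z) ^ (2 * k)"
      proof (cases "norm (f z) \<le> 1")
        case True
        have "norm (f z) powr r \<le> 1 powr r" using True r1 by (intro powr_mono2) auto
        then show ?thesis by (simp add: add_increasing2)
      next
        case False
        then have "norm (f z) powr r \<le> norm (f z) powr real (2 * k)" using k by (intro powr_mono) (auto simp: r_def)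
        also have "\<dots> = norm (f z) ^ (2 * k)" using False by (intro powr_realpow) auto
        finally show ?thesis by simp
      qed
    qed (use s in auto)
    finally show ?thesis .
  qed
  have "(LINT z|?M. norm (of_real s * f z) powr r) \<le> (LINT z|?M. s * (1 + norm (f z) ^ (2 * k)))"
    by (intro integral_mono Li pw integrable_mult_right Bochner_Integration.integrable_add gi surface_integrable_const)
  also have "\<dots> = s * (sphere_area TYPE('d) + (LINT z|?M. norm (f z) ^ (2 * k)))"
    using gi by (simp add: integral_one_add)
  also have "\<dots> \<le> s * (1 + sphere_area TYPE('d) + Y)" using s Y by (intro mult_left_mono) auto
  also have "\<dots> = 1" using den by (simp add: s_def)
  finally have "(LINT z|?M. norm (of_real s * f z) powr r) \<le> 1" .
  moreover have "(LINT z|?M. norm (of_real s * f z) powr r) \<ge> 0" by simp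
  ultimately have "(LINT z|?M. norm (of_real s * f z) powr r) powr (1 / r) \<le> 1 powr (1 / r)"
    using r1 by (intro powr_mono2) auto
  then have "Lp_norm p (\<lambda>z. of_real s * f z) \<le> 1" using p by (simp add: Lp_norm_def r_def)
  then show ?thesis using L by (simp add: Lp_unit_ball_def s_def)
qed

lemma sup_unit_ball:
  fixes f :: "complex ^ 'd::finite \<Rightarrow> complex"
  assumes f: "continuous_on usph f" and B: "B > 0" "\<And>z. z \<in> usph \<Longrightarrow> norm (f z) \<le> B"
  shows "(\<lambda>z. of_real (1 / B) * f z) \<in> Lp_unit_ball \<infinity>"
proof -
  let ?M = "surface_measure :: (complex ^ 'd) measure" and ?h = "\<lambda>z. of_real (1 / B) * f z"
  have L: "?h \<in> Lp \<infinity>" by (intro continuous_Lp continuous_intros f)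
  have m[measurable]: "?h \<in> borel_measurable ?M" by (rule Lp_measurable[OF L])
  have le: "norm (?h z) \<le> 1" if "z \<in> usph" for z
    using B(2)[OF that] B(1) by (simp add: norm_mult norm_divide divide_le_eq)
  have "esssup ?M (\<lambda>z. ereal (norm (?h z))) \<le> 1"
  proof (rule esssup_I)
    show "(\<lambda>z. ereal (norm (?h z))) \<in> borel_measurable ?M" by measurable
    show "AE z in ?M. ereal (norm (?h z)) \<le> 1" using le by (intro AE_I2) (auto simp: one_ereal_def)
  qed
  then have "Lp_norm \<infinity> ?h \<le> 1"
    unfolding Lp_norm_def by (cases "esssup ?M (\<lambda>z. ereal (norm (?h z)))") (auto simp: one_ereal_def)
  then show ?thesis using L by (simp add: Lp_unit_ball_def)
qed

section \<open>Two lower bounds for the width\<close>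

definition hpoly :: "nat \<Rightarrow> nat \<Rightarrow> (nat \<times> nat \<times> nat \<Rightarrow> complex) \<Rightarrow> complex ^ 'd::finite \<Rightarrow> complex" where
  "hpoly N L c z = (\<Sum>\<iota>\<in>hindex TYPE('d) N L. c \<iota> * hbasis \<iota> z)"

lemma hpoly_continuous: "continuous_on usph (hpoly N L c :: complex ^ 'd::finite \<Rightarrow> complex)"
  unfolding hpoly_def[abs_def] using hindex_subset by (intro continuous_intros hbasis_continuous) auto

lemma hpoly_ip:
  "ip (hpoly N L c :: complex ^ 'd::finite \<Rightarrow> complex) (hpoly N L b) = (\<Sum>\<iota>\<in>hindex TYPE('d) N L. c \<iota> * cnj (b \<iota>))"
  unfolding hpoly_def[abs_def] by (rule ONfam_ip[OF hindex_ONfam])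

lemma hpoly_ip_right:
  fixes f :: "complex ^ 'd::finite \<Rightarrow> complex"
  assumes f: "integrable surface_measure f"
  shows "ip f (hpoly N L c) = (\<Sum>\<iota>\<in>hindex TYPE('d) N L. cnj (c \<iota>) * ip f (hbasis \<iota>))"
proof -
  have i: "integrable surface_measure (\<lambda>z. f z * cnj (hbasis \<iota> z))" if "\<iota> \<in> hindex TYPE('d) N L" for \<iota>
    using that hindex_subset by (intro integrable_times_continuous[OF f] hbasis_continuous) auto
  have "ip f (hpoly N L c) = sphere_int (\<lambda>z. \<Sum>\<iota>\<in>hindex TYPE('d) N L. cnj (c \<iota>) * (f z * cnj (hbasis \<iota> z)))"
    unfolding ip_def hpoly_def by (simp add: sum_distrib_left mult_ac)
  also have "\<dots> = (\<Sum>\<iota>\<in>hindex TYPE('d) N L. cnj (c \<iota>) * ip f (hbasis \<iota>))"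
    unfolding ip_def by (subst Bochner_Integration.integral_sum) (auto intro!: integrable_mult_right i)
  finally show ?thesis .
qed

lemma hpoly_square:
  "(LINT z|(surface_measure :: (complex ^ 'd::finite) measure). norm (hpoly N L c z) ^ 2) = (\<Sum>\<iota>\<in>hindex TYPE('d) N L. (norm (c \<iota>))\<^sup>2)"
proof -
  have "complex_of_real (LINT z|(surface_measure :: (complex ^ 'd) measure). norm (hpoly N L c z) ^ 2) = of_real (\<Sum>\<iota>\<in>hindex TYPE('d) N L. (norm (c \<iota>))\<^sup>2)"
    unfolding ip_self[symmetric] hpoly_def[abs_def] by (rule ip_hbasis_norm)
  then show ?thesis by (simp only: of_real_eq_iff)
qed

lemma hpoly_scale: "hpoly N L (\<lambda>\<iota>. x * c \<iota>) z = x * hpoly N L c z"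
  by (simp add: hpoly_def sum_distrib_left mult.assoc)

definition eigenvalue :: "real \<Rightarrow> real \<Rightarrow> nat \<times> nat \<times> nat \<Rightarrow> real" where
  "eigenvalue \<gamma> \<xi> \<iota> = lambda1 \<gamma> \<xi> (real (fst \<iota>))"

text \<open>
  For indices in \<open>hindex\<close> with \<open>L \<le> N - 2\<close> the first degree is the larger one, so the eigenvalue
  depends on it alone.
\<close>

lemma multiplier_image_hpoly:
  fixes c :: "nat \<times> nat \<times> nat \<Rightarrow> complex"
  assumes L: "L + 2 \<le> N" and ball: "(hpoly N L c :: complex ^ 'd::finite \<Rightarrow> complex) \<in> Lp_unit_ball p"
  shows "(hpoly N L (\<lambda>\<iota>. of_real (eigenvalue \<gamma> \<xi> \<iota>) * c \<iota>) :: complex ^ 'd \<Rightarrow> complex) \<in> multiplier_image (multiplier1 \<gamma> \<xi>) p q"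
proof -
  have "multiplier_rel (multiplier1 \<gamma> \<xi>) (hpoly N L c :: complex ^ 'd \<Rightarrow> complex)
     (\<lambda>z. \<Sum>\<iota>\<in>hindex TYPE('d) N L. (multiplier1 \<gamma> \<xi> (fst \<iota>) (fst (snd \<iota>)) * c \<iota>) * hbasis \<iota> z)"
    unfolding hpoly_def[abs_def] by (rule multiplier_rel_hbasis[OF finite_hindex hindex_subset])
  also have "(\<lambda>z. \<Sum>\<iota>\<in>hindex TYPE('d) N L. (multiplier1 \<gamma> \<xi> (fst \<iota>) (fst (snd \<iota>)) * c \<iota>) * hbasis \<iota> z)
     = (hpoly N L (\<lambda>\<iota>. of_real (eigenvalue \<gamma> \<xi> \<iota>) * c \<iota>) :: complex ^ 'd \<Rightarrow> complex)"
    unfolding hpoly_def[abs_def]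
  proof (intro ext sum.cong refl)
    fix \<iota> and z :: "complex ^ 'd" assume "\<iota> \<in> hindex TYPE('d) N L"
    then have "max (fst \<iota>) (fst (snd \<iota>)) = fst \<iota>" using L by (auto simp: hindex_def)
    then show "(multiplier1 \<gamma> \<xi> (fst \<iota>) (fst (snd \<iota>)) * c \<iota>) * hbasis \<iota> z = of_real (eigenvalue \<gamma> \<xi> \<iota>) * c \<iota> * hbasis \<iota> z"
      by (simp add: multiplier1_def eigenvalue_def)
  qed
  finally show ?thesis
    unfolding multiplier_image_def using ball continuous_Lp[OF hpoly_continuous] by blast
qed

lemma lambda1_antimono:
  assumes "1 < s" "s \<le> t" "\<gamma> \<ge> 0" "\<xi> \<ge> 0"
  shows "lambda1 \<gamma> \<xi> t \<le> lambda1 \<gamma> \<xi> s"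
proof -
  have "t powr (- \<gamma>) \<le> s powr (- \<gamma>)" using assms by (intro powr_mono2') auto
  moreover have "ln t powr (- \<xi>) \<le> ln s powr (- \<xi>)" using assms by (intro powr_mono2') auto
  ultimately have "t powr (- \<gamma>) * ln t powr (- \<xi>) \<le> s powr (- \<gamma>) * ln s powr (- \<xi>)"
    by (intro mult_mono) auto
  then show ?thesis using assms by (simp add: lambda1_def)
qed

lemma eigenvalue_ge:
  assumes L: "L + 2 \<le> N" and "\<iota> \<in> hindex T N L" and "\<gamma> \<ge> 0" "\<xi> \<ge> 0"
  shows "lambda1 \<gamma> \<xi> (real N) \<le> eigenvalue \<gamma> \<xi> \<iota>"
proof -
  have "2 \<le> fst \<iota>" "fst \<iota> \<le> N" using assms by (auto simp: hindex_def)
  then show ?thesis unfolding eigenvalue_def using assms by (intro lambda1_antimono) auto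
qed

lemma lambda1_pos: "t > 1 \<Longrightarrow> lambda1 \<gamma> \<xi> t > 0"
  by (simp add: lambda1_def)

text \<open>
  Used for \<open>q \<le> 2\<close>.  The flat element \<open>\<phi>\<close> is orthogonal to the subspace and serves as the test functional for
  \<open>\<psi> = s \<Lambda>\<phi>\<close>; the factor \<open>s\<close> only uses that \<open>\<phi>\<close> has \<open>L\<^sup>2\<close> norm \<open>1\<close> and \<open>p \<le> 2\<close>.  Flatness enters through
  the bound \<open>B\<close> of the functional.
\<close>

lemma width_dual_case:
  fixes P :: "(nat \<times> nat \<times> nat \<Rightarrow> complex) \<Rightarrow> bool"
  assumes L: "L + 2 \<le> N" and g0: "\<gamma> \<ge> 0" "\<xi> \<ge> 0" and p: "1 \<le> p" "p \<le> 2" and q: "1 \<le> q" and B: "B > 0"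
    and flat: "\<And>a :: nat \<Rightarrow> nat \<times> nat \<times> nat \<Rightarrow> complex. \<exists>c. (\<Sum>\<iota>\<in>hindex TYPE('d::finite) N L. (norm (c \<iota>))\<^sup>2) = 1 \<and>
       (\<forall>j<m. (\<Sum>\<iota>\<in>hindex TYPE('d) N L. a j \<iota> * c \<iota>) = 0) \<and> P c"
    and dual: "\<And>c (f :: complex ^ 'd \<Rightarrow> complex). P c \<Longrightarrow> f \<in> Lp q \<Longrightarrow> norm (ip f (hpoly N L c)) \<le> B * Lp_norm q f"
  shows "kolmogorov_width m (multiplier_image (multiplier1 \<gamma> \<xi>) p q :: (complex ^ 'd \<Rightarrow> complex) set) q
     \<ge> ennreal (lambda1 \<gamma> \<xi> (real N) / ((2 + sphere_area TYPE('d)) * B))"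
proof (rule kolmogorov_width_ge[OF q B])
  let ?I = "hindex TYPE('d) N L"
  fix b :: "nat \<Rightarrow> complex ^ 'd \<Rightarrow> complex" assume b: "\<And>i. i < m \<Longrightarrow> b i \<in> Lp q"
  obtain c where c: "(\<Sum>\<iota>\<in>?I. (norm (c \<iota>))\<^sup>2) = 1" "\<And>j. j < m \<Longrightarrow> (\<Sum>\<iota>\<in>?I. cnj (ip (b j) (hbasis \<iota>)) * c \<iota>) = 0" "P c"
    using flat[of "\<lambda>j \<iota>. cnj (ip (b j) (hbasis \<iota>))"] by blast
  define s where "s = 1 / (1 + sphere_area TYPE('d) + 1)"
  have s: "s > 0" using sphere_area_pos[where 'd='d] by (simp add: s_def add_pos_pos)
  have pf: "p \<noteq> \<infinity>" using p(2) by (auto simp: top_unique)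
  have p2: "enn2real p \<le> real (2 * 1)"
    using p(2) pf by (cases p) (auto simp: ennreal_numeral[symmetric] simp del: ennreal_numeral)
  have "(\<lambda>z::complex ^ 'd. of_real s * hpoly N L c z) \<in> Lp_unit_ball p"
  proof -
    have "(LINT z|(surface_measure :: (complex ^ 'd) measure). norm (hpoly N L c z) ^ (2 * 1)) \<le> 1"
      using hpoly_square[of N L c, where 'd='d] c(1) by simp
    from moment_unit_ball[OF hpoly_continuous p(1) pf p2 this] show ?thesis unfolding s_def .
  qed
  then have ball: "(hpoly N L (\<lambda>\<iota>. of_real s * c \<iota>) :: complex ^ 'd \<Rightarrow> complex) \<in> Lp_unit_ball p"
    by (simp add: hpoly_scale[abs_def])
  define \<psi> where "\<psi> = (hpoly N L (\<lambda>\<iota>. of_real (eigenvalue \<gamma> \<xi> \<iota>) * (of_real s * c \<iota>)) :: complex ^ 'd \<Rightarrow> complex)"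
  have "\<psi> \<in> multiplier_image (multiplier1 \<gamma> \<xi>) p q"
    unfolding \<psi>_def by (rule multiplier_image_hpoly[OF L ball])
  moreover have "\<psi> \<in> Lp q" unfolding \<psi>_def by (rule continuous_Lp[OF hpoly_continuous])
  moreover have "ip (b i) (hpoly N L c) = 0" if "i < m" for i
  proof -
    have "ip (b i) (hpoly N L c) = cnj (\<Sum>\<iota>\<in>?I. cnj (ip (b i) (hbasis \<iota>)) * c \<iota>)"
      unfolding hpoly_ip_right[OF Lp_integrable[OF b[OF that] q]] by (simp add: mult.commute)
    then show ?thesis using c(2)[OF that] by simp
  qed
  moreover have "lambda1 \<gamma> \<xi> (real N) / ((2 + sphere_area TYPE('d)) * B) * B \<le> norm (ip \<psi> (hpoly N L c))"
  proof -
    have "ip \<psi> (hpoly N L c) = of_real (\<Sum>\<iota>\<in>?I. eigenvalue \<gamma> \<xi> \<iota> * s * (norm (c \<iota>))\<^sup>2)"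
      unfolding \<psi>_def hpoly_ip of_real_sum of_real_mult complex_norm_square by (intro sum.cong refl) (simp add: mult_ac)
    then have "norm (ip \<psi> (hpoly N L c)) = \<bar>\<Sum>\<iota>\<in>?I. eigenvalue \<gamma> \<xi> \<iota> * s * (norm (c \<iota>))\<^sup>2\<bar>" by (simp only: norm_of_real)
    also have "\<dots> \<ge> (\<Sum>\<iota>\<in>?I. eigenvalue \<gamma> \<xi> \<iota> * s * (norm (c \<iota>))\<^sup>2)" by (rule abs_ge_self)
    finally have "(\<Sum>\<iota>\<in>?I. eigenvalue \<gamma> \<xi> \<iota> * s * (norm (c \<iota>))\<^sup>2) \<le> norm (ip \<psi> (hpoly N L c))" .
    moreover have "(\<Sum>\<iota>\<in>?I. lambda1 \<gamma> \<xi> (real N) * s * (norm (c \<iota>))\<^sup>2) \<le> (\<Sum>\<iota>\<in>?I. eigenvalue \<gamma> \<xi> \<iota> * s * (norm (c \<iota>))\<^sup>2)"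
      using s by (intro sum_mono mult_right_mono eigenvalue_ge[OF L _ g0]) auto
    moreover have "(\<Sum>\<iota>\<in>?I. lambda1 \<gamma> \<xi> (real N) * s * (norm (c \<iota>))\<^sup>2) = lambda1 \<gamma> \<xi> (real N) * s"
      by (simp add: sum_distrib_left[symmetric] c(1))
    moreover have "lambda1 \<gamma> \<xi> (real N) / ((2 + sphere_area TYPE('d)) * B) * B = lambda1 \<gamma> \<xi> (real N) * s"
      using B by (simp add: s_def)
    ultimately show ?thesis by linarith
  qed
  ultimately show "\<exists>\<psi>\<in>multiplier_image (multiplier1 \<gamma> \<xi>) p q. \<psi> \<in> Lp q \<and> (\<exists>g. continuous_on usph g \<and>
        (\<forall>i<m. ip (b i) g = 0) \<and> (\<forall>f\<in>Lp q. norm (ip f g) \<le> B * Lp_norm q f) \<and> 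
         lambda1 \<gamma> \<xi> (real N) / ((2 + sphere_area TYPE('d)) * B) * B \<le> norm (ip \<psi> g))"
    using hpoly_continuous dual[OF c(3)] by (intro bexI[of _ \<psi>] conjI exI[of _ "hpoly N L c"]) auto
qed

text \<open>
  For \<open>q \<ge> 2\<close>.  Here \<open>\<Lambda>\<phi>\<close> is orthogonal to the subspace, and \<open>\<Lambda>\<phi>\<close> divided by its \<open>L\<^sup>2\<close> norm \<open>n\<close> is the test
  functional, with \<open>n \<ge> \<lambda>(N)\<close>.  Flatness enters through the factor \<open>s\<close> that brings \<open>\<phi>\<close> into the unit
  ball of \<open>L\<^sup>p\<close>.
\<close>

lemma width_hilbert_case:
  fixes P :: "(nat \<times> nat \<times> nat \<Rightarrow> complex) \<Rightarrow> bool"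
  assumes L: "L + 2 \<le> N" and g0: "\<gamma> \<ge> 0" "\<xi> \<ge> 0" and q: "2 \<le> q" and s: "s > 0"
    and flat: "\<And>a :: nat \<Rightarrow> nat \<times> nat \<times> nat \<Rightarrow> complex. \<exists>c. (\<Sum>\<iota>\<in>hindex TYPE('d::finite) N L. (norm (c \<iota>))\<^sup>2) = 1 \<and>
       (\<forall>j<m. (\<Sum>\<iota>\<in>hindex TYPE('d) N L. a j \<iota> * c \<iota>) = 0) \<and> P c"
    and ball: "\<And>c. P c \<Longrightarrow> (\<lambda>z. of_real s * (hpoly N L c (z :: complex ^ 'd) :: complex)) \<in> Lp_unit_ball p"
  shows "kolmogorov_width m (multiplier_image (multiplier1 \<gamma> \<xi>) p q :: (complex ^ 'd \<Rightarrow> complex) set) q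
     \<ge> ennreal (lambda1 \<gamma> \<xi> (real N) * s / (2 + sphere_area TYPE('d)))"
proof -
  let ?I = "hindex TYPE('d) N L" and ?B = "2 + sphere_area TYPE('d)"
  have q1: "1 \<le> q" using q by (rule order_trans[rotated]) simp
  have B: "?B > 0" using sphere_area_pos[where 'd='d] by simp
  show ?thesis
  proof (rule kolmogorov_width_ge[OF q1 B])
    fix b :: "nat \<Rightarrow> complex ^ 'd \<Rightarrow> complex" assume b: "\<And>i. i < m \<Longrightarrow> b i \<in> Lp q"
    obtain c where c: "(\<Sum>\<iota>\<in>?I. (norm (c \<iota>))\<^sup>2) = 1"
       "\<And>j. j < m \<Longrightarrow> (\<Sum>\<iota>\<in>?I. (cnj (ip (b j) (hbasis \<iota>)) * of_real (eigenvalue \<gamma> \<xi> \<iota>)) * c \<iota>) = 0" "P c"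
      using flat[of "\<lambda>j \<iota>. cnj (ip (b j) (hbasis \<iota>)) * of_real (eigenvalue \<gamma> \<xi> \<iota>)"] by blast
    define e where "e = (\<lambda>\<iota>. of_real (eigenvalue \<gamma> \<xi> \<iota>) * c \<iota>)"
    define n2 where "n2 = (\<Sum>\<iota>\<in>?I. (norm (e \<iota>))\<^sup>2)"
    have lN: "lambda1 \<gamma> \<xi> (real N) > 0" using L by (intro lambda1_pos) simp
    have "(lambda1 \<gamma> \<xi> (real N))\<^sup>2 = (\<Sum>\<iota>\<in>?I. (lambda1 \<gamma> \<xi> (real N))\<^sup>2 * (norm (c \<iota>))\<^sup>2)"
      by (simp add: sum_distrib_left[symmetric] c(1))
    also have "\<dots> \<le> n2" unfolding n2_def
    proof (rule sum_mono)
      fix \<iota> assume "\<iota> \<in> ?I"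
      then have "lambda1 \<gamma> \<xi> (real N) \<le> eigenvalue \<gamma> \<xi> \<iota>" by (rule eigenvalue_ge[OF L _ g0])
      then have "(lambda1 \<gamma> \<xi> (real N))\<^sup>2 \<le> (eigenvalue \<gamma> \<xi> \<iota>)\<^sup>2" using lN by (intro power_mono) auto
      then show "(lambda1 \<gamma> \<xi> (real N))\<^sup>2 * (norm (c \<iota>))\<^sup>2 \<le> (norm (e \<iota>))\<^sup>2"
        by (simp add: e_def norm_mult power_mult_distrib mult_right_mono)
    qed
    finally have n2: "(lambda1 \<gamma> \<xi> (real N))\<^sup>2 \<le> n2" .
    define n where "n = sqrt n2"
    have n2p: "n2 > 0" using n2 lN by (meson less_le_trans zero_less_power)
    have np: "n > 0" "n\<^sup>2 = n2" using n2p by (auto simp: n_def)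
    have nl: "lambda1 \<gamma> \<xi> (real N) \<le> n" unfolding n_def using n2 by (rule real_le_rsqrt)
    define g where "g = (hpoly N L (\<lambda>\<iota>. of_real (1 / n) * e \<iota>) :: complex ^ 'd \<Rightarrow> complex)"
    have gsq: "(LINT z|surface_measure. norm (g z) ^ 2) = 1"
    proof -
      have "(LINT z|surface_measure. norm (g z) ^ 2) = (\<Sum>\<iota>\<in>?I. (norm (of_real (1 / n) * e \<iota>))\<^sup>2)"
        unfolding g_def by (rule hpoly_square)
      also have "\<dots> = (1 / n)\<^sup>2 * n2"
        unfolding n2_def sum_distrib_left by (intro sum.cong refl) (simp add: norm_mult norm_divide power_mult_distrib power_divide)
      also have "\<dots> = 1" using np n2p by (simp add: power_divide)
      finally show ?thesis .
    qed
    have gc: "continuous_on usph g" unfolding g_def by (rule hpoly_continuous)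
    have dual: "norm (ip f g) \<le> ?B * Lp_norm q f" if f: "f \<in> Lp q" for f
    proof (cases "q = \<infinity>")
      case True
      then show ?thesis using dual_bound_Linf[OF _ gc, of f] f gsq by simp
    next
      case False
      have "2 \<le> enn2real q" using q False
        by (cases q) (auto simp: ennreal_numeral[symmetric] simp del: ennreal_numeral)
      then show ?thesis using dual_bound_finite[OF f q1 False gc, of 1] gsq by simp
    qed
    have ortho: "ip (b i) g = 0" if "i < m" for i
    proof -
      have "ip (b i) g = of_real (1 / n) * cnj (\<Sum>\<iota>\<in>?I. (cnj (ip (b i) (hbasis \<iota>)) * of_real (eigenvalue \<gamma> \<xi> \<iota>)) * c \<iota>)"
        unfolding g_def hpoly_ip_right[OF Lp_integrable[OF b[OF that] q1]] cnj_sum sum_distrib_left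
        by (intro sum.cong refl) (simp add: e_def mult_ac)
      then show ?thesis using c(2)[OF that] by simp
    qed
    define \<psi> where "\<psi> = (hpoly N L (\<lambda>\<iota>. of_real (eigenvalue \<gamma> \<xi> \<iota>) * (of_real s * c \<iota>)) :: complex ^ 'd \<Rightarrow> complex)"
    have "(hpoly N L (\<lambda>\<iota>. of_real s * c \<iota>) :: complex ^ 'd \<Rightarrow> complex) \<in> Lp_unit_ball p"
      using ball[OF c(3)] by (simp add: hpoly_scale[abs_def])
    then have im: "\<psi> \<in> multiplier_image (multiplier1 \<gamma> \<xi>) p q"
      unfolding \<psi>_def by (rule multiplier_image_hpoly[OF L])
    have pL: "\<psi> \<in> Lp q" unfolding \<psi>_def by (rule continuous_Lp[OF hpoly_continuous])
    have "ip \<psi> g = of_real (s / n * n2)"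
      unfolding \<psi>_def g_def hpoly_ip n2_def sum_distrib_left of_real_sum of_real_mult complex_norm_square
      by (intro sum.cong refl) (simp add: e_def mult_ac)
    also have "s / n * n2 = s * n" using np by (simp add: np(2)[symmetric] power2_eq_square)
    finally have "norm (ip \<psi> g) = s * n" using s np by (simp add: norm_mult)
    moreover have "lambda1 \<gamma> \<xi> (real N) * s / ?B * ?B \<le> s * n" using s nl B by (simp add: mult.commute)
    ultimately have lb: "lambda1 \<gamma> \<xi> (real N) * s / ?B * ?B \<le> norm (ip \<psi> g)" by simp
    show "\<exists>\<psi>\<in>multiplier_image (multiplier1 \<gamma> \<xi>) p q. \<psi> \<in> Lp q \<and> (\<exists>g. continuous_on usph g \<and>
        (\<forall>i<m. ip (b i) g = 0) \<and> (\<forall>f\<in>Lp q. norm (ip f g) \<le> ?B * Lp_norm q f) \<and> 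
         lambda1 \<gamma> \<xi> (real N) * s / ?B * ?B \<le> norm (ip \<psi> g))"
      using im pL gc dual ortho lb by (intro bexI[of _ \<psi>] conjI exI[of _ g]) auto
  qed
qed

section \<open>Choice of the degrees\<close>

lemma flat_polynomial_moment:
  assumes m: "2 * m \<le> card (hindex TYPE('d::finite) N L)" and D: "card (hindex TYPE('d) N L) > 0" and k: "k \<ge> 1"
  shows "\<exists>c. (\<Sum>\<iota>\<in>hindex TYPE('d) N L. (norm (c \<iota>))\<^sup>2) = 1 \<and>
    (\<forall>j<m. (\<Sum>\<iota>\<in>hindex TYPE('d) N L. a j \<iota> * c \<iota>) = (0::complex)) \<and>
    (LINT z|(surface_measure :: (complex ^ 'd) measure). norm (hpoly N L c z) ^ (2 * k))
      \<le> sphere_area TYPE('d) * (96 * real k / sphere_area TYPE('d)) ^ k"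
  unfolding hpoly_def by (rule flat_polynomial[OF m D k])

text \<open>
  The factor \<open>e\<^sup>4\<^sup>d\<close> comes from the dimension in \<open>norm_le_of_moment\<close>, and \<open>192\<close> is twice the \<open>96\<close> of
  \<open>flat_polynomial_moment\<close>, because \<open>k \<le> 2 ln N\<close>.
\<close>

definition sup_const :: "'d::finite itself \<Rightarrow> real" where
  "sup_const T = exp (4 * real CARD('d)) * 192 / sphere_area T"

text \<open>
  Take \<open>k\<close> to be \<open>ln N\<close> rounded up.  Then \<open>(kN + 1)(kL + 1) \<le> N\<^sup>4 \<le> e\<^sup>4\<^sup>k\<close>, so the dimension factor in
  \<open>norm_le_of_moment\<close> is the \<open>k\<close>-th power of a constant.
\<close>

lemma flat_polynomial_sup:
  assumes m: "2 * m \<le> card (hindex TYPE('d::finite) N L)" and D: "card (hindex TYPE('d) N L) > 0"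
    and N: "N \<ge> 4" and L: "L \<le> N"
  shows "\<exists>c. (\<Sum>\<iota>\<in>hindex TYPE('d) N L. (norm (c \<iota>))\<^sup>2) = 1 \<and>
    (\<forall>j<m. (\<Sum>\<iota>\<in>hindex TYPE('d) N L. a j \<iota> * c \<iota>) = (0::complex)) \<and>
    (\<forall>z\<in>usph. norm (hpoly N L c (z :: complex ^ 'd)) \<le> sqrt (sup_const TYPE('d) * ln (real N)))"
proof -
  let ?S = "sphere_area TYPE('d)"
  have S: "?S > 0" by (rule sphere_area_pos)
  have ln1: "ln (real N) \<ge> 1"
  proof -
    have "exp 1 \<le> real N" using exp_le N by linarith
    then show ?thesis using N by (subst ln_ge_iff) auto
  qed
  define k where "k = nat \<lceil>ln (real N)\<rceil>"
  have kl: "ln (real N) \<le> real k" unfolding k_def using ln1 by linarith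
  have ku: "real k \<le> 2 * ln (real N)" unfolding k_def using ln1 by linarith
  have k1: "k \<ge> 1" using kl ln1 by linarith
  have "ln (real N) \<le> real (N - 1)" using ln_le_minus_one[of "real N"] N by (simp add: of_nat_diff)
  then have kN: "k \<le> N - 1" unfolding k_def by (simp add: ceiling_le_iff nat_le_iff)
  obtain c where c: "(\<Sum>\<iota>\<in>hindex TYPE('d) N L. (norm (c \<iota>))\<^sup>2) = 1"
    "\<forall>j<m. (\<Sum>\<iota>\<in>hindex TYPE('d) N L. a j \<iota> * c \<iota>) = (0::complex)"
    "(LINT z|(surface_measure :: (complex ^ 'd) measure). norm (hpoly N L c z) ^ (2 * k)) \<le> ?S * (96 * real k / ?S) ^ k"
    using flat_polynomial_moment[OF m D k1, of a] by blast
  have NN: "(k * N + 1) * (k * L + 1) \<le> N ^ 4"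
  proof -
    have "k * N + 1 \<le> (N - 1) * N + N" using kN N by (intro add_mono mult_mono) auto
    also have "\<dots> = N * N" using N by (simp add: algebra_simps diff_mult_distrib)
    finally have 1: "k * N + 1 \<le> N * N" .
    have "k * L + 1 \<le> k * N + 1" using L by simp
    with 1 have "k * L + 1 \<le> N * N" by linarith
    with 1 have "(k * N + 1) * (k * L + 1) \<le> (N * N) * (N * N)" by (intro mult_mono) auto
    then show ?thesis by (simp add: power4_eq_xxxx mult.assoc)
  qed
  have Nk: "real N \<le> exp (real k)"
  proof -
    have "real N = exp (ln (real N))" using N by simp
    also have "\<dots> \<le> exp (real k)" using kl by simp
    finally show ?thesis .
  qed
  have dimb: "real (((k * N + 1) * (k * L + 1)) ^ CARD('d)) \<le> exp (4 * real CARD('d)) ^ k"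
  proof -
    have "((k * N + 1) * (k * L + 1)) ^ CARD('d) \<le> (N ^ 4) ^ CARD('d)" using NN by (rule power_mono) simp
    then have "real (((k * N + 1) * (k * L + 1)) ^ CARD('d)) \<le> real ((N ^ 4) ^ CARD('d))" by (rule of_nat_mono)
    also have "\<dots> = real N ^ (4 * CARD('d))" by (simp add: power_mult)
    also have "\<dots> \<le> exp (real k) ^ (4 * CARD('d))" using Nk by (intro power_mono) auto
    also have "\<dots> = exp (4 * real CARD('d)) ^ k"
      by (simp add: exp_of_nat_mult[symmetric] mult_ac flip: exp_of_nat2_mult)
    finally show ?thesis .
  qed
  have "norm (hpoly N L c z :: complex) \<le> sqrt (sup_const TYPE('d) * ln (real N))" if z: "z \<in> usph" for z :: "complex ^ 'd"
  proof -
    let ?J = "LINT z|(surface_measure :: (complex ^ 'd) measure). norm (hpoly N L c z) ^ (2 * k)"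
    define x where "x = (norm (hpoly N L c z))\<^sup>2"
    have "x ^ k = norm (hpoly N L c z) ^ (2 * k)" by (simp add: x_def power_mult)
    also have "\<dots> \<le> real (((k * N + 1) * (k * L + 1)) ^ CARD('d)) / ?S * ?J"
      unfolding hpoly_def by (rule norm_le_of_moment[OF z])
    also have "\<dots> \<le> exp (4 * real CARD('d)) ^ k / ?S * (?S * (96 * real k / ?S) ^ k)"
      using S c(3) dimb by (intro mult_mono divide_right_mono) auto
    also have "\<dots> = exp (4 * real CARD('d)) ^ k * (96 * real k / ?S) ^ k" using S by simp
    also have "\<dots> = (exp (4 * real CARD('d)) * (96 * real k / ?S)) ^ k" by (rule power_mult_distrib[symmetric])
    finally have "x \<le> exp (4 * real CARD('d)) * (96 * real k / ?S)"
      by (rule power_le_imp_le_base[of _ "k - 1", unfolded Suc_diff_1[OF less_le_trans[OF zero_less_one k1]] Suc_pred'[symmetric]])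
         (use S in simp)
    also have "\<dots> \<le> exp (4 * real CARD('d)) * (96 * (2 * ln (real N)) / ?S)"
      using S ku by (intro mult_left_mono divide_right_mono) auto
    also have "\<dots> = sup_const TYPE('d) * ln (real N)" by (simp add: sup_const_def)
    finally have "x \<le> sup_const TYPE('d) * ln (real N)" .
    then show ?thesis unfolding x_def by (rule real_le_rsqrt)
  qed
  then show ?thesis by (intro exI[of _ c] conjI c(1,2) ballI)
qed

text \<open>
  The least \<open>t\<close> with \<open>t\<^sup>2\<^sup>d\<^sup>-\<^sup>1 \<ge> 2m\<close>.  The polynomials used for \<open>m\<close> have degrees \<open>N = d t + 2\<close> and \<open>L = d t\<close>.
\<close>

definition degree_for :: "nat \<Rightarrow> nat \<Rightarrow> nat" where
  "degree_for d m = nat \<lceil>(2 * real m) powr (1 / (2 * real d - 1))\<rceil>"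

lemma degree_ge_2: "2 \<le> real (d * degree_for d m + 2)"
proof -
  have "real 2 \<le> real (d * degree_for d m + 2)" by (rule of_nat_mono) simp
  then show ?thesis by (simp only: of_nat_numeral)
qed

lemma degree_for_dimension:
  assumes m: "m \<ge> 2"
  shows "2 * m \<le> card (hindex TYPE('d::finite) (CARD('d) * degree_for CARD('d) m + 2) (CARD('d) * degree_for CARD('d) m))"
proof -
  let ?d = "CARD('d)" and ?t = "degree_for CARD('d) m"
  have d1: "?d \<ge> 1" using zero_less_card_finite[where 'a='d] by linarith
  have s: "real (2 * ?d - 1) = 2 * real ?d - 1" using d1 by (simp add: of_nat_diff)
  have "real 1 \<le> real ?d" using d1 by (rule of_nat_mono)
  then have s0: "2 * real ?d - 1 > 0" by linarith
  have "(2 * real m) powr (1 / (2 * real ?d - 1)) \<le> real ?t" unfolding degree_for_def by linarith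
  then have "((2 * real m) powr (1 / (2 * real ?d - 1))) powr (2 * real ?d - 1) \<le> real ?t powr (2 * real ?d - 1)"
    using s0 by (intro powr_mono2) auto
  then have "2 * real m \<le> real ?t powr (2 * real ?d - 1)" using s0 m by (simp add: powr_powr)
  also have "\<dots> \<le> real (?t + 1) powr (2 * real ?d - 1)" using s0 by (intro powr_mono2) auto
  also have "\<dots> = real (?t + 1) ^ (2 * ?d - 1)" unfolding s[symmetric] by (rule powr_realpow) simp
  finally have "real (2 * m) \<le> real ((?t + 1) ^ (2 * ?d - 1))" by simp
  then have "2 * m \<le> (?t + 1) ^ (2 * ?d - 1)" by (simp only: of_nat_le_iff)
  also have "\<dots> \<le> card (exponent_pairs (?d * ?t + 2) (?d * ?t) :: (('d \<Rightarrow> nat) \<times> ('d \<Rightarrow> nat)) set)"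
    by (rule card_exponent_pairs_ge) auto
  also have "\<dots> \<le> card (hindex TYPE('d) (?d * ?t + 2) (?d * ?t))" by (rule card_exponent_pairs_le_hindex)
  finally show ?thesis .
qed

lemma degree_for_upper:
  assumes m: "m \<ge> 2" and d: "d \<ge> 1"
  shows "real (d * degree_for d m + 2) \<le> (3 * real d + 2) * real m powr (1 / (2 * real d - 1))"
proof -
  let ?s = "2 * real d - 1" and ?x = "real m powr (1 / (2 * real d - 1))"
  have s1: "?s \<ge> 1" using d by simp
  have x1: "?x \<ge> 1" using m s1 by (intro ge_one_powr_ge_zero) auto
  have "(2 * real m) powr (1 / ?s) = 2 powr (1 / ?s) * ?x" using m by (simp add: powr_mult)
  also have "\<dots> \<le> 2 * ?x"
  proof (intro mult_right_mono)
    have "(2::real) powr (1 / ?s) \<le> 2 powr 1" using s1 by (intro powr_mono) (auto simp: divide_le_eq)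
    then show "(2::real) powr (1 / ?s) \<le> 2" by simp
  qed simp
  finally have a: "(2 * real m) powr (1 / ?s) \<le> 2 * ?x" .
  have "real (degree_for d m) \<le> (2 * real m) powr (1 / ?s) + 1"
    unfolding degree_for_def using powr_ge_zero[of "2 * real m" "1 / ?s"] by linarith
  then have "real (degree_for d m) \<le> 3 * ?x" using a x1 by linarith
  then have "real d * real (degree_for d m) \<le> real d * (3 * ?x)" by (intro mult_left_mono) auto
  then show ?thesis using x1 by (simp add: algebra_simps)
qed

lemma degree_for_ge: "m \<ge> 2 \<Longrightarrow> d \<ge> 1 \<Longrightarrow> degree_for d m \<ge> 1"
proof -
  assume m: "m \<ge> 2" and d: "d \<ge> 1"
  have "(2 * real m) powr (1 / (2 * real d - 1)) > 0" using m by simp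
  then show ?thesis unfolding degree_for_def by linarith
qed

lemma ln_degree_for_upper:
  assumes d: "d \<ge> 1"
  shows "\<exists>C>0. \<forall>m\<ge>2. ln (real (d * degree_for d m + 2)) \<le> C * ln (real m)"
proof -
  define A where "A = 3 * real d + 2"
  have A: "A \<ge> 1" by (simp add: A_def)
  define C where "C = ln A / ln 2 + 1"
  have lA: "ln A \<ge> 0" using A by simp
  have "ln (real (d * degree_for d m + 2)) \<le> C * ln (real m)" if m: "m \<ge> 2" for m
  proof -
    let ?e = "1 / (2 * real d - 1)"
    have e: "?e \<le> 1" "?e \<ge> 0" using d by (auto simp: divide_le_eq)
    have mp: "real m > 0" using m by simp
    have lm: "ln (real m) \<ge> ln 2" using m by simp
    have l2: "ln (2::real) > 0" by simp
    have "ln (real (d * degree_for d m + 2)) \<le> ln (A * real m powr ?e)"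
      using order_trans[OF degree_ge_2 degree_for_upper[OF m d]] degree_for_upper[OF m d] degree_ge_2[of d m]
      unfolding A_def[symmetric] by (subst ln_le_cancel_iff) linarith+
    also have "\<dots> = ln A + ?e * ln (real m)" using A mp by (subst ln_mult) (auto simp: ln_powr)
    also have "\<dots> \<le> ln A / ln 2 * ln (real m) + 1 * ln (real m)"
    proof (rule add_mono)
      have "ln A / ln 2 * ln 2 \<le> ln A / ln 2 * ln (real m)" using lA lm l2 by (intro mult_left_mono) auto
      then show "ln A \<le> ln A / ln 2 * ln (real m)" using l2 by simp
      show "?e * ln (real m) \<le> 1 * ln (real m)" using e lm l2 by (intro mult_right_mono) linarith+
    qed
    finally show ?thesis by (simp add: C_def algebra_simps)
  qed
  moreover have "C > 0" unfolding C_def using lA by (simp add: add_nonneg_pos)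
  ultimately show ?thesis by blast
qed

lemma lambda1_degree_for_lower:
  assumes d: "d \<ge> 1" and g: "\<gamma> \<ge> 0" "\<xi> \<ge> 0"
  shows "\<exists>C>0. \<forall>m\<ge>2. C * (real m powr (- \<gamma> / (2 * real d - 1)) * ln (real m) powr (- \<xi>))
     \<le> lambda1 \<gamma> \<xi> (real (d * degree_for d m + 2))"
proof -
  define A where "A = 3 * real d + 2"
  have A: "A > 0" by (simp add: A_def add_pos_pos)
  obtain B where B: "B > 0" "\<And>m. m \<ge> 2 \<Longrightarrow> ln (real (d * degree_for d m + 2)) \<le> B * ln (real m)"
    using ln_degree_for_upper[OF d] by blast
  have "A powr (- \<gamma>) * B powr (- \<xi>) * (real m powr (- \<gamma> / (2 * real d - 1)) * ln (real m) powr (- \<xi>))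
     \<le> lambda1 \<gamma> \<xi> (real (d * degree_for d m + 2))" if m: "m \<ge> 2" for m
  proof -
    let ?N = "real (d * degree_for d m + 2)" and ?e = "1 / (2 * real d - 1)"
    have N: "?N > 1" using degree_ge_2[of d m] by linarith
    have lm: "ln (real m) > 0" using m by simp
    have "(A * real m powr ?e) powr (- \<gamma>) \<le> ?N powr (- \<gamma>)"
      using degree_for_upper[OF m d] g N unfolding A_def by (intro powr_mono2') auto
    moreover have "(A * real m powr ?e) powr (- \<gamma>) = A powr (- \<gamma>) * real m powr (- \<gamma> / (2 * real d - 1))"
      using A by (simp add: powr_mult powr_powr)
    ultimately have 1: "A powr (- \<gamma>) * real m powr (- \<gamma> / (2 * real d - 1)) \<le> ?N powr (- \<gamma>)" by simp
    have "(B * ln (real m)) powr (- \<xi>) \<le> ln ?N powr (- \<xi>)"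
      using B(2)[OF m] g N by (intro powr_mono2') auto
    then have 2: "B powr (- \<xi>) * ln (real m) powr (- \<xi>) \<le> ln ?N powr (- \<xi>)"
      using B(1) lm by (simp add: powr_mult)
    have "(A powr (- \<gamma>) * real m powr (- \<gamma> / (2 * real d - 1))) * (B powr (- \<xi>) * ln (real m) powr (- \<xi>))
      \<le> ?N powr (- \<gamma>) * ln ?N powr (- \<xi>)"
      by (intro mult_mono 1 2) auto
    then show ?thesis using N by (simp add: lambda1_def mult_ac)
  qed
  moreover have "A powr (- \<gamma>) * B powr (- \<xi>) > 0" using A B(1) by simp
  ultimately show ?thesis by blast
qed

lemma inv_sqrt_ln_lower:
  assumes d: "d \<ge> 1" and C: "C > 0"
  shows "\<exists>K>0. \<forall>m\<ge>2. K * ln (real m) powr (- 1 / 2) \<le> 1 / sqrt (C * ln (real (d * degree_for d m + 2)))"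
proof -
  obtain B where B: "B > 0" "\<And>m. m \<ge> 2 \<Longrightarrow> ln (real (d * degree_for d m + 2)) \<le> B * ln (real m)"
    using ln_degree_for_upper[OF d] by blast
  have "1 / sqrt (C * B) * ln (real m) powr (- 1 / 2) \<le> 1 / sqrt (C * ln (real (d * degree_for d m + 2)))" if m: "m \<ge> 2" for m
  proof -
    have lm: "ln (real m) > 0" using m by simp
    have lN: "ln (real (d * degree_for d m + 2)) > 0" using degree_ge_2[of d m] by (intro ln_gt_zero) linarith
    have half: "(- 1 / 2 :: real) = - (1 / 2)" by simp
    have "ln (real m) powr (- 1 / 2) = 1 / sqrt (ln (real m))"
      unfolding half powr_minus powr_half_sqrt[OF less_imp_le[OF lm]] by (simp only: inverse_eq_divide)
    then have "1 / sqrt (C * B) * ln (real m) powr (- 1 / 2) = 1 / sqrt (C * (B * ln (real m)))"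
      using B(1) C lm by (simp add: real_sqrt_mult)
    also have "\<dots> \<le> 1 / sqrt (C * ln (real (d * degree_for d m + 2)))"
      using C lN B(2)[OF m] by (intro divide_left_mono real_sqrt_le_mono mult_left_mono) auto
    finally show ?thesis .
  qed
  moreover have "1 / sqrt (C * B) > 0" using B(1) C by simp
  ultimately show ?thesis by blast
qed

lemma le_double_Suc: "n \<le> 2 * Suc n - 1" "n \<le> 2 * Suc n" for n :: nat
  by simp_all

lemma ennreal_le_trans_real: "x \<le> y \<Longrightarrow> ennreal y \<le> K \<Longrightarrow> ennreal x \<le> K"
  using ennreal_leI order_trans by blast

section \<open>The lower bound\<close>

theorem theorem6p3:
  fixes \<xi> \<gamma> :: real and p q :: ennreal
  assumes "2 \<le> CARD('d::finite)"
    and "0 \<le> \<xi>"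
    and "(2 * real CARD('d) - 1) / 2 < \<gamma>"
    and "admissible_exponents p q"
    and "multiplier_bounded TYPE('d) (multiplier1 \<gamma> \<xi>) p q"
  shows "\<exists>C>0. \<forall>m::nat. 2 \<le> m \<longrightarrow>
           kolmogorov_width m
             (multiplier_image (multiplier1 \<gamma> \<xi>) p q :: ((complex ^ 'd) \<Rightarrow> complex) set) q
           \<ge> ennreal (C * (real m powr (- \<gamma> / (2 * real CARD('d) - 1))
                         * ln (real m) powr (- \<xi>) * kappa p q m))"
proof -
  let ?d = "CARD('d)" and ?S = "sphere_area TYPE('d)"
  let ?W = "\<lambda>m. kolmogorov_width m (multiplier_image (multiplier1 \<gamma> \<xi>) p q :: ((complex ^ 'd) \<Rightarrow> complex) set) q"
  have d1: "?d \<ge> 1" using assms(1) by simp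
  have "real 1 \<le> real ?d" using d1 by (rule of_nat_mono)
  then have "0 < 2 * real ?d - 1" by linarith
  then have "0 < (2 * real ?d - 1) / 2" by (rule half_gt_zero)
  then have "\<gamma> \<ge> 0" using assms(3) by (rule order.strict_implies_order[OF order.strict_trans])
  then have g0: "\<gamma> \<ge> 0" "\<xi> \<ge> 0" using assms(2) by simp_all
  have Nr: "2 \<le> real (?d * degree_for ?d m + 2)" for m by (rule degree_ge_2)
  have S: "?S > 0" by (rule sphere_area_pos)
  define N where "N = (\<lambda>m. ?d * degree_for ?d m + 2)"
  define L where "L = (\<lambda>m. ?d * degree_for ?d m)"
  define \<mu> where "\<mu> = (\<lambda>m. real m powr (- \<gamma> / (2 * real ?d - 1)) * ln (real m) powr (- \<xi>))"
  have \<mu>0: "\<mu> m \<ge> 0" for m by (simp add: \<mu>_def)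
  obtain c1 where c1: "c1 > 0" "\<And>m. m \<ge> 2 \<Longrightarrow> c1 * \<mu> m \<le> lambda1 \<gamma> \<xi> (real (N m))"
    using lambda1_degree_for_lower[OF d1 g0] unfolding \<mu>_def N_def by blast
  have sc: "sup_const TYPE('d) > 0" using S by (simp add: sup_const_def)
  obtain c2 where c2: "c2 > 0" "\<And>m. m \<ge> 2 \<Longrightarrow> c2 * ln (real m) powr (- 1 / 2) \<le> 1 / sqrt (sup_const TYPE('d) * ln (real (N m)))"
    using inv_sqrt_ln_lower[OF d1 sc] unfolding N_def by blast
  have NL: "L m + 2 \<le> N m" "L m \<le> N m" for m by (simp_all add: N_def L_def)
  have N4: "N m \<ge> 4" if "m \<ge> 2" for m
  proof -
    have "2 * 1 \<le> ?d * degree_for ?d m" using assms(1) degree_for_ge[OF that d1] by (rule mult_le_mono)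
    then show ?thesis by (simp add: N_def)
  qed
  have dim: "2 * m \<le> card (hindex TYPE('d) (N m) (L m))" if "m \<ge> 2" for m
    unfolding N_def L_def by (rule degree_for_dimension[OF that])
  have dim0: "card (hindex TYPE('d) (N m) (L m)) > 0" if "m \<ge> 2" for m using dim[OF that] that by linarith
  define R where "R = (\<lambda>m. sqrt (sup_const TYPE('d) * ln (real (N m))))"
  have lnN: "ln (real (N m)) > 0" for m using Nr[of m] unfolding N_def by (intro ln_gt_zero) linarith
  have l0: "lambda1 \<gamma> \<xi> (real (N m)) \<ge> 0" for m
    using lambda1_pos[of "real (N m)" \<gamma> \<xi>] Nr[of m] unfolding N_def by linarith
  have R0: "R m > 0" for m using sc lnN[of m] by (simp add: R_def)
  have "(1 \<le> p \<and> p \<le> 2 \<and> 1 < q \<and> q \<le> 2) \<or> (1 \<le> p \<and> p \<noteq> \<infinity> \<and> 2 \<le> q) \<or>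
     (1 \<le> p \<and> p \<le> 2 \<and> q = 1) \<or> (p = \<infinity> \<and> 2 \<le> q)"
  proof -
    have "1 \<le> p" if "2 \<le> p" using that by (rule order_trans[rotated]) simp
    moreover have "p \<noteq> \<infinity>" if "p \<le> 2" using that by (auto simp: top_unique)
    moreover have "p \<noteq> \<infinity>" if "p < \<infinity>" using that by auto
    ultimately show ?thesis using assms(4) unfolding admissible_exponents_def by blast
  qed
  then consider (a) "1 \<le> p" "p \<le> 2" "1 < q" "q \<le> 2" | (b) "1 \<le> p" "p \<noteq> \<infinity>" "2 \<le> q"
    | (d) "1 \<le> p" "p \<le> 2" "q = 1" | (e) "p = \<infinity>" "2 \<le> q" by blast
  then show ?thesis
  proof cases
    case a
    have qf: "q \<noteq> \<infinity>" using a(4) by (auto simp: top_unique)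
    have q1: "1 < enn2real q" using a(3) qf by (cases q) (auto simp: ennreal_less_iff ennreal_1[symmetric] simp del: ennreal_1)
    \<comment> \<open>large enough for \<open>2k\<close> to be at least the conjugate exponent of \<open>q\<close>\<close>
    define k where "k = Suc (nat \<lceil>1 / (enn2real q - 1)\<rceil>)"
    have kr: "real (2 * k) / real (2 * k - 1) \<le> enn2real q"
    proof -
      define h where "h = real (2 * k - 1)"
      have "1 / (enn2real q - 1) \<le> real (nat \<lceil>1 / (enn2real q - 1)\<rceil>)" by (rule real_nat_ceiling_ge)
      also have "\<dots> \<le> h" unfolding k_def h_def by (rule of_nat_mono[OF le_double_Suc(1)])
      finally have "1 / (enn2real q - 1) \<le> h" .
      then have h1: "1 \<le> h * (enn2real q - 1)" using q1 by (simp add: divide_le_eq)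
      have "2 * k = Suc (2 * k - 1)" by (simp add: k_def)
      then have k2: "real (2 * k) = h + 1" unfolding h_def by (metis of_nat_Suc add.commute)
      have "h > 0" by (simp add: k_def h_def)
      with h1 have "(h + 1) / h \<le> enn2real q" by (simp add: divide_le_eq algebra_simps)
      then show ?thesis by (simp only: k2 h_def[symmetric])
    qed
    have k1: "k \<ge> 1" by (simp add: k_def)
    define Y where "Y = ?S * (96 * real k / ?S) ^ k"
    have Y0: "Y \<ge> 0" using S by (simp add: Y_def)
    define B where "B = 1 + ?S + Y"
    have B: "B > 0" using S Y0 by (simp add: B_def)
    have w: "ennreal (lambda1 \<gamma> \<xi> (real (N m)) / ((2 + ?S) * B)) \<le> ?W m" if m: "m \<ge> 2" for m
    proof (rule width_dual_case[where P = "\<lambda>c. (LINT z|(surface_measure :: (complex ^ 'd) measure). norm (hpoly (N m) (L m) c z) ^ (2 * k)) \<le> Y"])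
      fix a show "\<exists>c. (\<Sum>\<iota>\<in>hindex TYPE('d) (N m) (L m). (norm (c \<iota>))\<^sup>2) = 1 \<and>
         (\<forall>j<m. (\<Sum>\<iota>\<in>hindex TYPE('d) (N m) (L m). a j \<iota> * c \<iota>) = (0::complex)) \<and>
         (LINT z|(surface_measure :: (complex ^ 'd) measure). norm (hpoly (N m) (L m) c z) ^ (2 * k)) \<le> Y"
        unfolding Y_def by (rule flat_polynomial_moment[OF dim[OF m] dim0[OF m] k1])
    next
      fix c and f :: "complex ^ 'd \<Rightarrow> complex"
      assume P: "(LINT z|(surface_measure :: (complex ^ 'd) measure). norm (hpoly (N m) (L m) c z) ^ (2 * k)) \<le> Y" and f: "f \<in> Lp q"
      have "norm (ip f (hpoly (N m) (L m) c)) \<le> (1 + ?S + (LINT z|(surface_measure :: (complex ^ 'd) measure). norm (hpoly (N m) (L m) c z) ^ (2 * k))) * Lp_norm q f"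
        using a(3) by (intro dual_bound_finite[OF f _ qf hpoly_continuous k1 kr]) simp
      also have "\<dots> \<le> B * Lp_norm q f"
        unfolding B_def using P qf by (intro mult_right_mono add_mono) (auto simp: Lp_norm_def)
      finally show "norm (ip f (hpoly (N m) (L m) c)) \<le> B * Lp_norm q f" .
    qed (use a NL g0 B in auto)
    show ?thesis
    proof (intro exI[of _ "c1 / ((2 + ?S) * B)"] conjI allI impI)
      show "c1 / ((2 + ?S) * B) > 0" using c1(1) B S by simp
      fix m :: nat assume m: "2 \<le> m"
      have kap: "kappa p q m = 1" using a by (simp add: kappa_def)
      have "c1 / ((2 + ?S) * B) * (\<mu> m * kappa p q m) = c1 * \<mu> m / ((2 + ?S) * B)" unfolding kap by simp
      also have "\<dots> \<le> lambda1 \<gamma> \<xi> (real (N m)) / ((2 + ?S) * B)"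
        using c1(2)[OF m] B S by (intro divide_right_mono) auto
      finally show "ennreal (c1 / ((2 + ?S) * B) * (real m powr (- \<gamma> / (2 * real ?d - 1)) * ln (real m) powr (- \<xi>) * kappa p q m)) \<le> ?W m"
        unfolding \<mu>_def by (rule ennreal_le_trans_real[OF _ w[OF m]])
    qed
  next
    case b
    define k where "k = Suc (nat \<lceil>enn2real p\<rceil>)"
    have k1: "k \<ge> 1" by (simp add: k_def)
    have kp: "enn2real p \<le> real (2 * k)" 
      unfolding k_def by (rule order_trans[OF real_nat_ceiling_ge of_nat_mono[OF le_double_Suc(2)]])
    define Y where "Y = ?S * (96 * real k / ?S) ^ k"
    have Y0: "Y \<ge> 0" using S by (simp add: Y_def)
    define s where "s = 1 / (1 + ?S + Y)"
    have s: "s > 0" using S Y0 by (simp add: s_def)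
    have w: "ennreal (lambda1 \<gamma> \<xi> (real (N m)) * s / (2 + ?S)) \<le> ?W m" if m: "m \<ge> 2" for m
    proof (rule width_hilbert_case[where P = "\<lambda>c. (LINT z|(surface_measure :: (complex ^ 'd) measure). norm (hpoly (N m) (L m) c z) ^ (2 * k)) \<le> Y"])
      fix a show "\<exists>c. (\<Sum>\<iota>\<in>hindex TYPE('d) (N m) (L m). (norm (c \<iota>))\<^sup>2) = 1 \<and>
         (\<forall>j<m. (\<Sum>\<iota>\<in>hindex TYPE('d) (N m) (L m). a j \<iota> * c \<iota>) = (0::complex)) \<and>
         (LINT z|(surface_measure :: (complex ^ 'd) measure). norm (hpoly (N m) (L m) c z) ^ (2 * k)) \<le> Y"
        unfolding Y_def by (rule flat_polynomial_moment[OF dim[OF m] dim0[OF m] k1])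
    next
      fix c
      assume P: "(LINT z|(surface_measure :: (complex ^ 'd) measure). norm (hpoly (N m) (L m) c z) ^ (2 * k)) \<le> Y"
      show "(\<lambda>z. of_real s * (hpoly (N m) (L m) c (z :: complex ^ 'd))) \<in> Lp_unit_ball p"
        unfolding s_def by (rule moment_unit_ball[OF hpoly_continuous b(1,2) kp P])
    qed (use b NL g0 s in auto)
    show ?thesis
    proof (intro exI[of _ "c1 * s / (2 + ?S)"] conjI allI impI)
      show "c1 * s / (2 + ?S) > 0" using c1(1) s S by simp
      fix m :: nat assume m: "2 \<le> m"
      have "p < \<infinity>" using b(2) by (simp add: less_top)
      moreover have "q \<le> \<infinity>" by simp
      moreover have "p \<le> 2 \<or> 2 \<le> p" by (rule linear)
      ultimately have kap: "kappa p q m = 1" using b unfolding kappa_def by auto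
      have "c1 * s / (2 + ?S) * (\<mu> m * kappa p q m) = c1 * \<mu> m * s / (2 + ?S)" unfolding kap by simp
      also have "\<dots> \<le> lambda1 \<gamma> \<xi> (real (N m)) * s / (2 + ?S)"
        using c1(2)[OF m] s S by (intro divide_right_mono mult_right_mono) auto
      finally show "ennreal (c1 * s / (2 + ?S) * (real m powr (- \<gamma> / (2 * real ?d - 1)) * ln (real m) powr (- \<xi>) * kappa p q m)) \<le> ?W m"
        unfolding \<mu>_def by (rule ennreal_le_trans_real[OF _ w[OF m]])
    qed
  next
    case d
    have w: "ennreal (lambda1 \<gamma> \<xi> (real (N m)) / ((2 + ?S) * R m)) \<le> ?W m" if m: "m \<ge> 2" for m
    proof (rule width_dual_case[where P = "\<lambda>c. \<forall>z\<in>usph. norm (hpoly (N m) (L m) c (z :: complex ^ 'd)) \<le> R m"])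
      fix a show "\<exists>c. (\<Sum>\<iota>\<in>hindex TYPE('d) (N m) (L m). (norm (c \<iota>))\<^sup>2) = 1 \<and>
         (\<forall>j<m. (\<Sum>\<iota>\<in>hindex TYPE('d) (N m) (L m). a j \<iota> * c \<iota>) = (0::complex)) \<and>
         (\<forall>z\<in>usph. norm (hpoly (N m) (L m) c (z :: complex ^ 'd)) \<le> R m)"
        unfolding R_def by (rule flat_polynomial_sup[OF dim[OF m] dim0[OF m] N4[OF m] NL(2)])
    next
      fix c and f :: "complex ^ 'd \<Rightarrow> complex"
      assume P: "\<forall>z\<in>usph. norm (hpoly (N m) (L m) c (z :: complex ^ 'd)) \<le> R m" and f: "f \<in> Lp q"
      show "norm (ip f (hpoly (N m) (L m) c)) \<le> R m * Lp_norm q f"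
        using dual_bound_L1[OF _ hpoly_continuous, of f "N m" "L m" c "R m"] P f d(3) by simp
    qed (use d NL g0 R0 in auto)
    show ?thesis
    proof (intro exI[of _ "c1 * c2 / (2 + ?S)"] conjI allI impI)
      show "c1 * c2 / (2 + ?S) > 0" using c1(1) c2(1) S by simp
      fix m :: nat assume m: "2 \<le> m"
      have kap: "kappa p q m = ln (real m) powr (- 1 / 2)"
        using d by (simp add: kappa_def)
      have "c1 * c2 / (2 + ?S) * (\<mu> m * kappa p q m) = (c1 * \<mu> m) * (c2 * ln (real m) powr (- 1 / 2)) / (2 + ?S)"
        unfolding kap by simp
      also have "\<dots> \<le> lambda1 \<gamma> \<xi> (real (N m)) * (1 / R m) / (2 + ?S)"
        using c1 c2 m S R0[of m] \<mu>0[of m] unfolding R_def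
        by (intro divide_right_mono mult_mono) (auto simp: l0)
      also have "\<dots> = lambda1 \<gamma> \<xi> (real (N m)) / ((2 + ?S) * R m)" by (simp add: mult.commute)
      finally show "ennreal (c1 * c2 / (2 + ?S) * (real m powr (- \<gamma> / (2 * real ?d - 1)) * ln (real m) powr (- \<xi>) * kappa p q m)) \<le> ?W m"
        unfolding \<mu>_def by (rule ennreal_le_trans_real[OF _ w[OF m]])
    qed
  next
    case e
    have w: "ennreal (lambda1 \<gamma> \<xi> (real (N m)) * (1 / R m) / (2 + ?S)) \<le> ?W m" if m: "m \<ge> 2" for m
    proof (rule width_hilbert_case[where P = "\<lambda>c. \<forall>z\<in>usph. norm (hpoly (N m) (L m) c (z :: complex ^ 'd)) \<le> R m"])
      fix a show "\<exists>c. (\<Sum>\<iota>\<in>hindex TYPE('d) (N m) (L m). (norm (c \<iota>))\<^sup>2) = 1 \<and>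
         (\<forall>j<m. (\<Sum>\<iota>\<in>hindex TYPE('d) (N m) (L m). a j \<iota> * c \<iota>) = (0::complex)) \<and>
         (\<forall>z\<in>usph. norm (hpoly (N m) (L m) c (z :: complex ^ 'd)) \<le> R m)"
        unfolding R_def by (rule flat_polynomial_sup[OF dim[OF m] dim0[OF m] N4[OF m] NL(2)])
    next
      fix c
      assume P: "\<forall>z\<in>usph. norm (hpoly (N m) (L m) c (z :: complex ^ 'd)) \<le> R m"
      show "(\<lambda>z. of_real (1 / R m) * (hpoly (N m) (L m) c (z :: complex ^ 'd))) \<in> Lp_unit_ball p"
        unfolding e(1) by (rule sup_unit_ball[OF hpoly_continuous R0]) (use P in blast)
    qed (use e NL g0 R0 in auto)
    show ?thesis
    proof (intro exI[of _ "c1 * c2 / (2 + ?S)"] conjI allI impI)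
      show "c1 * c2 / (2 + ?S) > 0" using c1(1) c2(1) S by simp
      fix m :: nat assume m: "2 \<le> m"
      have kap: "kappa p q m = ln (real m) powr (- 1 / 2)"
        using e by (simp add: kappa_def top_unique)
      have "c1 * c2 / (2 + ?S) * (\<mu> m * kappa p q m) = (c1 * \<mu> m) * (c2 * ln (real m) powr (- 1 / 2)) / (2 + ?S)"
        unfolding kap by simp
      also have "\<dots> \<le> lambda1 \<gamma> \<xi> (real (N m)) * (1 / R m) / (2 + ?S)"
        using c1 c2 m S R0[of m] \<mu>0[of m] unfolding R_def
        by (intro divide_right_mono mult_mono) (auto simp: l0)
      finally show "ennreal (c1 * c2 / (2 + ?S) * (real m powr (- \<gamma> / (2 * real ?d - 1)) * ln (real m) powr (- \<xi>) * kappa p q m)) \<le> ?W m"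
        unfolding \<mu>_def by (rule ennreal_le_trans_real[OF _ w[OF m]])
    qed
  qed
qed

end
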